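(* Let $(\mathcal{M},\tau)$ be a tracial $W^*$-probability space and $X=(X_1,\dots,X_n)$ a tuple of (not necessarily selfadjoint) elements of $\mathcal{M}$. Then the following are equivalent. (i) $\Delta(X)=n$. (ii) For any $N\in\mathbb{N}$ and any linear matrix $A\in M_N(\mathbb{C}\langle x_1,\dots,x_n\rangle)$: if there are $f\in\ker A(X)$ and $e\in\ker A(X)^*$ such that both $e$ and $f$ have $\mathbb{C}$-linearly independent components, then $A=0$. (iii) For any $N\in\mathbb{N}$ and any linear full matrix $A\in M_N(\mathbb{C}\langle x_1,\dots,x_n\rangle)$: $\ker A(X)=\{0\}$.
   Context: Tracial $W^*$-probability space: a von Neumann algebra $\mathcal{M}$ with a faithful normal tracial state $\tau$; $\mathcal{M}$ acts on $L^2(\mathcal{M},\tau)$ by left multiplication, and matrices in $M_N(\mathcal{M})$ act on $L^2(\mathcal{M},\tau)^N$. For $f=(f_1,\dots,f_N)\in L^2(\mathcal{M},\tau)^N$, the components of $f$ are $f_1,\dots,f_N$. $\mathbb{C}\langle x_1,\dots,x_n\rangle$ is the unital free algebra of noncommutative polynomials. A matrix $A\in M_N(\mathbb{C}\langle x_1,\dots,x_n\rangle)$ is linear if $A=A_0+A_1x_1+\dots+A_nx_n$ with $A_0,\dots,A_n\in M_N(\mathbb{C})$; $A(X)\in M_N(\mathcal{M})$ is obtained by replacing each $x_i$ by $X_i$. $A\in M_N(\mathbb{C}\langle x_1,\dots,x_n\rangle)$ is full if it is nonzero and cannot be written as $A=BC$ with $B$ of size $N\times r$ and $C$ of size $r\times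 N$ over $\mathbb{C}\langle x_1,\dots,x_n\rangle$ and $r<N$. $\Delta$: let $\mathcal{F}(L^2(\mathcal{M},\tau))$ be the finite rank operators on $L^2(\mathcal{M},\tau)$ and $J$ the conjugate-linear isometry of $L^2(\mathcal{M},\tau)$ extending $x\mapsto x^*$ on $\mathcal{M}$. Then $$\Delta(X):=n-\dim_{\mathcal{M}\overline{\otimes}\mathcal{M}^{\mathrm{op}}}\overline{\Big\{(T_1,\dots,T_n)\in\mathcal{F}(L^2(\mathcal{M},\tau))^n : \sum_{j=1}^n[T_j,JX_jJ]=0\Big\}}^{\mathrm{HS}},$$ where the closure is in Hilbert–Schmidt norm and $\dim$ is the Murray–von Neumann dimension for the action $(a\otimes b^{\mathrm{op}})\cdot T=aTb$ of $\mathcal{M}\overline{\otimes}\mathcal{M}^{\mathrm{op}}$ on Hilbert–Schmidt operators (normalized so that the space of all Hilbert–Schmidt operators on $L^2(\mathcal{M},\tau)$ has dimension $1$). *)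

theory Defs
  imports
    "HOL-Analysis.Inner_Product"
    "HOL-Analysis.Infinite_Sum"
    "HOL-Library.Poly_Mapping"
    "Jordan_Normal_Form.Matrix"
begin

section \<open>Complex Hilbert spaces and bounded operators\<close>

text \<open>The inner product \<open>cinner\<close> is linear in its first and conjugate-linear in its second
  argument.  Positivity and the norm come from the underlying real Hilbert space structure.\<close>

class complex_hilbert = real_inner + complete_space +
  fixes scaleC :: "complex \<Rightarrow> 'a \<Rightarrow> 'a" (infixr "*\<^sub>C" 75)
    and cinner :: "'a \<Rightarrow> 'a \<Rightarrow> complex"
  assumes scaleC_add_right: "c *\<^sub>C (x + y) = c *\<^sub>C x + c *\<^sub>C y"
    and scaleC_add_left: "(c + d) *\<^sub>C x = c *\<^sub>C x + d *\<^sub>C x"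
    and scaleC_scaleC: "c *\<^sub>C (d *\<^sub>C x) = (c * d) *\<^sub>C x"
    and scaleC_of_real: "complex_of_real r *\<^sub>C x = r *\<^sub>R x"
    and cinner_add_left: "cinner (x + y) z = cinner x z + cinner y z"
    and cinner_scaleC_left: "cinner (c *\<^sub>C x) y = c * cinner x y"
    and cinner_commute: "cinner x y = cnj (cinner y x)"
    and inner_eq_Re_cinner: "inner x y = Re (cinner x y)"

interpretation complex_vector: vector_space "scaleC :: complex \<Rightarrow> 'a \<Rightarrow> 'a::complex_hilbert"
proof
  show "1 *\<^sub>C x = x" for x :: 'a
    using scaleC_of_real[of 1 x] by simp
qed (simp_all add: scaleC_add_right scaleC_add_left scaleC_scaleC)

instantiation complex :: complex_hilbert
begin
definition scaleC_complex :: "complex \<Rightarrow> complex \<Rightarrow> complex" where "scaleC_complex c x = c * x"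
definition cinner_complex :: "complex \<Rightarrow> complex \<Rightarrow> complex" where "cinner_complex x y = x * cnj y"
instance
  by standard
    (auto simp: scaleC_complex_def cinner_complex_def inner_complex_def algebra_simps
      scaleR_conv_of_real)
end

definition bounded_clinear :: "('a::complex_hilbert \<Rightarrow> 'b::complex_hilbert) \<Rightarrow> bool" where
  "bounded_clinear f \<longleftrightarrow> bounded_linear f \<and> (\<forall>c x. f (c *\<^sub>C x) = c *\<^sub>C f x)"

definition cadj :: "('a::complex_hilbert \<Rightarrow> 'a) \<Rightarrow> 'a \<Rightarrow> 'a" where
  "cadj f = (THE g. \<forall>x y. cinner (f x) y = cinner x (g y))"

definition commutant :: "('a::complex_hilbert \<Rightarrow> 'a) set \<Rightarrow> ('a \<Rightarrow> 'a) set" where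
  "commutant S = {b. bounded_clinear b \<and> (\<forall>a\<in>S. a \<circ> b = b \<circ> a)}"

definition von_neumann_algebra :: "('a::complex_hilbert \<Rightarrow> 'a) set \<Rightarrow> bool" where
  "von_neumann_algebra M \<longleftrightarrow>
     (\<forall>a\<in>M. bounded_clinear a) \<and> (\<forall>a\<in>M. cadj a \<in> M) \<and> commutant (commutant M) = M"


section \<open>Tracial W*-probability spaces\<close>

definition self_adjoint_part :: "('a::complex_hilbert \<Rightarrow> 'a) set \<Rightarrow> ('a \<Rightarrow> 'a) set" where
  "self_adjoint_part M = {a \<in> M. cadj a = a}"

definition op_le :: "('a::complex_hilbert \<Rightarrow> 'a) \<Rightarrow> ('a \<Rightarrow> 'a) \<Rightarrow> bool" where
  "op_le a b \<longleftrightarrow> (\<forall>x. Re (cinner (a x) x) \<le> Re (cinner (b x) x))"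

definition normal_on ::
  "('a::complex_hilbert \<Rightarrow> 'a) set \<Rightarrow> (('a \<Rightarrow> 'a) \<Rightarrow> complex) \<Rightarrow> bool" where
  "normal_on M \<tau> \<longleftrightarrow>
     (\<forall>D s. D \<subseteq> self_adjoint_part M \<and> D \<noteq> {} \<and>
        (\<forall>a\<in>D. \<forall>b\<in>D. \<exists>c\<in>D. op_le a c \<and> op_le b c) \<and>
        s \<in> self_adjoint_part M \<and> (\<forall>a\<in>D. op_le a s) \<and>
        (\<forall>t\<in>self_adjoint_part M. (\<forall>a\<in>D. op_le a t) \<longrightarrow> op_le s t)
      \<longrightarrow> Re (\<tau> s) = (SUP a\<in>D. Re (\<tau> a)))"

text \<open>Only the values of \<open>\<tau>\<close> on \<open>M\<close> matter.\<close>

definition tracial_Wstar_space ::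
  "('a::complex_hilbert \<Rightarrow> 'a) set \<Rightarrow> (('a \<Rightarrow> 'a) \<Rightarrow> complex) \<Rightarrow> bool" where
  "tracial_Wstar_space M \<tau> \<longleftrightarrow>
     von_neumann_algebra M \<and>
     (\<forall>a\<in>M. \<forall>b\<in>M. \<tau> (\<lambda>x. a x + b x) = \<tau> a + \<tau> b) \<and>
     (\<forall>a\<in>M. \<forall>c. \<tau> (\<lambda>x. c *\<^sub>C a x) = c * \<tau> a) \<and>
     \<tau> id = 1 \<and>
     (\<forall>a\<in>M. Im (\<tau> (cadj a \<circ> a)) = 0 \<and> 0 \<le> Re (\<tau> (cadj a \<circ> a))) \<and>
     (\<forall>a\<in>M. \<forall>b\<in>M. \<tau> (a \<circ> b) = \<tau> (b \<circ> a)) \<and>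
     (\<forall>a\<in>M. \<tau> (cadj a \<circ> a) = 0 \<longrightarrow> a = (\<lambda>x. 0)) \<and>
     normal_on M \<tau>"

text \<open>\<open>is_L2 M \<tau> \<iota>\<close>: the Hilbert space \<open>'h\<close> together with \<open>\<iota>\<close> is \<open>L\<^sup>2(M,\<tau>)\<close>, i.e. the completion
  of \<open>M\<close> for the inner product \<open>\<tau>(b* a)\<close>; \<open>\<iota>\<close> is the canonical inclusion of \<open>M\<close>.  This
  determines the pair up to unitary equivalence.\<close>

definition is_L2 ::
  "('k::complex_hilbert \<Rightarrow> 'k) set \<Rightarrow> (('k \<Rightarrow> 'k) \<Rightarrow> complex) \<Rightarrow>
   (('k \<Rightarrow> 'k) \<Rightarrow> 'h::complex_hilbert) \<Rightarrow> bool" where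
  "is_L2 M \<tau> \<iota> \<longleftrightarrow>
     (\<forall>a\<in>M. \<forall>b\<in>M. \<iota> (\<lambda>x. a x + b x) = \<iota> a + \<iota> b) \<and>
     (\<forall>a\<in>M. \<forall>c. \<iota> (\<lambda>x. c *\<^sub>C a x) = c *\<^sub>C \<iota> a) \<and>
     (\<forall>a\<in>M. \<forall>b\<in>M. cinner (\<iota> a) (\<iota> b) = \<tau> (cadj b \<circ> a)) \<and>
     closure (\<iota> ` M) = UNIV"

definition L2_left ::
  "('k::complex_hilbert \<Rightarrow> 'k) set \<Rightarrow> (('k \<Rightarrow> 'k) \<Rightarrow> 'h::complex_hilbert) \<Rightarrow> ('k \<Rightarrow> 'k) \<Rightarrow> 'h \<Rightarrow> 'h"
  where
  "L2_left M \<iota> a = (THE L. bounded_clinear L \<and> (\<forall>b\<in>M. L (\<iota> b) = \<iota> (a \<circ> b)))"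

definition L2_J ::
  "('k::complex_hilbert \<Rightarrow> 'k) set \<Rightarrow> (('k \<Rightarrow> 'k) \<Rightarrow> 'h::complex_hilbert) \<Rightarrow> 'h \<Rightarrow> 'h" where
  "L2_J M \<iota> = (THE J. (\<forall>x y. J (x + y) = J x + J y) \<and> (\<forall>c x. J (c *\<^sub>C x) = cnj c *\<^sub>C J x) \<and>
                      (\<forall>x. norm (J x) = norm x) \<and> (\<forall>a\<in>M. J (\<iota> a) = \<iota> (cadj a)))"


section \<open>Finite rank and Hilbert--Schmidt operators\<close>

definition finite_rank :: "('h::complex_hilbert \<Rightarrow> 'h) \<Rightarrow> bool" where
  "finite_rank T \<longleftrightarrow>
     bounded_clinear T \<and> (\<exists>B. finite B \<and> range T \<subseteq> complex_vector.span B)"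

definition is_onb :: "'h::complex_hilbert set \<Rightarrow> bool" where
  "is_onb B \<longleftrightarrow> (\<forall>e\<in>B. \<forall>f\<in>B. cinner e f = (if e = f then 1 else 0)) \<and>
                (\<forall>v. (\<forall>e\<in>B. cinner v e = 0) \<longrightarrow> v = 0)"

text \<open>The notions below do not depend on the choice of the orthonormal basis.\<close>

definition onb :: "'h::complex_hilbert set" where
  "onb = (SOME B. is_onb B)"

definition hilbert_schmidt :: "('h::complex_hilbert \<Rightarrow> 'h) \<Rightarrow> bool" where
  "hilbert_schmidt T \<longleftrightarrow> bounded_clinear T \<and> (\<lambda>e. (norm (T e))\<^sup>2) summable_on onb"

definition hs_inner :: "('h::complex_hilbert \<Rightarrow> 'h) \<Rightarrow> ('h \<Rightarrow> 'h) \<Rightarrow> complex" where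
  "hs_inner S T = (\<Sum>\<^sub>\<infinity>e\<in>onb. cinner (S e) (T e))"

text \<open>Tuples of operators are indexed by a finite type \<open>'n\<close>, so \<open>n\<close> is the cardinality of \<open>'n\<close>.\<close>

definition hs_tuple_inner ::
  "('n::finite \<Rightarrow> 'h::complex_hilbert \<Rightarrow> 'h) \<Rightarrow> ('n \<Rightarrow> 'h \<Rightarrow> 'h) \<Rightarrow> complex" where
  "hs_tuple_inner S T = (\<Sum>j\<in>UNIV. hs_inner (S j) (T j))"

definition hs_tuple_dist ::
  "('n::finite \<Rightarrow> 'h::complex_hilbert \<Rightarrow> 'h) \<Rightarrow> ('n \<Rightarrow> 'h \<Rightarrow> 'h) \<Rightarrow> real" where
  "hs_tuple_dist S T = sqrt (Re (hs_tuple_inner (\<lambda>j v. S j v - T j v) (\<lambda>j v. S j v - T j v)))"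

definition hs_closure ::
  "('n::finite \<Rightarrow> 'h::complex_hilbert \<Rightarrow> 'h) set \<Rightarrow> ('n \<Rightarrow> 'h \<Rightarrow> 'h) set" where
  "hs_closure V =
     {S. (\<forall>j. hilbert_schmidt (S j)) \<and> (\<forall>\<epsilon>>0. \<exists>T\<in>V. hs_tuple_dist S T < \<epsilon>)}"

definition hs_proj ::
  "('n::finite \<Rightarrow> 'h::complex_hilbert \<Rightarrow> 'h) set \<Rightarrow> ('n \<Rightarrow> 'h \<Rightarrow> 'h) \<Rightarrow> ('n \<Rightarrow> 'h \<Rightarrow> 'h)" where
  "hs_proj V S = (THE P. P \<in> V \<and> (\<forall>T\<in>V. hs_tuple_inner (\<lambda>j v. S j v - P j v) T = 0))"


section \<open>Murray--von Neumann dimension and \<open>\<Delta>\<close>\<close>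

text \<open>Write \<open>N\<close> for the von Neumann algebra tensor product of \<open>M\<close> and \<open>M\<^sup>o\<^sup>p\<close>, acting on the
  Hilbert--Schmidt operators by \<open>(a \<otimes> b\<^sup>o\<^sup>p) T = a T b\<close>, and \<open>p\<close> for the rank one projection onto
  the span of the trace vector \<open>\<iota> id\<close>.  Since \<open>p\<close> is cyclic and
  \<open>\<langle>a p b, p\<rangle> = \<tau> a * \<tau> b\<close>, the map \<open>a \<otimes> b\<^sup>o\<^sup>p \<mapsto> a p b\<close> extends to an \<open>N\<close>-linear unitary from
  \<open>L\<^sup>2(N)\<close> onto the Hilbert--Schmidt operators, with \<open>p\<close> the image of the unit.

  The Murray--von Neumann dimension of a closed \<open>N\<close>-submodule \<open>V\<close> of \<open>L\<^sup>2(N)\<^sup>n\<close> is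
  \<open>(Tr\<^sub>n \<otimes> \<tau>')(P\<^sub>V)\<close>, where the orthogonal projection \<open>P\<^sub>V\<close> onto \<open>V\<close> is an \<open>n \<times> n\<close> matrix over the
  commutant \<open>N'\<close> and \<open>\<tau>'(Y) = \<langle>Y p, p\<rangle>\<close> is the canonical trace on \<open>N'\<close>.\<close>

definition trace_proj ::
  "(('k::complex_hilbert \<Rightarrow> 'k) \<Rightarrow> 'h::complex_hilbert) \<Rightarrow> 'h \<Rightarrow> 'h" where
  "trace_proj \<iota> = (\<lambda>v. cinner v (\<iota> id) *\<^sub>C \<iota> id)"

definition commutant_trace ::
  "(('k::complex_hilbert \<Rightarrow> 'k) \<Rightarrow> 'h::complex_hilbert) \<Rightarrow> (('h \<Rightarrow> 'h) \<Rightarrow> ('h \<Rightarrow> 'h)) \<Rightarrow> complex" where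
  "commutant_trace \<iota> Y = hs_inner (Y (trace_proj \<iota>)) (trace_proj \<iota>)"

definition matrix_entry ::
  "(('n \<Rightarrow> 'h::complex_hilbert \<Rightarrow> 'h) \<Rightarrow> ('n \<Rightarrow> 'h \<Rightarrow> 'h)) \<Rightarrow> 'n \<Rightarrow> 'n \<Rightarrow> ('h \<Rightarrow> 'h) \<Rightarrow> ('h \<Rightarrow> 'h)" where
  "matrix_entry P i j T = P (\<lambda>k. if k = j then T else (\<lambda>v. 0)) i"

definition MvN_dim ::
  "(('k::complex_hilbert \<Rightarrow> 'k) \<Rightarrow> 'h::complex_hilbert) \<Rightarrow> ('n::finite \<Rightarrow> 'h \<Rightarrow> 'h) set \<Rightarrow> real" where
  "MvN_dim \<iota> V = Re (\<Sum>j\<in>UNIV. commutant_trace \<iota> (matrix_entry (hs_proj V) j j))"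

definition commutator :: "('h::complex_hilbert \<Rightarrow> 'h) \<Rightarrow> ('h \<Rightarrow> 'h) \<Rightarrow> 'h \<Rightarrow> 'h" where
  "commutator S T = (\<lambda>v. S (T v) - T (S v))"

definition finite_rank_relations ::
  "('k::complex_hilbert \<Rightarrow> 'k) set \<Rightarrow> (('k \<Rightarrow> 'k) \<Rightarrow> 'h::complex_hilbert) \<Rightarrow> ('n::finite \<Rightarrow> 'k \<Rightarrow> 'k) \<Rightarrow>
   ('n \<Rightarrow> 'h \<Rightarrow> 'h) set" where
  "finite_rank_relations M \<iota> X =
     {T. (\<forall>j. finite_rank (T j)) \<and>
         (\<forall>v. (\<Sum>j\<in>UNIV. commutator (T j) (L2_J M \<iota> \<circ> L2_left M \<iota> (X j) \<circ> L2_J M \<iota>) v) = 0)}"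

definition Delta ::
  "('k::complex_hilbert \<Rightarrow> 'k) set \<Rightarrow> (('k \<Rightarrow> 'k) \<Rightarrow> 'h::complex_hilbert) \<Rightarrow> ('n::finite \<Rightarrow> 'k \<Rightarrow> 'k) \<Rightarrow>
   real" where
  "Delta M \<iota> X = real (card (UNIV :: 'n set)) - MvN_dim \<iota> (hs_closure (finite_rank_relations M \<iota> X))"


section \<open>Noncommutative polynomials and their matrices\<close>

text \<open>The free monoid on \<open>'n\<close>, written additively because multiplication of type
  \<open>_ \<Rightarrow>\<^sub>0 _\<close> is convolution with respect to addition of exponents.  Thus \<open>'n ncpoly\<close>
  is the monoid algebra of the free monoid, i.e. the free unital algebra on the
  generators indexed by \<open>'n\<close>.\<close>

datatype 'n free_word = Word (letters: "'n list")

instantiation free_word :: (type) monoid_add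
begin
definition zero_free_word :: "'a free_word" where "zero_free_word = Word []"
definition plus_free_word :: "'a free_word \<Rightarrow> 'a free_word \<Rightarrow> 'a free_word" where
  "plus_free_word u w = Word (letters u @ letters w)"
instance
  by standard (auto simp: zero_free_word_def plus_free_word_def)
end

type_synonym 'n ncpoly = "'n free_word \<Rightarrow>\<^sub>0 complex"

definition nc_const :: "complex \<Rightarrow> 'n ncpoly" where
  "nc_const c = Poly_Mapping.single 0 c"

definition nc_var :: "'n \<Rightarrow> 'n ncpoly" where
  "nc_var i = Poly_Mapping.single (Word [i]) 1"

definition nc_eval :: "('n \<Rightarrow> 'k::complex_hilbert \<Rightarrow> 'k) \<Rightarrow> 'n ncpoly \<Rightarrow> 'k \<Rightarrow> 'k" where
  "nc_eval X p = (\<lambda>v. \<Sum>w\<in>Poly_Mapping.keys p.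
     Poly_Mapping.lookup p w *\<^sub>C foldr (\<lambda>i f. X i \<circ> f) (letters w) id v)"

definition linear_nc_mat :: "nat \<Rightarrow> 'n::finite ncpoly mat \<Rightarrow> bool" where
  "linear_nc_mat N A \<longleftrightarrow>
     (\<exists>A0 A1. A0 \<in> carrier_mat N N \<and> (\<forall>i. A1 i \<in> carrier_mat N N) \<and>
        A = mat N N (\<lambda>(k, l). nc_const (A0 $$ (k, l)) +
                              (\<Sum>i\<in>UNIV. nc_const (A1 i $$ (k, l)) * nc_var i)))"

definition full_mat :: "nat \<Rightarrow> 'n ncpoly mat \<Rightarrow> bool" where
  "full_mat N A \<longleftrightarrow> A \<in> carrier_mat N N \<and> A \<noteq> 0\<^sub>m N N \<and>
     \<not> (\<exists>r<N. \<exists>B\<in>carrier_mat N r. \<exists>C\<in>carrier_mat r N. A = B * C)"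

definition nc_eval_mat ::
  "('n \<Rightarrow> 'k::complex_hilbert \<Rightarrow> 'k) \<Rightarrow> 'n ncpoly mat \<Rightarrow> ('k \<Rightarrow> 'k) mat" where
  "nc_eval_mat X A = map_mat (nc_eval X) A"

definition op_mat_adj :: "('k::complex_hilbert \<Rightarrow> 'k) mat \<Rightarrow> ('k \<Rightarrow> 'k) mat" where
  "op_mat_adj B = mat (dim_col B) (dim_row B) (\<lambda>(k, l). cadj (B $$ (l, k)))"

definition L2_mat_ker ::
  "('k::complex_hilbert \<Rightarrow> 'k) set \<Rightarrow> (('k \<Rightarrow> 'k) \<Rightarrow> 'h::complex_hilbert) \<Rightarrow> ('k \<Rightarrow> 'k) mat \<Rightarrow>
   'h vec set" where
  "L2_mat_ker M \<iota> B =
     {f \<in> carrier_vec (dim_col B).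
        \<forall>k<dim_row B. (\<Sum>l<dim_col B. L2_left M \<iota> (B $$ (k, l)) (f $ l)) = 0}"

definition lin_indep_components :: "'h::complex_hilbert vec \<Rightarrow> bool" where
  "lin_indep_components f \<longleftrightarrow>
     (\<forall>c :: nat \<Rightarrow> complex. (\<Sum>i<dim_vec f. c i *\<^sub>C (f $ i)) = 0 \<longrightarrow> (\<forall>i<dim_vec f. c i = 0))"

end

theory Submission
  imports Defs "HOL-Analysis.Analysis"
begin

text \<open>All three conditions say that the operators \<open>X\<^sub>j\<close>, acting on the \<open>L\<^sup>2\<close>-space by left multiplication,
  satisfy no nontrivial relation \<open>\<Sum>\<^sub>j [T\<^sub>j, X\<^sub>j] = 0\<close> with operators \<open>T\<^sub>j\<close> of finite rank.

  For (i), the dimension of the closure of the relations is \<open>\<Sum>\<^sub>j \<parallel>P E\<^sub>j\<parallel>\<^sup>2\<close>, where \<open>P\<close> is the orthogonal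
  projection onto it and \<open>E\<^sub>j\<close> has the trace projection in position \<open>j\<close>.  If it vanishes, the relations
  are orthogonal to all \<open>E\<^sub>j\<close>.  Since they form a bimodule over the algebra, for which the trace
  projection is cyclic, they are all zero (\<open>Delta_eq_card_iff\<close>).  Conjugation by \<open>J\<close> replaces the
  operators \<open>J X\<^sub>j J\<close> in the definition of \<open>\<Delta>\<close> by the \<open>X\<^sub>j\<close>.

  The link to linear matrices is a dictionary between relations and kernels.  If \<open>A(X) f = 0\<close> and
  \<open>A(X)* e = 0\<close>, then the operators \<open>T\<^sub>j = \<Sum>\<^sub>k\<^sub>l (A\<^sub>j)\<^sub>k\<^sub>l \<langle>-, e\<^sub>k\<rangle> f\<^sub>l\<close> satisfy \<open>\<Sum>\<^sub>j [T\<^sub>j, X\<^sub>j] = 0\<close>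
  (\<open>relation_of_kernels\<close>).  Conversely, the matrices of the \<open>T\<^sub>j\<close> in an orthonormal basis of a space that
  contains all their ranges and coranges are the coefficients of a linear matrix that has this basis
  in both kernels (\<open>relations_trivial_if_indep_kernels\<close>).  So (ii) excludes relations.

  In the absence of relations, let a linear matrix of size \<open>N\<close> have a kernel.  Scalar column operations
  restrict it to \<open>t\<close> columns on which the kernel satisfies no linear relation, and row operations
  single out \<open>s\<close> rows on which the same holds for the kernel of the adjoint.  The dictionary shows that
  the corresponding \<open>s \<times> t\<close> block vanishes.  If the matrix is full, then \<open>s + t \<le> N\<close>, so the \<open>N \<times> t\<close>
  matrix has an adjoint whose kernel occupies at most \<open>N - t\<close> coordinates; as matrices over a tracial
  algebra form a finite algebra, the \<open>N \<times> t\<close> matrix is injective, which contradicts the choice of \<open>t\<close>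
  unless \<open>t = 0\<close> (\<open>trivial_pker_if_relations_trivial\<close>).  This proves (iii).  Finiteness is needed in the
  form that \<open>C\<close> is injective if \<open>C*\<close> is.  It follows from the equality of the traces of the powers of
  \<open>1 - \<delta> C C*\<close> and of \<open>1 - \<delta> C* C\<close>, as these powers converge strongly to the projections onto the two
  kernels (\<open>matrix_injective_if_adjoint_injective\<close>).

  From (iii) to (ii), a theorem of Cohn identifies fullness of a linear matrix with the absence of an
  oversized zero block, of size \<open>s \<times> t\<close> with \<open>s + t > N\<close>, in all equivalent matrices
  (\<open>full_lin_mat_iff\<close>); its proof is the weak algorithm of the free algebra (\<open>degree_reduction\<close>).  In this
  combinatorial form (iii) extends to rectangular matrices by deleting rows or splitting along a zero
  block (\<open>trivial_pker_if_not_hollow\<close>).  Given independent kernel vectors on both sides, the blocks next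
  to a maximal zero block would be injective, which is impossible unless the zero block is everything
  (\<open>pencil_zero_if_indep_kernels\<close>).

  The boundedness of left multiplications on the \<open>L\<^sup>2\<close>-space rests on square roots in the algebra, which
  are fixed points of a contraction (\<open>von_neumann_algebra_sqrt\<close>).  Projections onto closed spaces of
  Hilbert--Schmidt tuples come from the completeness of the space of these tuples.\<close>

section \<open>Geometry of complex Hilbert spaces\<close>

instance complex_hilbert \<subseteq> banach by standard

lemma cinner_add_right: "cinner x (y + z) = cinner x y + cinner x z"
  for x :: "'a::complex_hilbert"
  by (metis cinner_add_left cinner_commute complex_cnj_add)

lemma cinner_scaleC_right: "cinner x (c *\<^sub>C y) = cnj c * cinner x y"
  for x :: "'a::complex_hilbert"
  by (metis cinner_commute cinner_scaleC_left complex_cnj_mult)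

lemma scaleC_simps [simp]:
  fixes x :: "'a::complex_hilbert"
  shows "0 *\<^sub>C x = 0" "1 *\<^sub>C x = x" "c *\<^sub>C (0::'a) = 0" "(-1) *\<^sub>C x = - x"
    "(- c) *\<^sub>C x = - (c *\<^sub>C x)" "c *\<^sub>C (- x) = - (c *\<^sub>C x)"
  by (simp_all add: complex_vector.scale_minus_left complex_vector.scale_minus_right)

lemma cinner_zero [simp]: "cinner 0 x = 0" "cinner x 0 = 0" for x :: "'a::complex_hilbert"
  using cinner_scaleC_left[of 0 x x] cinner_scaleC_right[of x 0 x] by simp_all

lemma cinner_minus [simp]: "cinner (- x) y = - cinner x y" "cinner x (- y) = - cinner x y"
  for x :: "'a::complex_hilbert"
  using cinner_scaleC_left[of "-1" x y] cinner_scaleC_right[of x "-1" y] by simp_all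

lemma cinner_diff_left: "cinner (x - y) z = cinner x z - cinner y z" for x :: "'a::complex_hilbert"
  using cinner_add_left[of x "- y" z] by simp

lemma cinner_diff_right: "cinner x (y - z) = cinner x y - cinner x z" for x :: "'a::complex_hilbert"
  using cinner_add_right[of x y "- z"] by simp

lemma cinner_sum_left: "cinner (sum f A) y = (\<Sum>i\<in>A. cinner (f i) y)" for y :: "'a::complex_hilbert"
  by (induction A rule: infinite_finite_induct) (auto simp: cinner_add_left)

lemma cinner_sum_right: "cinner y (sum f A) = (\<Sum>i\<in>A. cinner y (f i))" for y :: "'a::complex_hilbert"
  by (induction A rule: infinite_finite_induct) (auto simp: cinner_add_right)

lemma cinner_self: "cinner x x = complex_of_real ((norm x)\<^sup>2)" for x :: "'a::complex_hilbert"
proof -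
  have "cinner x x = cnj (cinner x x)" by (rule cinner_commute)
  then have "Im (cinner x x) = 0" by (simp add: complex_eq_iff)
  then show ?thesis
    by (simp add: complex_eq_iff inner_eq_Re_cinner[symmetric] power2_norm_eq_inner)
qed

lemma cinner_self_eq_0 [simp]: "cinner x x = 0 \<longleftrightarrow> x = 0" for x :: "'a::complex_hilbert"
  by (simp add: cinner_self)

lemma cinner_eqI_right: "(\<And>z. cinner z x = cinner z y) \<Longrightarrow> x = y" for x :: "'a::complex_hilbert"
  by (metis cinner_diff_right cinner_self_eq_0 eq_iff_diff_eq_0)

lemma norm_scaleC [simp]: "norm (c *\<^sub>C x) = cmod c * norm x" for x :: "'a::complex_hilbert"
proof -
  have "complex_of_real ((norm (c *\<^sub>C x))\<^sup>2) = (c * cnj c) * complex_of_real ((norm x)\<^sup>2)"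
    by (simp only: cinner_self[symmetric] cinner_scaleC_left cinner_scaleC_right mult_ac)
  also have "\<dots> = complex_of_real ((cmod c * norm x)\<^sup>2)"
    by (simp add: complex_mult_cnj cmod_power2 power_mult_distrib)
  finally have "(norm (c *\<^sub>C x))\<^sup>2 = (cmod c * norm x)\<^sup>2" using of_real_eq_iff by blast
  then show ?thesis by (simp add: power2_eq_iff_nonneg)
qed

lemma scaleC_diff_right: "c *\<^sub>C (x - y) = c *\<^sub>C x - c *\<^sub>C y" for x :: "'a::complex_hilbert"
  by (rule complex_vector.scale_right_diff_distrib)

lemma scaleC_sum_right: "c *\<^sub>C (sum f A) = (\<Sum>i\<in>A. c *\<^sub>C (f i :: 'a::complex_hilbert))"
  by (rule complex_vector.scale_sum_right)

lemma scaleC_sum_left: "(sum f A) *\<^sub>C x = (\<Sum>i\<in>A. f i *\<^sub>C (x :: 'a::complex_hilbert))"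
  by (rule complex_vector.scale_sum_left)

lemma scaleC_eq_0 [simp]: "c *\<^sub>C x = 0 \<longleftrightarrow> c = 0 \<or> x = 0" for x :: "'a::complex_hilbert"
  by (rule complex_vector.scale_eq_0_iff)

text \<open>Rotating the first argument by the phase of the inner product reduces the complex
  Cauchy--Schwarz inequality to the real one.\<close>

lemma cinner_Cauchy_Schwarz: "cmod (cinner x y) \<le> norm x * norm y" for x :: "'a::complex_hilbert"
proof -
  define c where "c = cnj (sgn (cinner x y))"
  have "c * cinner x y = complex_of_real (cmod (cinner x y))"
    by (simp add: c_def sgn_eq complex_norm_square[symmetric] mult.commute power2_eq_square)
  then have "cmod (cinner x y) = inner (c *\<^sub>C x) y"
    by (simp add: inner_eq_Re_cinner cinner_scaleC_left)
  also have "\<dots> \<le> norm (c *\<^sub>C x) * norm y" by (rule norm_cauchy_schwarz)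
  also have "\<dots> \<le> norm x * norm y"
    by (intro mult_right_mono) (auto simp: c_def norm_sgn)
  finally show ?thesis .
qed

lemma bounded_bilinear_cinner:
  "bounded_bilinear (cinner :: 'a::complex_hilbert \<Rightarrow> 'a \<Rightarrow> complex)"
proof
  show "\<exists>K. \<forall>a b :: 'a. cmod (cinner a b) \<le> norm a * norm b * K"
    by (rule exI[of _ 1]) (simp add: cinner_Cauchy_Schwarz)
next
  fix r and a b :: 'a
  show "cinner (r *\<^sub>R a) b = r *\<^sub>R cinner a b"
    by (simp add: scaleC_of_real[symmetric] cinner_scaleC_left scaleR_conv_of_real scaleC_complex_def)
  show "cinner a (r *\<^sub>R b) = r *\<^sub>R cinner a b"
    by (simp add: scaleC_of_real[symmetric] cinner_scaleC_right scaleR_conv_of_real scaleC_complex_def)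
qed (auto simp: cinner_add_left cinner_add_right)

lemmas tendsto_cinner = bounded_bilinear.tendsto[OF bounded_bilinear_cinner]
  and bounded_linear_cinner_left = bounded_bilinear.bounded_linear_left[OF bounded_bilinear_cinner]

lemma continuous_on_cinner [continuous_intros]:
  "continuous_on S f \<Longrightarrow> continuous_on S g \<Longrightarrow>
   continuous_on S (\<lambda>x. cinner (f x) (g x :: 'a::complex_hilbert))"
  by (rule bounded_bilinear.continuous_on[OF bounded_bilinear_cinner])

lemma bounded_clinear_scaleC: "bounded_clinear (\<lambda>x :: 'a::complex_hilbert. c *\<^sub>C x)"
  unfolding bounded_clinear_def
proof (intro conjI allI)
  show "bounded_linear (\<lambda>x :: 'a. c *\<^sub>C x)"
    by (rule bounded_linear_intro[of _ "cmod c"])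
      (auto simp: scaleC_add_right scaleC_of_real[symmetric] scaleC_scaleC mult.commute)
qed (simp add: scaleC_scaleC mult.commute)

lemma bounded_clinearI:
  assumes "\<And>x y. f (x + y) = f x + f y" "\<And>c x. f (c *\<^sub>C x) = c *\<^sub>C f x"
    and "\<And>x. norm (f x) \<le> norm x * K"
  shows "bounded_clinear f"
  unfolding bounded_clinear_def
  by (auto intro!: bounded_linear_intro[of _ K] simp: assms scaleC_of_real[symmetric])

lemma bounded_clinear_linear: "bounded_clinear f \<Longrightarrow> bounded_linear f"
  by (simp add: bounded_clinear_def)

lemma bounded_clinear_simps:
  assumes "bounded_clinear f"
  shows "f (x + y) = f x + f y" "f (c *\<^sub>C x) = c *\<^sub>C f x" "f 0 = 0" "f (- x) = - f x"
    "f (x - y) = f x - f y" "f (sum g A) = (\<Sum>i\<in>A. f (g i))"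
  using assms linear_simps[OF bounded_clinear_linear[OF assms]]
    bounded_linear.linear[OF bounded_clinear_linear[OF assms]]
  by (auto simp: bounded_clinear_def linear_sum)

lemma bounded_clinear_bound:
  assumes "bounded_clinear f"
  obtains K where "0 < K" "\<And>x. norm (f x) \<le> K * norm x"
  using bounded_linear.pos_bounded[OF bounded_clinear_linear[OF assms]] by (auto simp: mult.commute)

lemma bounded_clinear_id [simp]: "bounded_clinear id" "bounded_clinear (\<lambda>x. x)"
  unfolding bounded_clinear_def id_def by auto

lemma bounded_clinear_zero [simp]: "bounded_clinear (\<lambda>x. 0)"
  unfolding bounded_clinear_def by auto

lemma bounded_clinear_add:
  "bounded_clinear f \<Longrightarrow> bounded_clinear g \<Longrightarrow> bounded_clinear (\<lambda>x. f x + g x)"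
  unfolding bounded_clinear_def by (auto intro: bounded_linear_add simp: scaleC_add_right)

lemma bounded_clinear_diff:
  "bounded_clinear f \<Longrightarrow> bounded_clinear g \<Longrightarrow> bounded_clinear (\<lambda>x. f x - g x)"
  unfolding bounded_clinear_def by (auto intro: bounded_linear_sub simp: scaleC_diff_right)

lemma bounded_clinear_compose:
  "bounded_clinear f \<Longrightarrow> bounded_clinear g \<Longrightarrow> bounded_clinear (\<lambda>x. f (g x))"
  unfolding bounded_clinear_def by (auto intro: bounded_linear_compose)

lemma bounded_clinear_comp:
  "bounded_clinear f \<Longrightarrow> bounded_clinear g \<Longrightarrow> bounded_clinear (f \<circ> g)"
  using bounded_clinear_compose[of f g] by (simp add: comp_def)

lemma bounded_clinear_scale:
  "bounded_clinear f \<Longrightarrow> bounded_clinear (\<lambda>x. c *\<^sub>C f x)"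
  by (rule bounded_clinear_compose[OF bounded_clinear_scaleC])

lemma bounded_clinear_sum:
  "(\<And>i. i \<in> A \<Longrightarrow> bounded_clinear (f i)) \<Longrightarrow> bounded_clinear (\<lambda>x. \<Sum>i\<in>A. f i x)"
  by (induction A rule: infinite_finite_induct) (auto intro: bounded_clinear_add)

lemma bounded_clinear_rank_one: "bounded_clinear (\<lambda>v. cinner v h *\<^sub>C (g :: 'a::complex_hilbert))"
  by (rule bounded_clinearI[of _ "norm h * norm g"])
    (auto simp: cinner_add_left scaleC_add_left cinner_scaleC_left scaleC_scaleC mult.assoc[symmetric]
      intro!: mult_right_mono cinner_Cauchy_Schwarz)

lemma bounded_clinear_continuous: "bounded_clinear f \<Longrightarrow> continuous_on S f"
  using bounded_clinear_linear linear_continuous_on by blast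

lemma bounded_clinear_eq_on_closure:
  assumes "bounded_clinear f" "bounded_clinear g" "\<And>x. x \<in> S \<Longrightarrow> f x = g x" "closure S = UNIV"
  shows "f = g"
proof -
  have "closed {x. f x = g x}"
    by (intro closed_Collect_eq bounded_clinear_continuous assms)
  then have "closure S \<subseteq> {x. f x = g x}" using assms(3) by (intro closure_minimal) auto
  then show ?thesis using assms(4) by auto
qed

text \<open>Minimizing sequences for the distance to a subspace are Cauchy by the parallelogram law; the
  minimizer is the foot of the perpendicular.\<close>

theorem orthogonal_projection_exists:
  fixes V :: "'a::{real_inner, complete_space} set"
  assumes V: "subspace V" "closed V"
  shows "\<exists>p\<in>V. \<forall>v\<in>V. inner (x - p) v = 0"
proof -
  define d where "d = (INF v\<in>V. norm (x - v))"
  have ne: "V \<noteq> {}" using V(1) subspace_0 by blast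
  have bdd: "bdd_below ((\<lambda>v. norm (x - v)) ` V)" by (rule bdd_belowI[of _ 0]) auto
  have d_le: "d \<le> norm (x - v)" if "v \<in> V" for v unfolding d_def using bdd that by (rule cINF_lower)
  have d0: "0 \<le> d" unfolding d_def using ne by (intro cINF_greatest) auto
  have "\<exists>v\<in>V. norm (x - v) < d + 1 / Suc n" for n
    using cINF_less_iff[OF ne bdd, of "d + 1 / Suc n"] unfolding d_def[symmetric] by simp
  then obtain u where u: "\<And>n. u n \<in> V" "\<And>n. norm (x - u n) < d + 1 / Suc n" by metis
  \<comment> \<open>The midpoint of \<open>u m\<close> and \<open>u n\<close> lies in \<open>V\<close>, hence is at distance at least \<open>d\<close> from \<open>x\<close>.\<close>
  have par: "(norm (u m - u n))\<^sup>2 \<le> 2 * (norm (x - u m))\<^sup>2 + 2 * (norm (x - u n))\<^sup>2 - 4 * d\<^sup>2" for m n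
  proof -
    have "(1/2) *\<^sub>R (u m + u n) \<in> V" using V(1) u(1) by (simp add: subspace_add subspace_scale)
    from d_le[OF this] have "d\<^sup>2 \<le> (norm (x - (1/2) *\<^sub>R (u m + u n)))\<^sup>2"
      using d0 by (intro power_mono) auto
    also have "\<dots> = (norm ((1/2) *\<^sub>R ((x - u m) + (x - u n))))\<^sup>2"
      by (rule arg_cong[where f = "\<lambda>z. (norm z)\<^sup>2"]) (simp add: algebra_simps flip: scaleR_add_left)
    also have "\<dots> = (norm ((x - u m) + (x - u n)))\<^sup>2 / 4"
      by (simp add: power_divide)
    finally have "4 * d\<^sup>2 \<le> (norm ((x - u m) + (x - u n)))\<^sup>2" by simp
    moreover have "(norm ((x - u m) + (x - u n)))\<^sup>2 + (norm ((x - u m) - (x - u n)))\<^sup>2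
        = 2 * (norm (x - u m))\<^sup>2 + 2 * (norm (x - u n))\<^sup>2"
      by (simp add: power2_norm_eq_inner inner_add_left inner_add_right inner_diff_left inner_diff_right)
    moreover have "norm ((x - u m) - (x - u n)) = norm (u m - u n)"
      by (simp add: norm_minus_commute)
    ultimately show ?thesis by simp
  qed
  have lim1: "(\<lambda>n. norm (x - u n)) \<longlonglongrightarrow> d"
  proof (rule tendsto_sandwich[of "\<lambda>_. d" _ _ "\<lambda>n. d + 1 / Suc n"])
    show "(\<lambda>n. d + 1 / Suc n) \<longlonglongrightarrow> d"
      using tendsto_add[OF tendsto_const LIMSEQ_inverse_real_of_nat, of d] by (simp add: inverse_eq_divide)
  qed (auto intro!: always_eventually less_imp_le[OF u(2)] d_le u(1) simp del: of_nat_Suc)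
  then have lim2: "(\<lambda>n. (norm (x - u n))\<^sup>2) \<longlonglongrightarrow> d\<^sup>2" by (rule tendsto_power)
  have "Cauchy u"
  proof (rule metric_CauchyI)
    fix e :: real assume e: "0 < e"
    then have "eventually (\<lambda>n. (norm (x - u n))\<^sup>2 < d\<^sup>2 + e\<^sup>2 / 4) sequentially"
      using lim2 by (intro order_tendstoD(2)[where y = "d\<^sup>2"]) auto
    then obtain K where K: "\<And>n. n \<ge> K \<Longrightarrow> (norm (x - u n))\<^sup>2 < d\<^sup>2 + e\<^sup>2 / 4"
      by (auto simp: eventually_sequentially)
    have "dist (u m) (u n) < e" if "m \<ge> K" "n \<ge> K" for m n
    proof -
      have "(norm (u m - u n))\<^sup>2 < e\<^sup>2" using par[of m n] K[OF that(1)] K[OF that(2)] by simp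
      then show ?thesis using e by (simp add: dist_norm power2_less_imp_less)
    qed
    then show "\<exists>M. \<forall>m\<ge>M. \<forall>n\<ge>M. dist (u m) (u n) < e" by blast
  qed
  then obtain p where p: "u \<longlonglongrightarrow> p" using Cauchy_convergent convergent_def by blast
  have pV: "p \<in> V" using V(2) u(1) p by (rule closed_sequentially)
  have "(\<lambda>n. norm (x - u n)) \<longlonglongrightarrow> norm (x - p)" by (intro tendsto_intros p)
  with lim1 have nd: "norm (x - p) = d" using LIMSEQ_unique by blast
  have "inner (x - p) v = 0" if v: "v \<in> V" for v
  proof (rule ccontr)
    assume nz: "inner (x - p) v \<noteq> 0"
    define a where "a = inner (x - p) v"
    \<comment> \<open>Moving \<open>p\<close> by this multiple of \<open>v\<close> would bring it strictly closer to \<open>x\<close>.\<close>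
    define t where "t = a / (norm v)\<^sup>2"
    have v0: "(norm v)\<^sup>2 > 0" using nz by auto
    have "p + t *\<^sub>R v \<in> V" using V(1) pV v by (simp add: subspace_add subspace_scale)
    from d_le[OF this] have "(norm (x - p))\<^sup>2 \<le> (norm (x - p - t *\<^sub>R v))\<^sup>2"
      using nd d0 by (intro power_mono) (auto simp: algebra_simps)
    also have "\<dots> = (norm (x - p))\<^sup>2 - 2 * t * a + t\<^sup>2 * (norm v)\<^sup>2"
    proof -
      have "(norm (y - t *\<^sub>R v))\<^sup>2 = (norm y)\<^sup>2 - 2 * t * inner y v + t\<^sup>2 * (norm v)\<^sup>2" for y
        unfolding power2_norm_eq_inner
        by (simp add: inner_diff_left inner_diff_right inner_commute power2_eq_square algebra_simps)
      from this[of "x - p"] show ?thesis by (simp add: a_def)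
    qed
    finally have "2 * t * a \<le> t\<^sup>2 * (norm v)\<^sup>2" by simp
    moreover have "t * (norm v)\<^sup>2 = a" using v0 by (simp add: t_def)
    ultimately have "2 * t * a \<le> t * a" by (simp add: power2_eq_square mult.assoc)
    moreover have "t * a = a\<^sup>2 / (norm v)\<^sup>2" by (simp add: t_def power2_eq_square)
    ultimately have "a\<^sup>2 / (norm v)\<^sup>2 \<le> 0" by simp
    then have "a\<^sup>2 \<le> 0" using v0 by (simp add: divide_le_0_iff)
    then show False using nz by (simp add: a_def)
  qed
  with pV show ?thesis by blast
qed

lemma complex_orthogonal_projection_exists:
  fixes V :: "'a::complex_hilbert set"
  assumes V: "complex_vector.subspace V" "closed V"
  shows "\<exists>p\<in>V. \<forall>v\<in>V. cinner (x - p) v = 0"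
proof -
  have "subspace V"
    using V(1) unfolding subspace_def complex_vector.subspace_def by (metis scaleC_of_real)
  then obtain p where p: "p \<in> V" "\<And>v. v \<in> V \<Longrightarrow> inner (x - p) v = 0"
    using orthogonal_projection_exists[OF _ V(2)] by blast
  have "cinner (x - p) v = 0" if v: "v \<in> V" for v
  proof -
    \<comment> \<open>Real orthogonality to \<open>v\<close> and to \<open>\<i> v\<close> is complex orthogonality to \<open>v\<close>.\<close>
    have "\<i> *\<^sub>C v \<in> V" using V(1) v by (simp add: complex_vector.subspace_scale)
    then have "Re (cinner (x - p) (\<i> *\<^sub>C v)) = 0" using p(2) by (simp add: inner_eq_Re_cinner)
    moreover have "Re (cinner (x - p) v) = 0" using p(2)[OF v] by (simp add: inner_eq_Re_cinner)
    ultimately show ?thesis by (simp add: cinner_scaleC_right complex_eq_iff)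
  qed
  then show ?thesis using p(1) by blast
qed

text \<open>The orthogonal complement of the kernel of a nonzero functional is one-dimensional, so \<open>\<phi>\<close> is
  determined by its value on one vector \<open>z\<close> there and the representing vector is a multiple of \<open>z\<close>.\<close>

theorem Riesz_representation:
  fixes \<phi> :: "'a::complex_hilbert \<Rightarrow> complex"
  assumes "bounded_clinear \<phi>"
  shows "\<exists>h. \<forall>v. \<phi> v = cinner v h"
proof (cases "\<forall>v. \<phi> v = 0")
  case True then show ?thesis by (intro exI[of _ 0]) simp
next
  case False
  then obtain x where x: "\<phi> x \<noteq> 0" by blast
  note lin = bounded_clinear_simps[OF assms]
  have "closed {v. \<phi> v = 0}"
    by (intro closed_Collect_eq bounded_clinear_continuous assms continuous_on_const)
  moreover have "complex_vector.subspace {v. \<phi> v = 0}"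
    unfolding complex_vector.subspace_def by (auto simp: lin)
  ultimately obtain p where p: "\<phi> p = 0" "\<And>v. \<phi> v = 0 \<Longrightarrow> cinner (x - p) v = 0"
    using complex_orthogonal_projection_exists[of "{v. \<phi> v = 0}" x] by blast
  define z where "z = x - p"
  have z: "\<phi> z \<noteq> 0" using x p(1) by (simp add: z_def lin)
  then have nz: "cinner z z \<noteq> 0" using lin by auto
  have orth: "cinner v z = 0" if "\<phi> v = 0" for v
    using p(2)[OF that] cinner_commute[of v z] by (simp add: z_def)
  have "\<phi> v = cinner v ((cnj (\<phi> z / cinner z z)) *\<^sub>C z)" for v
  proof -
    have "\<phi> (v - (\<phi> v / \<phi> z) *\<^sub>C z) = 0" using z by (simp add: lin scaleC_complex_def)
    from orth[OF this] have "cinner v z = (\<phi> v / \<phi> z) * cinner z z"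
      by (simp add: cinner_diff_left cinner_scaleC_left)
    then show ?thesis using z nz by (simp add: cinner_scaleC_right field_simps)
  qed
  then show ?thesis by blast
qed

lemma cadj_unique:
  assumes "\<And>x y. cinner (f x) y = cinner x (g y)"
  shows "cadj f = g"
  unfolding cadj_def
proof (rule the_equality)
  fix g' assume g': "\<forall>x y. cinner (f x) y = cinner x (g' y)"
  show "g' = g"
  proof
    fix y show "g' y = g y"
      by (rule cinner_eqI_right) (metis g' assms)
  qed
qed (use assms in blast)

lemma cadj_works:
  assumes f: "bounded_clinear f"
  shows "cinner (f x) y = cinner x (cadj f y)"
proof -
  have "\<exists>h. \<forall>x. cinner (f x) y = cinner x h" for y
  proof (rule Riesz_representation)
    have "bounded_linear (\<lambda>x. cinner (f x) y)"
      using bounded_linear_compose[OF bounded_linear_cinner_left bounded_clinear_linear[OF f]] .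
    then show "bounded_clinear (\<lambda>x. cinner (f x) y)"
      unfolding bounded_clinear_def
      by (auto simp: bounded_clinear_simps[OF f] cinner_scaleC_left scaleC_complex_def)
  qed
  then obtain g where g: "\<And>x y. cinner (f x) y = cinner x (g y)" by metis
  then show ?thesis using cadj_unique[of f g] by simp
qed

lemma cadj_works_left: "bounded_clinear f \<Longrightarrow> cinner (cadj f x) y = cinner x (f y)"
  by (metis cadj_works cinner_commute)

lemma bounded_clinear_cadj:
  assumes f: "bounded_clinear f"
  shows "bounded_clinear (cadj f)"
proof -
  obtain K where K: "0 < K" "\<And>x. norm (f x) \<le> K * norm x" using bounded_clinear_bound[OF f] by blast
  show ?thesis
  proof (rule bounded_clinearI[of _ K])
    fix x y c
    show "cadj f (x + y) = cadj f x + cadj f y"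
      by (rule cinner_eqI_right) (simp add: cadj_works[OF f, symmetric] cinner_add_right)
    show "cadj f (c *\<^sub>C x) = c *\<^sub>C cadj f x"
      by (rule cinner_eqI_right) (simp add: cadj_works[OF f, symmetric] cinner_scaleC_right)
    have "(norm (cadj f x))\<^sup>2 = cmod (cinner (f (cadj f x)) x)"
      by (simp add: cadj_works[OF f] cinner_self del: of_real_power)
    also have "\<dots> \<le> norm (f (cadj f x)) * norm x" by (rule cinner_Cauchy_Schwarz)
    also have "\<dots> \<le> (K * norm (cadj f x)) * norm x" by (intro mult_right_mono K) auto
    finally have "norm (cadj f x) * norm (cadj f x) \<le> norm (cadj f x) * (norm x * K)"
      by (simp add: power2_eq_square algebra_simps)
    then show "norm (cadj f x) \<le> norm x * K"
      using K(1) by (cases "cadj f x = 0") (auto)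
  qed
qed

lemma cadj_cadj: "bounded_clinear f \<Longrightarrow> cadj (cadj f) = f"
  by (rule cadj_unique) (simp add: cadj_works_left)

lemma cadj_comp: "bounded_clinear f \<Longrightarrow> bounded_clinear g \<Longrightarrow> cadj (f \<circ> g) = cadj g \<circ> cadj f"
  by (rule cadj_unique) (simp add: cadj_works)

lemma cadj_add:
  "bounded_clinear f \<Longrightarrow> bounded_clinear g \<Longrightarrow> cadj (\<lambda>x. f x + g x) = (\<lambda>x. cadj f x + cadj g x)"
  by (rule cadj_unique) (simp add: cadj_works cinner_add_left cinner_add_right)

lemma cadj_scale: "bounded_clinear f \<Longrightarrow> cadj (\<lambda>x. c *\<^sub>C f x) = (\<lambda>x. cnj c *\<^sub>C cadj f x)"
  by (rule cadj_unique) (simp add: cadj_works cinner_scaleC_left cinner_scaleC_right)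

lemma cadj_id [simp]: "cadj id = id" "cadj (\<lambda>x. x) = (\<lambda>x. x)"
  by (rule cadj_unique; simp)+

lemma cadj_sum:
  "(\<And>i. i \<in> A \<Longrightarrow> bounded_clinear (f i)) \<Longrightarrow> cadj (\<lambda>x. \<Sum>i\<in>A. f i x) = (\<lambda>x. \<Sum>i\<in>A. cadj (f i) x)"
  by (rule cadj_unique) (simp add: cadj_works cinner_sum_left cinner_sum_right)

section \<open>Orthonormal bases\<close>

definition orthonormal :: "'h::complex_hilbert set \<Rightarrow> bool" where
  "orthonormal B \<longleftrightarrow> (\<forall>e\<in>B. \<forall>f\<in>B. cinner e f = (if e = f then 1 else 0))"

lemma orthonormal_subset: "orthonormal B \<Longrightarrow> C \<subseteq> B \<Longrightarrow> orthonormal C"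
  unfolding orthonormal_def by blast

lemma orthonormal_insert:
  assumes "orthonormal B" "\<And>e. e \<in> B \<Longrightarrow> cinner v e = 0" "norm v = 1"
  shows "orthonormal (insert v B)"
proof -
  have "cinner e v = 0" if "e \<in> B" for e
    using assms(2)[OF that] cinner_commute[of e v] by simp
  moreover have "cinner v v = 1" using assms(3) by (simp add: cinner_self)
  ultimately show ?thesis using assms(1,2) unfolding orthonormal_def by auto
qed

text \<open>A maximal orthonormal set, given by Zorn's lemma, is total: otherwise a unit vector orthogonal to
  it could be added.\<close>

lemma is_onb_exists: "\<exists>B :: 'h::complex_hilbert set. is_onb B"
proof -
  have "\<exists>B\<in>{B :: 'h set. orthonormal B}. \<forall>C\<in>{B. orthonormal B}. B \<subseteq> C \<longrightarrow> C = B"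
  proof (rule subset_Zorn')
    fix \<C> :: "'h set set" assume \<C>: "subset.chain {B. orthonormal B} \<C>"
    have "cinner e f = (if e = f then 1 else 0)" if "e \<in> B" "B \<in> \<C>" "f \<in> C" "C \<in> \<C>" for e f B C
    proof -
      have "B \<subseteq> C \<or> C \<subseteq> B" using \<C> that unfolding subset.chain_def by blast
      moreover have "orthonormal B" "orthonormal C" using \<C> that unfolding subset.chain_def by auto
      ultimately show ?thesis using that(1,3) unfolding orthonormal_def by blast
    qed
    then show "\<Union>\<C> \<in> {B. orthonormal B}" unfolding orthonormal_def by blast
  qed
  then obtain B :: "'h set" where B: "orthonormal B" "\<And>C. orthonormal C \<Longrightarrow> B \<subseteq> C \<Longrightarrow> C = B" by blast
  have "v = 0" if v: "\<forall>e\<in>B. cinner v e = 0" for v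
  proof (rule ccontr)
    assume "v \<noteq> 0"
    define u where "u = complex_of_real (inverse (norm v)) *\<^sub>C v"
    have nu: "norm u = 1" using \<open>v \<noteq> 0\<close> by (simp add: u_def norm_inverse)
    have ou: "\<And>e. e \<in> B \<Longrightarrow> cinner u e = 0" using v by (simp add: u_def cinner_scaleC_left)
    have "u \<in> B" using B(2)[OF orthonormal_insert[OF B(1) ou nu]] by blast
    then have "cinner u u = 0" using ou by blast
    then show False using nu by simp
  qed
  then show ?thesis using B(1) unfolding is_onb_def orthonormal_def by blast
qed

lemma is_onb_onb: "is_onb (onb :: 'h::complex_hilbert set)"
  unfolding onb_def using is_onb_exists by (rule someI_ex)

lemma orthonormal_onb: "orthonormal (onb :: 'h::complex_hilbert set)"
  using is_onb_onb unfolding is_onb_def orthonormal_def by blast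

lemma orthonormal_cinner_sum:
  assumes "orthonormal F" "finite F" "e \<in> F"
  shows "cinner (\<Sum>f\<in>F. c f *\<^sub>C f) e = c e"
proof -
  have "cinner (\<Sum>f\<in>F. c f *\<^sub>C f) e = (\<Sum>f\<in>F. if f = e then c f else 0)"
    unfolding cinner_sum_left cinner_scaleC_left
    using assms by (intro sum.cong) (auto simp: orthonormal_def)
  then show ?thesis using assms by simp
qed

lemma orthonormal_norm_sum:
  assumes "orthonormal F" "finite F"
  shows "(norm (\<Sum>f\<in>F. c f *\<^sub>C f))\<^sup>2 = (\<Sum>f\<in>F. (cmod (c f))\<^sup>2)"
proof -
  let ?s = "\<Sum>f\<in>F. c f *\<^sub>C f"
  have "cinner ?s ?s = (\<Sum>f\<in>F. cnj (c f) * cinner ?s f)"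
    unfolding cinner_sum_right[of ?s] by (simp add: cinner_scaleC_right)
  also have "\<dots> = (\<Sum>f\<in>F. complex_of_real ((cmod (c f))\<^sup>2))"
    by (intro sum.cong refl)
      (simp add: orthonormal_cinner_sum[OF assms] complex_norm_square[symmetric] mult.commute
       del: of_real_power)
  finally have "complex_of_real ((norm ?s)\<^sup>2) = complex_of_real (\<Sum>f\<in>F. (cmod (c f))\<^sup>2)"
    by (simp only: cinner_self of_real_sum)
  then show ?thesis using of_real_eq_iff by blast
qed

text \<open>The partial Fourier sum is the best approximation of \<open>x\<close> in the span of \<open>F\<close>; comparing with
  the zero vector gives Bessel's inequality.\<close>

lemma orthonormal_best_approx:
  assumes F: "orthonormal F" "finite F"
  shows "(norm (x - (\<Sum>f\<in>F. c f *\<^sub>C f)))\<^sup>2 =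
    (norm (x - (\<Sum>f\<in>F. cinner x f *\<^sub>C f)))\<^sup>2 + (\<Sum>f\<in>F. (cmod (cinner x f - c f))\<^sup>2)"
proof -
  let ?r = "x - (\<Sum>f\<in>F. cinner x f *\<^sub>C f)" and ?d = "\<Sum>f\<in>F. (cinner x f - c f) *\<^sub>C f"
  have "cinner ?r f = 0" if "f \<in> F" for f
    by (simp add: cinner_diff_left orthonormal_cinner_sum[OF F that])
  then have "cinner ?r ?d = 0" by (simp add: cinner_sum_right cinner_scaleC_right)
  then have "inner ?r ?d = 0" by (simp add: inner_eq_Re_cinner)
  then have "(norm (?r + ?d))\<^sup>2 = (norm ?r)\<^sup>2 + (norm ?d)\<^sup>2"
    by (simp add: power2_norm_eq_inner inner_add_left inner_add_right inner_commute)
  moreover have "?r + ?d = x - (\<Sum>f\<in>F. c f *\<^sub>C f)"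
    by (simp add: complex_vector.scale_left_diff_distrib sum_subtractf)
  ultimately show ?thesis by (simp add: orthonormal_norm_sum[OF F])
qed

lemma Bessel_inequality:
  assumes F: "orthonormal F" "finite F"
  shows "(\<Sum>f\<in>F. (cmod (cinner x f))\<^sup>2) \<le> (norm x)\<^sup>2"
  using orthonormal_best_approx[OF F, of x "\<lambda>_. 0"] by simp

lemma closure_complex_subspace:
  assumes "complex_vector.subspace (S :: 'h::complex_hilbert set)"
  shows "complex_vector.subspace (closure S)"
  unfolding complex_vector.subspace_def
proof (intro conjI ballI allI)
  show "0 \<in> closure S" using assms closure_subset complex_vector.subspace_0 by blast
next
  fix x y assume "x \<in> closure S" "y \<in> closure S"
  then obtain a b where "\<forall>n::nat. a n \<in> S" "a \<longlonglongrightarrow> x" "\<forall>n::nat. b n \<in> S" "b \<longlonglongrightarrow> y"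
    unfolding closure_sequential by blast
  then have "\<forall>n. a n + b n \<in> S" "(\<lambda>n. a n + b n) \<longlonglongrightarrow> x + y"
    using assms by (auto intro: tendsto_add complex_vector.subspace_add)
  then show "x + y \<in> closure S" unfolding closure_sequential by (intro exI[of _ "\<lambda>n. a n + b n"] conjI)
next
  fix c x assume "x \<in> closure S"
  then obtain a where "\<forall>n::nat. a n \<in> S" "a \<longlonglongrightarrow> x" unfolding closure_sequential by blast
  then have "\<forall>n. c *\<^sub>C a n \<in> S" "(\<lambda>n. c *\<^sub>C a n) \<longlonglongrightarrow> c *\<^sub>C x"
    using assms bounded_linear.tendsto[OF bounded_clinear_linear[OF bounded_clinear_scaleC]]
    by (auto intro: complex_vector.subspace_scale)
  then show "c *\<^sub>C x \<in> closure S" unfolding closure_sequential by (intro exI[of _ "\<lambda>n. c *\<^sub>C a n"] conjI)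
qed

text \<open>The span of the basis is dense because nothing is orthogonal to its closure.  A finite
  combination close to \<open>x\<close> is beaten by every partial Fourier sum over a larger index set.\<close>

lemma onb_expansion: "((\<lambda>e. cinner x e *\<^sub>C e) has_sum x) (onb :: 'h::complex_hilbert set)"
proof -
  let ?S = "complex_vector.span (onb :: 'h set)"
  obtain p where p: "p \<in> closure ?S" "\<And>v. v \<in> closure ?S \<Longrightarrow> cinner (x - p) v = 0"
    using complex_orthogonal_projection_exists[OF closure_complex_subspace[OF complex_vector.subspace_span] closed_closure]
    by blast
  have "e \<in> closure ?S" if "e \<in> onb" for e
    using that complex_vector.span_base closure_subset by blast
  then have "x - p = 0" using p(2) is_onb_onb unfolding is_onb_def by blast
  then have x: "x \<in> closure ?S" using p(1) by simp
  show ?thesis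
    unfolding has_sum_def tendsto_iff eventually_finite_subsets_at_top
  proof (intro allI impI)
    fix \<epsilon> :: real assume "0 < \<epsilon>"
    then obtain w where w: "w \<in> ?S" "dist w x < \<epsilon>" using x closure_approachable by blast
    then obtain F r where F: "finite F" "F \<subseteq> onb" "w = (\<Sum>f\<in>F. r f *\<^sub>C f)"
      unfolding complex_vector.span_explicit by blast
    have "dist (\<Sum>e\<in>Y. cinner x e *\<^sub>C e) x < \<epsilon>" if Y: "finite Y" "F \<subseteq> Y" "Y \<subseteq> onb" for Y
    proof -
      have oY: "orthonormal Y" using orthonormal_subset[OF orthonormal_onb Y(3)] .
      have "w = (\<Sum>f\<in>Y. (if f \<in> F then r f else 0) *\<^sub>C f)"
        unfolding F(3) using Y by (intro sum.mono_neutral_cong_left) auto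
      then have "(norm (x - (\<Sum>f\<in>Y. cinner x f *\<^sub>C f)))\<^sup>2 \<le> (norm (x - w))\<^sup>2"
        using orthonormal_best_approx[OF oY Y(1), of x "\<lambda>f. if f \<in> F then r f else 0"]
          sum_nonneg[of Y "\<lambda>f. (cmod (cinner x f - (if f \<in> F then r f else 0)))\<^sup>2"]
        by (metis (no_types, lifting) le_add_same_cancel1 zero_le_power2)
      then have "norm (x - (\<Sum>f\<in>Y. cinner x f *\<^sub>C f)) \<le> norm (x - w)"
        by (rule power2_le_imp_le) simp
      then show ?thesis using w(2) by (simp add: dist_norm norm_minus_commute)
    qed
    then show "\<exists>X. finite X \<and> X \<subseteq> onb \<and>
        (\<forall>Y. finite Y \<and> X \<subseteq> Y \<and> Y \<subseteq> onb \<longrightarrow> dist (\<Sum>e\<in>Y. cinner x e *\<^sub>C e) x < \<epsilon>)"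
      using F by blast
  qed
qed

text \<open>Gram--Schmidt, in the form needed to choose orthonormal coordinates.\<close>

lemma finite_orthonormal_spanning:
  assumes "finite (B :: 'h::complex_hilbert set)"
  shows "\<exists>F. finite F \<and> orthonormal F \<and> B \<subseteq> complex_vector.span F"
  using assms
proof (induction B)
  case empty then show ?case by (intro exI[of _ "{}"]) (simp add: orthonormal_def)
next
  case (insert b B)
  then obtain F where F: "finite F" "orthonormal F" "B \<subseteq> complex_vector.span F" by blast
  define c where "c = b - (\<Sum>f\<in>F. cinner b f *\<^sub>C f)"
  have sF: "(\<Sum>f\<in>F. cinner b f *\<^sub>C f) \<in> complex_vector.span F"
    by (intro complex_vector.span_sum complex_vector.span_scale complex_vector.span_base)
  have co: "cinner c f = 0" if "f \<in> F" for f
    by (simp add: c_def cinner_diff_left orthonormal_cinner_sum[OF F(2,1) that])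
  show ?case
  proof (cases "c = 0")
    case True
    then have "b \<in> complex_vector.span F" using sF by (simp add: c_def)
    then show ?thesis using F by blast
  next
    case False
    define u where "u = complex_of_real (inverse (norm c)) *\<^sub>C c"
    have "orthonormal (Set.insert u F)"
      using False by (intro orthonormal_insert F) (auto simp: u_def cinner_scaleC_left co norm_inverse)
    moreover have "b \<in> complex_vector.span (Set.insert u F)"
    proof -
      have "c = complex_of_real (norm c) *\<^sub>C u" using False by (simp add: u_def scaleC_scaleC norm_inverse)
      then have "b = complex_of_real (norm c) *\<^sub>C u + (\<Sum>f\<in>F. cinner b f *\<^sub>C f)" by (simp add: c_def)
      moreover have "(\<Sum>f\<in>F. cinner b f *\<^sub>C f) \<in> complex_vector.span (Set.insert u F)"
        using sF complex_vector.span_mono[of F "Set.insert u F"] by blast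
      ultimately show ?thesis
        by (metis complex_vector.span_add complex_vector.span_base complex_vector.span_scale insertI1)
    qed
    moreover have "B \<subseteq> complex_vector.span (Set.insert u F)"
      using F(3) complex_vector.span_mono[of F "Set.insert u F"] by blast
    ultimately show ?thesis using F(1) by (intro exI[of _ "Set.insert u F"]) auto
  qed
qed

lemma orthonormal_span_expansion:
  assumes F: "finite F" "orthonormal F" and x: "x \<in> complex_vector.span F"
  shows "x = (\<Sum>f\<in>F. cinner x f *\<^sub>C f)"
proof -
  obtain r where r: "x = (\<Sum>f\<in>F. r f *\<^sub>C f)"
    using x complex_vector.span_finite[OF F(1)] by auto
  then have "\<And>f. f \<in> F \<Longrightarrow> cinner x f = r f" using orthonormal_cinner_sum[OF F(2,1)] by simp
  then show ?thesis using r by (metis (no_types, lifting) sum.cong)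
qed

section \<open>Hilbert--Schmidt operators\<close>

lemma hilbert_schmidt_bounded: "hilbert_schmidt T \<Longrightarrow> bounded_clinear T"
  by (simp add: hilbert_schmidt_def)

lemma hilbert_schmidt_summable: "hilbert_schmidt T \<Longrightarrow> (\<lambda>e. (norm (T e))\<^sup>2) summable_on onb"
  by (simp add: hilbert_schmidt_def)

lemma norm_add_sq_le: "(norm (a + b))\<^sup>2 \<le> 2 * (norm a)\<^sup>2 + 2 * (norm (b :: 'a::real_inner))\<^sup>2"
proof -
  have "(norm (a + b))\<^sup>2 + (norm (a - b))\<^sup>2 = 2 * (norm a)\<^sup>2 + 2 * (norm b)\<^sup>2"
    by (simp add: power2_norm_eq_inner inner_add_left inner_add_right inner_diff_left inner_diff_right)
  then show ?thesis using zero_le_power2[of "norm (a - b)"] by linarith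
qed

lemma hilbert_schmidt_zero [simp]: "hilbert_schmidt (\<lambda>v. 0)"
  by (simp add: hilbert_schmidt_def)

lemma hilbert_schmidt_add:
  assumes "hilbert_schmidt S" "hilbert_schmidt T"
  shows "hilbert_schmidt (\<lambda>v. S v + T v)"
  unfolding hilbert_schmidt_def
proof
  show "bounded_clinear (\<lambda>v. S v + T v)"
    using assms by (intro bounded_clinear_add hilbert_schmidt_bounded)
  have "(\<lambda>e. 2 * (norm (S e))\<^sup>2 + 2 * (norm (T e))\<^sup>2) summable_on onb"
    using assms by (intro summable_on_add summable_on_cmult_right hilbert_schmidt_summable)
  then show "(\<lambda>e. (norm (S e + T e))\<^sup>2) summable_on onb"
    by (rule summable_on_comparison_test) (auto intro: norm_add_sq_le)
qed

lemma hilbert_schmidt_compose_left: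
  assumes "hilbert_schmidt T" and a: "bounded_clinear a"
  shows "hilbert_schmidt (\<lambda>v. a (T v))"
  unfolding hilbert_schmidt_def
proof
  show "bounded_clinear (\<lambda>v. a (T v))"
    by (rule bounded_clinear_compose[OF a hilbert_schmidt_bounded[OF assms(1)]])
  obtain K where K: "0 < K" "\<And>x. norm (a x) \<le> K * norm x" using bounded_clinear_bound[OF a] by blast
  have "(\<lambda>e. K\<^sup>2 * (norm (T e))\<^sup>2) summable_on onb"
    using assms by (intro summable_on_cmult_right hilbert_schmidt_summable)
  then show "(\<lambda>e. (norm (a (T e)))\<^sup>2) summable_on onb"
  proof (rule summable_on_comparison_test)
    fix e
    have "(norm (a (T e)))\<^sup>2 \<le> (K * norm (T e))\<^sup>2" by (intro power_mono K) auto
    then show "(norm (a (T e)))\<^sup>2 \<le> K\<^sup>2 * (norm (T e))\<^sup>2" by (simp add: power_mult_distrib)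
  qed auto
qed

lemma hilbert_schmidt_scale: "hilbert_schmidt T \<Longrightarrow> hilbert_schmidt (\<lambda>v. c *\<^sub>C T v)"
  by (rule hilbert_schmidt_compose_left[OF _ bounded_clinear_scaleC])

lemma hilbert_schmidt_uminus: "hilbert_schmidt T \<Longrightarrow> hilbert_schmidt (\<lambda>v. - T v)"
  using hilbert_schmidt_scale[of T "-1"] by simp

lemma hilbert_schmidt_diff:
  assumes "hilbert_schmidt S" "hilbert_schmidt T"
  shows "hilbert_schmidt (\<lambda>v. S v - T v)"
  using hilbert_schmidt_add[OF assms(1) hilbert_schmidt_scale[OF assms(2), of "-1"]] by simp

lemma hilbert_schmidt_sum:
  "(\<And>i. i \<in> A \<Longrightarrow> hilbert_schmidt (f i)) \<Longrightarrow> hilbert_schmidt (\<lambda>v. \<Sum>i\<in>A. f i v)"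
  by (induction A rule: infinite_finite_induct) (auto intro: hilbert_schmidt_add)

text \<open>The square sum over the basis is \<open>\<parallel>g\<parallel>\<^sup>2\<close> times the sum of the \<open>|\<langle>h, e\<rangle>|\<^sup>2\<close>, which Bessel's
  inequality bounds.\<close>

lemma hilbert_schmidt_rank_one: "hilbert_schmidt (\<lambda>v. cinner v h *\<^sub>C (g :: 'h::complex_hilbert))"
  unfolding hilbert_schmidt_def
proof
  show "(\<lambda>e. (norm (cinner e h *\<^sub>C g))\<^sup>2) summable_on onb"
  proof (rule nonneg_bdd_above_summable_on)
    show "bdd_above (sum (\<lambda>e. (norm (cinner e h *\<^sub>C g))\<^sup>2) ` {F. F \<subseteq> onb \<and> finite F})"
    proof (rule bdd_aboveI2[where M = "(norm h)\<^sup>2 * (norm g)\<^sup>2"], clarify)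
      fix F :: "'h set" assume F: "F \<subseteq> onb" "finite F"
      have "(\<Sum>e\<in>F. (norm (cinner e h *\<^sub>C g))\<^sup>2) = (\<Sum>e\<in>F. (cmod (cinner h e))\<^sup>2) * (norm g)\<^sup>2"
        unfolding sum_distrib_right
        by (intro sum.cong refl) (metis cinner_commute complex_mod_cnj norm_scaleC power_mult_distrib)
      also have "\<dots> \<le> (norm h)\<^sup>2 * (norm g)\<^sup>2"
        using Bessel_inequality[OF orthonormal_subset[OF orthonormal_onb F(1)] F(2), of h]
        by (intro mult_right_mono) auto
      finally show "(\<Sum>e\<in>F. (norm (cinner e h *\<^sub>C g))\<^sup>2) \<le> (norm h)\<^sup>2 * (norm g)\<^sup>2" .
    qed
  qed auto
qed (rule bounded_clinear_rank_one)

lemma bounded_clinear_functional: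
  assumes T: "bounded_clinear T"
  shows "bounded_clinear (\<lambda>v. cinner (T v) w)"
  unfolding bounded_clinear_def
  using bounded_linear_compose[OF bounded_linear_cinner_left bounded_clinear_linear[OF T]]
  by (auto simp: bounded_clinear_simps[OF T] cinner_scaleC_left scaleC_complex_def)

text \<open>Expanding \<open>T v\<close> in an orthonormal basis of a space containing the range, the coefficients are
  \<open>\<langle>T v, f\<rangle> = \<langle>v, T* f\<rangle>\<close>.\<close>

lemma finite_rank_representation:
  assumes T: "finite_rank (T :: 'h::complex_hilbert \<Rightarrow> 'h)"
  shows "\<exists>F. finite F \<and> orthonormal F \<and> (\<forall>v. T v = (\<Sum>f\<in>F. cinner v (cadj T f) *\<^sub>C f))"
proof -
  obtain B where B: "bounded_clinear T" "finite B" "range T \<subseteq> complex_vector.span B"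
    using T unfolding finite_rank_def by blast
  obtain F where F: "finite F" "orthonormal F" "B \<subseteq> complex_vector.span F"
    using finite_orthonormal_spanning[OF B(2)] by blast
  have "T v \<in> complex_vector.span F" for v
    using B(3) F(3) complex_vector.span_mono[OF F(3)] by (auto simp: complex_vector.span_span)
  from orthonormal_span_expansion[OF F(1,2) this]
  show ?thesis using F by (auto simp: cadj_works[OF B(1)])
qed

lemma finite_rank_hilbert_schmidt: "finite_rank T \<Longrightarrow> hilbert_schmidt T"
proof -
  assume "finite_rank T"
  then obtain F where "\<And>v. T v = (\<Sum>f\<in>F. cinner v (cadj T f) *\<^sub>C f)"
    using finite_rank_representation by blast
  then have "T = (\<lambda>v. \<Sum>f\<in>F. cinner v (cadj T f) *\<^sub>C f)" by blast
  moreover have "hilbert_schmidt \<dots>" by (intro hilbert_schmidt_sum hilbert_schmidt_rank_one)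
  ultimately show ?thesis by simp
qed

lemma finite_rank_rank_one_sum:
  "finite A \<Longrightarrow> finite_rank (\<lambda>v. \<Sum>i\<in>A. cinner v (h i) *\<^sub>C (g i :: 'h::complex_hilbert))"
  unfolding finite_rank_def
proof
  assume A: "finite A"
  have "(\<Sum>i\<in>A. cinner v (h i) *\<^sub>C g i) \<in> complex_vector.span (g ` A)" for v
    by (intro complex_vector.span_sum complex_vector.span_scale complex_vector.span_base) auto
  then show "\<exists>B. finite B \<and> range (\<lambda>v. \<Sum>i\<in>A. cinner v (h i) *\<^sub>C g i) \<subseteq> complex_vector.span B"
    using A by (intro exI[of _ "g ` A"]) auto
qed (intro bounded_clinear_sum bounded_clinear_rank_one)

lemma hs_inner_summable:
  assumes "hilbert_schmidt S" "hilbert_schmidt T"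
  shows "(\<lambda>e. cinner (S e) (T e)) summable_on onb"
proof (rule abs_summable_summable, rule summable_on_comparison_test)
  show "(\<lambda>e. (norm (S e))\<^sup>2 + (norm (T e))\<^sup>2) summable_on onb"
    using assms by (intro summable_on_add hilbert_schmidt_summable)
  fix e
  have "cmod (cinner (S e) (T e)) \<le> norm (S e) * norm (T e)" by (rule cinner_Cauchy_Schwarz)
  also have "\<dots> \<le> (norm (S e))\<^sup>2 + (norm (T e))\<^sup>2"
    using sum_squares_bound[of "norm (S e)" "norm (T e)"]
      mult_nonneg_nonneg[OF norm_ge_zero[of "S e"] norm_ge_zero[of "T e"]]
    by linarith
  finally show "norm (cinner (S e) (T e)) \<le> (norm (S e))\<^sup>2 + (norm (T e))\<^sup>2" .
qed auto

lemma hs_inner_add_left: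
  "hilbert_schmidt S \<Longrightarrow> hilbert_schmidt S' \<Longrightarrow> hilbert_schmidt T \<Longrightarrow>
   hs_inner (\<lambda>v. S v + S' v) T = hs_inner S T + hs_inner S' T"
  unfolding hs_inner_def by (simp add: cinner_add_left infsum_add hs_inner_summable)

lemma hs_inner_scale_left: "hs_inner (\<lambda>v. c *\<^sub>C S v) T = c * hs_inner S T"
  unfolding hs_inner_def by (simp add: cinner_scaleC_left infsum_cmult_right')

lemma hs_inner_commute: "hs_inner S T = cnj (hs_inner T S)"
  unfolding hs_inner_def infsum_cnj[symmetric] by (simp flip: cinner_commute)

lemma hs_inner_self:
  assumes "hilbert_schmidt T"
  shows "hs_inner T T = complex_of_real (\<Sum>\<^sub>\<infinity>e\<in>onb. (norm (T e))\<^sup>2)"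
  unfolding hs_inner_def cinner_self
  by (rule infsumI[OF has_sum_of_real[OF has_sum_infsum[OF hilbert_schmidt_summable[OF assms]]]])

text \<open>The sum defining the left-hand side is the image of the expansion of \<open>h\<close> in the basis under the
  bounded functional \<open>v \<mapsto> \<langle>S v, g\<rangle>\<close>.\<close>

lemma hs_inner_rank_one:
  assumes S: "bounded_clinear S"
  shows "hs_inner S (\<lambda>v. cinner v h *\<^sub>C g) = cinner (S h) g"
proof -
  have "((\<lambda>e. cinner (S (cinner h e *\<^sub>C e)) g) has_sum cinner (S h) g) onb"
    using has_sum_bounded_linear[OF bounded_clinear_linear[OF bounded_clinear_functional[OF S]] onb_expansion] .
  then have "((\<lambda>e. cinner (S e) (cinner e h *\<^sub>C g)) has_sum cinner (S h) g) onb"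
    by (simp add: bounded_clinear_simps[OF S] cinner_scaleC_left cinner_scaleC_right
        flip: cinner_commute[of h])
  then show ?thesis unfolding hs_inner_def by (rule infsumI)
qed

lemma hs_tuple_inner_zero_right: "hs_tuple_inner S (\<lambda>j v. 0) = 0"
  by (simp add: hs_tuple_inner_def hs_inner_def)

text \<open>Convergence in Hilbert--Schmidt norm implies pointwise convergence: expand \<open>v\<close> in the basis and
  apply the Cauchy--Schwarz inequality to its coefficients and the vectors \<open>T e\<close>.\<close>

lemma hilbert_schmidt_norm_bound:
  assumes T: "hilbert_schmidt T"
  shows "(norm (T v))\<^sup>2 \<le> (\<Sum>\<^sub>\<infinity>e\<in>onb. (norm (T e))\<^sup>2) * (norm v)\<^sup>2"
proof -
  let ?s = "\<Sum>\<^sub>\<infinity>e\<in>onb. (norm (T e))\<^sup>2"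
  note bl = hilbert_schmidt_bounded[OF T]
  have "((\<lambda>e. T (cinner v e *\<^sub>C e)) has_sum T v) onb"
    using has_sum_bounded_linear[OF bounded_clinear_linear[OF bl] onb_expansion] .
  then have "((\<lambda>F. (norm (\<Sum>e\<in>F. T (cinner v e *\<^sub>C e)))\<^sup>2) \<longlongrightarrow> (norm (T v))\<^sup>2) (finite_subsets_at_top onb)"
    unfolding has_sum_def by (intro tendsto_power tendsto_norm)
  then show ?thesis
  proof (rule tendsto_upperbound)
    show "\<forall>\<^sub>F F in finite_subsets_at_top onb. (norm (\<Sum>e\<in>F. T (cinner v e *\<^sub>C e)))\<^sup>2 \<le> ?s * (norm v)\<^sup>2"
    proof (rule eventually_finite_subsets_at_top_weakI)
      fix F :: "'a set" assume F: "finite F" "F \<subseteq> onb"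
      have "norm (\<Sum>e\<in>F. T (cinner v e *\<^sub>C e)) \<le> (\<Sum>e\<in>F. cmod (cinner v e) * norm (T e))"
        by (rule order_trans[OF norm_sum]) (simp add: bounded_clinear_simps[OF bl])
      then have "(norm (\<Sum>e\<in>F. T (cinner v e *\<^sub>C e)))\<^sup>2 \<le> (\<Sum>e\<in>F. cmod (cinner v e) * norm (T e))\<^sup>2"
        by (rule power_mono) auto
      also have "\<dots> \<le> (\<Sum>e\<in>F. (cmod (cinner v e))\<^sup>2) * (\<Sum>e\<in>F. (norm (T e))\<^sup>2)"
        by (rule Cauchy_Schwarz_ineq_sum)
      also have "\<dots> \<le> (norm v)\<^sup>2 * ?s"
        using Bessel_inequality[OF orthonormal_subset[OF orthonormal_onb F(2)] F(1), of v]
          finite_sum_le_infsum[OF hilbert_schmidt_summable[OF T] F]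
        by (intro mult_mono) (auto intro: sum_nonneg)
      finally show "(norm (\<Sum>e\<in>F. T (cinner v e *\<^sub>C e)))\<^sup>2 \<le> ?s * (norm v)\<^sup>2"
        by (simp add: mult.commute)
    qed
  qed simp
qed

section \<open>The Hilbert space of Hilbert--Schmidt tuples\<close>

lemma has_sum_finite_sum:
  fixes f :: "'i \<Rightarrow> 'a \<Rightarrow> real"
  assumes "\<And>i. i \<in> I \<Longrightarrow> (f i has_sum s i) A"
  shows "((\<lambda>x. \<Sum>i\<in>I. f i x) has_sum (\<Sum>i\<in>I. s i)) A"
  using assms by (induction I rule: infinite_finite_induct) (auto intro!: has_sum_add has_sum_0)

text \<open>Tuples of Hilbert--Schmidt operators are made into a type, so that the projection theorem
  applies to them.\<close>

typedef (overloaded) ('n::finite, 'h::complex_hilbert) hs_tuple =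
  "{T :: 'n \<Rightarrow> 'h \<Rightarrow> 'h. \<forall>j. hilbert_schmidt (T j)}"
  by (rule exI[of _ "\<lambda>j v. 0"]) simp

setup_lifting type_definition_hs_tuple

lemma hs_tuple_summable:
  assumes "\<forall>j. hilbert_schmidt (T j)"
  shows "(\<lambda>e. \<Sum>j\<in>UNIV. (norm (T j e))\<^sup>2) summable_on onb"
proof -
  have "((\<lambda>e. \<Sum>j\<in>UNIV. (norm (T j e))\<^sup>2) has_sum (\<Sum>j\<in>UNIV. \<Sum>\<^sub>\<infinity>e\<in>onb. (norm (T j e))\<^sup>2)) onb"
    using assms by (intro has_sum_finite_sum has_sum_infsum hilbert_schmidt_summable) auto
  then show ?thesis unfolding summable_on_def by blast
qed

lemma hs_tuple_inner_self:
  assumes "\<forall>j. hilbert_schmidt (T j)"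
  shows "hs_tuple_inner T T = complex_of_real (\<Sum>\<^sub>\<infinity>e\<in>onb. \<Sum>j\<in>UNIV. (norm (T j e))\<^sup>2)"
proof -
  have "(\<Sum>\<^sub>\<infinity>e\<in>onb. \<Sum>j\<in>UNIV. (norm (T j e))\<^sup>2) = (\<Sum>j\<in>UNIV. \<Sum>\<^sub>\<infinity>e\<in>onb. (norm (T j e))\<^sup>2)"
    by (rule infsumI, intro has_sum_finite_sum has_sum_infsum) (use assms in \<open>auto intro: hilbert_schmidt_summable\<close>)
  then show ?thesis using assms by (simp add: hs_tuple_inner_def hs_inner_self)
qed

lemma hs_tuple_norm_bound:
  assumes "\<forall>j. hilbert_schmidt (T j)"
  shows "(norm (T j v))\<^sup>2 \<le> Re (hs_tuple_inner T T) * (norm v)\<^sup>2"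
proof -
  have "(\<Sum>\<^sub>\<infinity>e\<in>onb. (norm (T j e))\<^sup>2) \<le> (\<Sum>j\<in>UNIV. \<Sum>\<^sub>\<infinity>e\<in>onb. (norm (T j e))\<^sup>2)"
    by (rule member_le_sum) (auto intro: infsum_nonneg)
  also have "\<dots> = Re (hs_tuple_inner T T)" using assms by (simp add: hs_tuple_inner_def hs_inner_self)
  finally show ?thesis
    using hilbert_schmidt_norm_bound[of "T j" v] assms
    by (meson mult_right_mono order_trans zero_le_power2)
qed

lemma hs_tuple_inner_add_left:
  assumes "\<forall>j. hilbert_schmidt (S j)" "\<forall>j. hilbert_schmidt (S' j)" "\<forall>j. hilbert_schmidt (T j)"
  shows "hs_tuple_inner (\<lambda>j v. S j v + S' j v) T = hs_tuple_inner S T + hs_tuple_inner S' T"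
  using assms by (simp add: hs_tuple_inner_def hs_inner_add_left sum.distrib)

lemma hs_tuple_inner_scale_left: "hs_tuple_inner (\<lambda>j v. c *\<^sub>C S j v) T = c * hs_tuple_inner S T"
  by (simp add: hs_tuple_inner_def hs_inner_scale_left sum_distrib_left)

lemma hs_tuple_inner_commute: "hs_tuple_inner S T = cnj (hs_tuple_inner T S)"
  unfolding hs_tuple_inner_def cnj_sum by (intro sum.cong refl hs_inner_commute)

instantiation hs_tuple :: (finite, complex_hilbert) real_inner
begin

lift_definition zero_hs_tuple :: "('a, 'b) hs_tuple" is "\<lambda>j v. 0" by simp
lift_definition plus_hs_tuple :: "('a, 'b) hs_tuple \<Rightarrow> ('a, 'b) hs_tuple \<Rightarrow> ('a, 'b) hs_tuple"
  is "\<lambda>S T j v. S j v + T j v" by (simp add: hilbert_schmidt_add)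
lift_definition minus_hs_tuple :: "('a, 'b) hs_tuple \<Rightarrow> ('a, 'b) hs_tuple \<Rightarrow> ('a, 'b) hs_tuple"
  is "\<lambda>S T j v. S j v - T j v" by (simp add: hilbert_schmidt_diff)
lift_definition uminus_hs_tuple :: "('a, 'b) hs_tuple \<Rightarrow> ('a, 'b) hs_tuple"
  is "\<lambda>T j v. - T j v" by (simp add: hilbert_schmidt_uminus)
lift_definition scaleR_hs_tuple :: "real \<Rightarrow> ('a, 'b) hs_tuple \<Rightarrow> ('a, 'b) hs_tuple"
  is "\<lambda>r T j v. r *\<^sub>R T j v"
  by (simp add: hilbert_schmidt_scale flip: scaleC_of_real)
lift_definition inner_hs_tuple :: "('a, 'b) hs_tuple \<Rightarrow> ('a, 'b) hs_tuple \<Rightarrow> real"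
  is "\<lambda>S T. Re (hs_tuple_inner S T)" .

definition norm_hs_tuple :: "('a, 'b) hs_tuple \<Rightarrow> real" where "norm_hs_tuple S = sqrt (inner S S)"
definition sgn_hs_tuple :: "('a, 'b) hs_tuple \<Rightarrow> ('a, 'b) hs_tuple"
  where "sgn_hs_tuple S = inverse (norm S) *\<^sub>R S"
definition dist_hs_tuple :: "('a, 'b) hs_tuple \<Rightarrow> ('a, 'b) hs_tuple \<Rightarrow> real"
  where "dist_hs_tuple S T = norm (S - T)"
definition uniformity_hs_tuple :: "(('a, 'b) hs_tuple \<times> ('a, 'b) hs_tuple) filter"
  where "uniformity_hs_tuple = (INF e\<in>{0<..}. principal {(x, y). dist x y < e})"
definition open_hs_tuple :: "('a, 'b) hs_tuple set \<Rightarrow> bool"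
  where "open_hs_tuple S = (\<forall>x\<in>S. \<forall>\<^sub>F (x', y) in uniformity. x' = x \<longrightarrow> y \<in> S)"

instance
proof
  fix a b :: real and x y z :: "('a, 'b) hs_tuple"
  show "x + y + z = x + (y + z)" by transfer (simp add: add.assoc)
  show "x + y = y + x" by transfer (simp add: add.commute)
  show "0 + x = x" by transfer simp
  show "- x + x = 0" by transfer simp
  show "x - y = x + - y" by transfer simp
  show "a *\<^sub>R (x + y) = a *\<^sub>R x + a *\<^sub>R y" by transfer (simp add: scaleR_add_right)
  show "(a + b) *\<^sub>R x = a *\<^sub>R x + b *\<^sub>R x" by transfer (simp add: scaleR_add_left)
  show "a *\<^sub>R b *\<^sub>R x = (a * b) *\<^sub>R x" by transfer simp
  show "1 *\<^sub>R x = x" by transfer simp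
  show "inner x y = inner y x"
    by transfer (subst hs_tuple_inner_commute, simp)
  show "inner (x + y) z = inner x z + inner y z" by transfer (simp add: hs_tuple_inner_add_left)
  show "inner (a *\<^sub>R x) y = a * inner x y"
    by transfer (simp add: scaleC_of_real[symmetric] hs_tuple_inner_scale_left)
  show "0 \<le> inner x x"
    by transfer (simp add: hs_tuple_inner_self infsum_nonneg sum_nonneg)
  show "inner x x = 0 \<longleftrightarrow> x = 0"
  proof transfer
    fix T :: "'a \<Rightarrow> 'b \<Rightarrow> 'b" assume T: "\<forall>j. hilbert_schmidt (T j)"
    have "T j v = 0" if "Re (hs_tuple_inner T T) = 0" for j v
      using hs_tuple_norm_bound[OF T, of j v] that by simp
    then show "Re (hs_tuple_inner T T) = 0 \<longleftrightarrow> T = (\<lambda>j v. 0)"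
      by (auto simp: hs_tuple_inner_zero_right)
  qed
qed (simp_all add: norm_hs_tuple_def sgn_hs_tuple_def dist_hs_tuple_def uniformity_hs_tuple_def
      open_hs_tuple_def)

end

lemma norm_hs_tuple_sq: "(norm S)\<^sup>2 = Re (hs_tuple_inner (Rep_hs_tuple S) (Rep_hs_tuple S))"
  for S :: "('n::finite, 'h::complex_hilbert) hs_tuple"
  by (simp add: power2_norm_eq_inner inner_hs_tuple.rep_eq)

lemma norm_hs_tuple_apply:
  "norm (Rep_hs_tuple S j v) \<le> norm S * norm v"
  for S :: "('n::finite, 'h::complex_hilbert) hs_tuple"
proof -
  have "(norm (Rep_hs_tuple S j v))\<^sup>2 \<le> (norm S * norm v)\<^sup>2"
    unfolding norm_hs_tuple_sq power_mult_distrib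
    using Rep_hs_tuple[of S] by (intro hs_tuple_norm_bound) auto
  then show ?thesis by (rule power2_le_imp_le) simp
qed

lemma hs_tuple_partial_sum_le:
  fixes S :: "('n::finite, 'h::complex_hilbert) hs_tuple"
  assumes "finite F" "F \<subseteq> onb"
  shows "(\<Sum>e\<in>F. \<Sum>j\<in>UNIV. (norm (Rep_hs_tuple S j e))\<^sup>2) \<le> (norm S)\<^sup>2"
proof -
  have hs: "\<forall>j. hilbert_schmidt (Rep_hs_tuple S j)" using Rep_hs_tuple[of S] by auto
  then have "(\<lambda>e. \<Sum>j\<in>UNIV. (norm (Rep_hs_tuple S j e))\<^sup>2) summable_on onb"
    by (rule hs_tuple_summable)
  from finite_sum_le_infsum[OF this assms] show ?thesis
    by (simp add: norm_hs_tuple_sq hs_tuple_inner_self[OF hs] sum_nonneg)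
qed

text \<open>A Cauchy sequence of tuples converges pointwise, and Fatou's argument on finite partial sums
  shows that the pointwise limit is a limit in Hilbert--Schmidt norm.\<close>

instance hs_tuple :: (finite, complex_hilbert) complete_space
proof
  fix X :: "nat \<Rightarrow> ('a, 'b) hs_tuple" assume C: "Cauchy X"
  let ?X = "\<lambda>n. Rep_hs_tuple (X n)"
  have bc: "bounded_clinear (?X n j)" for n j
    using Rep_hs_tuple[of "X n"] hilbert_schmidt_bounded by auto
  have "Cauchy (\<lambda>n. ?X n j v)" for j v
  proof (rule metric_CauchyI)
    fix e :: real assume e: "0 < e"
    have "0 < e / (norm v + 1)" using e by (simp add: add_nonneg_pos)
    then obtain M where M: "\<And>m n. m \<ge> M \<Longrightarrow> n \<ge> M \<Longrightarrow> dist (X m) (X n) < e / (norm v + 1)"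
      using metric_CauchyD[OF C] by meson
    have "dist (?X m j v) (?X n j v) < e" if "m \<ge> M" "n \<ge> M" for m n
    proof -
      have "dist (?X m j v) (?X n j v) \<le> norm (X m - X n) * norm v"
        using norm_hs_tuple_apply[of "X m - X n" j v] by (simp add: dist_norm minus_hs_tuple.rep_eq)
      also have "\<dots> \<le> norm (X m - X n) * (norm v + 1)" by (intro mult_left_mono) auto
      also have "\<dots> < e" using M[OF that]
        by (simp add: dist_norm pos_less_divide_eq add_nonneg_pos)
      finally show ?thesis .
    qed
    then show "\<exists>M. \<forall>m\<ge>M. \<forall>n\<ge>M. dist (?X m j v) (?X n j v) < e" by blast
  qed
  then have "\<exists>T. \<forall>j v. (\<lambda>n. ?X n j v) \<longlonglongrightarrow> T j v"
    by (intro exI[of _ "\<lambda>j v. lim (\<lambda>n. ?X n j v)"]) (simp add: Cauchy_convergent convergent_LIMSEQ_iff[symmetric])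
  then obtain T where T: "\<And>j v. (\<lambda>n. ?X n j v) \<longlonglongrightarrow> T j v" by blast
  obtain K where K: "\<And>n. norm (X n) \<le> K"
    using Cauchy_Bseq[OF C] unfolding Bseq_def by blast
  have bT: "bounded_clinear (T j)" for j
  proof (rule bounded_clinearI[of _ K])
    fix x y and c :: complex
    show "T j (x + y) = T j x + T j y"
      using LIMSEQ_unique[OF T[of j "x + y"]] tendsto_add[OF T T]
      by (simp add: bounded_clinear_simps[OF bc])
    show "T j (c *\<^sub>C x) = c *\<^sub>C T j x"
      using LIMSEQ_unique[OF T[of j "c *\<^sub>C x"]]
        bounded_linear.tendsto[OF bounded_clinear_linear[OF bounded_clinear_scaleC] T[of j x], of c]
      by (simp add: bounded_clinear_simps[OF bc])
    show "norm (T j x) \<le> norm x * K"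
    proof (rule LIMSEQ_le_const2[OF tendsto_norm[OF T[of j x]]], intro exI allI impI)
      fix n show "norm (?X n j x) \<le> norm x * K"
        using norm_hs_tuple_apply[of "X n" j x] mult_right_mono[OF K[of n], of "norm x"]
        by (simp add: mult.commute)
    qed
  qed
  have tail: "(\<Sum>e\<in>F. \<Sum>j\<in>UNIV. (norm (?X n j e - T j e))\<^sup>2) \<le> \<epsilon>\<^sup>2"
    if F: "finite F" "F \<subseteq> onb" and n: "\<And>m. m \<ge> n \<Longrightarrow> dist (X n) (X m) \<le> \<epsilon>" for F n \<epsilon>
  proof (rule LIMSEQ_le_const2)
    show "(\<lambda>m. \<Sum>e\<in>F. \<Sum>j\<in>UNIV. (norm (?X n j e - ?X m j e))\<^sup>2)
        \<longlonglongrightarrow> (\<Sum>e\<in>F. \<Sum>j\<in>UNIV. (norm (?X n j e - T j e))\<^sup>2)"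
      by (intro tendsto_intros T)
    have "(\<Sum>e\<in>F. \<Sum>j\<in>UNIV. (norm (?X n j e - ?X m j e))\<^sup>2) \<le> \<epsilon>\<^sup>2" if "m \<ge> n" for m
    proof -
      have "(\<Sum>e\<in>F. \<Sum>j\<in>UNIV. (norm (?X n j e - ?X m j e))\<^sup>2) \<le> (norm (X n - X m))\<^sup>2"
        using hs_tuple_partial_sum_le[OF F, of "X n - X m"] by (simp add: minus_hs_tuple.rep_eq)
      also have "\<dots> \<le> \<epsilon>\<^sup>2" using n[OF that] by (intro power_mono) (auto simp: dist_norm)
      finally show ?thesis .
    qed
    then show "\<exists>N. \<forall>m\<ge>N. (\<Sum>e\<in>F. \<Sum>j\<in>UNIV. (norm (?X n j e - ?X m j e))\<^sup>2) \<le> \<epsilon>\<^sup>2" by blast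
  qed
  have diff_hs: "hilbert_schmidt (\<lambda>v. ?X n j v - T j v)"
    if n: "\<And>m. m \<ge> n \<Longrightarrow> dist (X n) (X m) \<le> \<epsilon>" for n j \<epsilon>
    unfolding hilbert_schmidt_def
  proof
    show "bounded_clinear (\<lambda>v. ?X n j v - T j v)" by (intro bounded_clinear_diff bc bT)
    show "(\<lambda>e. (norm (?X n j e - T j e))\<^sup>2) summable_on onb"
    proof (rule nonneg_bdd_above_summable_on)
      show "bdd_above (sum (\<lambda>e. (norm (?X n j e - T j e))\<^sup>2) ` {F. F \<subseteq> onb \<and> finite F})"
      proof (rule bdd_aboveI2[where M = "\<epsilon>\<^sup>2"], clarify)
        fix F :: "'b set" assume F: "F \<subseteq> onb" "finite F"
        have "(\<Sum>e\<in>F. (norm (?X n j e - T j e))\<^sup>2) \<le> (\<Sum>e\<in>F. \<Sum>j\<in>UNIV. (norm (?X n j e - T j e))\<^sup>2)"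
          by (intro sum_mono member_le_sum) auto
        then show "(\<Sum>e\<in>F. (norm (?X n j e - T j e))\<^sup>2) \<le> \<epsilon>\<^sup>2" using tail[OF F(2,1) n] by simp
      qed
    qed auto
  qed
  \<comment> \<open>The limit differs from a member of the sequence by a Hilbert--Schmidt tuple, hence is one itself.\<close>
  have C': "\<exists>M. \<forall>n\<ge>M. \<forall>m\<ge>n. dist (X n) (X m) \<le> \<epsilon>" if "0 < \<epsilon>" for \<epsilon>
    using metric_CauchyD[OF C that] by (metis less_imp_le order_trans)
  obtain M1 where "\<forall>n\<ge>M1. \<forall>m\<ge>n. dist (X n) (X m) \<le> 1" using C'[of 1] by auto
  then have "hilbert_schmidt (\<lambda>v. ?X M1 j v - T j v)" for j by (intro diff_hs) auto
  moreover have "hilbert_schmidt (?X M1 j)" for j using Rep_hs_tuple[of "X M1"] by auto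
  ultimately have hT: "hilbert_schmidt (T j)" for j
    using hilbert_schmidt_diff[of "?X M1 j" "\<lambda>v. ?X M1 j v - T j v"] by simp
  then have RT: "Rep_hs_tuple (Abs_hs_tuple T) = T" by (simp add: Abs_hs_tuple_inverse)
  have "X \<longlonglongrightarrow> Abs_hs_tuple T"
  proof (rule metric_LIMSEQ_I)
    fix r :: real assume r: "0 < r"
    then obtain M where M: "\<forall>n\<ge>M. \<forall>m\<ge>n. dist (X n) (X m) \<le> r / 2" using C'[of "r / 2"] by auto
    have "dist (X n) (Abs_hs_tuple T) < r" if n: "n \<ge> M" for n
    proof -
      let ?D = "\<lambda>j v. ?X n j v - T j v"
      have hD: "\<forall>j. hilbert_schmidt (?D j)" using M n by (auto intro!: diff_hs[where \<epsilon> = "r / 2"])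
      have "(norm (X n - Abs_hs_tuple T))\<^sup>2 = (\<Sum>\<^sub>\<infinity>e\<in>onb. \<Sum>j\<in>UNIV. (norm (?D j e))\<^sup>2)"
        by (simp add: norm_hs_tuple_sq minus_hs_tuple.rep_eq RT hs_tuple_inner_self[OF hD])
      also have "\<dots> \<le> (r / 2)\<^sup>2"
        by (rule infsum_le_finite_sums)
          (use hD M n in \<open>auto intro!: hs_tuple_summable tail[where n = n and \<epsilon> = "r / 2"]\<close>)
      finally have "norm (X n - Abs_hs_tuple T) \<le> r / 2"
        by (rule power2_le_imp_le) (use r in simp)
      then show ?thesis using r by (simp add: dist_norm)
    qed
    then show "\<exists>M. \<forall>n\<ge>M. dist (X n) (Abs_hs_tuple T) < r" by blast
  qed
  then show "convergent X" unfolding convergent_def by blast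
qed

instantiation hs_tuple :: (finite, complex_hilbert) complex_hilbert
begin

lift_definition scaleC_hs_tuple :: "complex \<Rightarrow> ('a, 'b) hs_tuple \<Rightarrow> ('a, 'b) hs_tuple"
  is "\<lambda>c T j v. c *\<^sub>C T j v" by (simp add: hilbert_schmidt_scale)
lift_definition cinner_hs_tuple :: "('a, 'b) hs_tuple \<Rightarrow> ('a, 'b) hs_tuple \<Rightarrow> complex"
  is "\<lambda>S T. hs_tuple_inner S T" .

instance
proof
  fix c d :: complex and r :: real and x y z :: "('a, 'b) hs_tuple"
  show "c *\<^sub>C (x + y) = c *\<^sub>C x + c *\<^sub>C y" by transfer (simp add: scaleC_add_right)
  show "(c + d) *\<^sub>C x = c *\<^sub>C x + d *\<^sub>C x" by transfer (simp add: scaleC_add_left)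
  show "c *\<^sub>C d *\<^sub>C x = (c * d) *\<^sub>C x" by transfer (simp add: scaleC_scaleC)
  show "complex_of_real r *\<^sub>C x = r *\<^sub>R x" by transfer (simp add: scaleC_of_real)
  show "cinner (x + y) z = cinner x z + cinner y z" by transfer (simp add: hs_tuple_inner_add_left)
  show "cinner (c *\<^sub>C x) y = c * cinner x y" by transfer (simp add: hs_tuple_inner_scale_left)
  show "cinner x y = cnj (cinner y x)" by transfer (rule hs_tuple_inner_commute)
  show "inner x y = Re (cinner x y)" by transfer simp
qed

end

lemma hs_tuple_dist_eq:
  assumes "\<forall>j. hilbert_schmidt (S j)" "\<forall>j. hilbert_schmidt (T j)"
  shows "hs_tuple_dist S T = dist (Abs_hs_tuple S) (Abs_hs_tuple T)"
  using assms
  by (simp add: hs_tuple_dist_def dist_norm norm_eq_sqrt_inner inner_hs_tuple.rep_eq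
      minus_hs_tuple.rep_eq Abs_hs_tuple_inverse)

text \<open>The closure given by the explicit \<open>\<epsilon>\<close>-condition is the topological closure in the type of tuples,
  which makes the projection theorem available for it.\<close>

lemma hs_closure_eq:
  assumes V: "\<forall>T\<in>V. \<forall>j. hilbert_schmidt (T j)"
  shows "hs_closure V = Rep_hs_tuple ` closure (Abs_hs_tuple ` V)"
proof (rule Set.set_eqI)
  fix S :: "'a \<Rightarrow> 'b \<Rightarrow> 'b"
  show "S \<in> hs_closure V \<longleftrightarrow> S \<in> Rep_hs_tuple ` closure (Abs_hs_tuple ` V)"
  proof (cases "\<forall>j. hilbert_schmidt (S j)")
    case True
    then have RS: "Rep_hs_tuple (Abs_hs_tuple S) = S" by (simp add: Abs_hs_tuple_inverse)
    have "S \<in> hs_closure V \<longleftrightarrow> Abs_hs_tuple S \<in> closure (Abs_hs_tuple ` V)"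
    proof -
      have "hs_tuple_dist S T = dist (Abs_hs_tuple T) (Abs_hs_tuple S)" if "T \<in> V" for T
        using hs_tuple_dist_eq[OF True, of T] V that by (simp add: dist_commute)
      then show ?thesis using True unfolding hs_closure_def closure_approachable by simp
    qed
    also have "\<dots> \<longleftrightarrow> S \<in> Rep_hs_tuple ` closure (Abs_hs_tuple ` V)"
      using RS by (auto simp: Rep_hs_tuple_inverse intro: image_eqI[where f = Rep_hs_tuple and x = "Abs_hs_tuple S"])
    finally show ?thesis .
  next
    case False
    then show ?thesis using Rep_hs_tuple by (auto simp: hs_closure_def)
  qed
qed

text \<open>The projection theorem provides a foot of the perpendicular, and the difference of two such feet
  is orthogonal to itself; so the definite description denotes the orthogonal projection.\<close>

lemma hs_proj_works:
  assumes V: "\<forall>T\<in>V. \<forall>j. hilbert_schmidt (T j)"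
    and V0: "(\<lambda>j v. 0) \<in> V"
    and Vadd: "\<forall>S\<in>V. \<forall>T\<in>V. (\<lambda>j v. S j v + T j v) \<in> V"
    and Vscale: "\<forall>c. \<forall>T\<in>V. (\<lambda>j v. c *\<^sub>C T j v) \<in> V"
    and S: "\<forall>j. hilbert_schmidt (S j)"
  shows "hs_proj (hs_closure V) S \<in> hs_closure V"
    and "\<And>T. T \<in> hs_closure V \<Longrightarrow> hs_tuple_inner (\<lambda>j v. S j v - hs_proj (hs_closure V) S j v) T = 0"
proof -
  have "complex_vector.subspace (Abs_hs_tuple ` V)"
    unfolding complex_vector.subspace_def
  proof (intro conjI ballI allI)
    show "0 \<in> Abs_hs_tuple ` V" using V0 unfolding zero_hs_tuple_def by auto
  next
    fix x y assume "x \<in> Abs_hs_tuple ` V" "y \<in> Abs_hs_tuple ` V"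
    then obtain A B where "A \<in> V" "B \<in> V" "x = Abs_hs_tuple A" "y = Abs_hs_tuple B" by blast
    then show "x + y \<in> Abs_hs_tuple ` V"
      using Vadd V by (auto simp: plus_hs_tuple_def Abs_hs_tuple_inverse)
  next
    fix c x assume "x \<in> Abs_hs_tuple ` V"
    then obtain A where "A \<in> V" "x = Abs_hs_tuple A" by blast
    then show "c *\<^sub>C x \<in> Abs_hs_tuple ` V"
      using Vscale V by (auto simp: scaleC_hs_tuple_def Abs_hs_tuple_inverse)
  qed
  then obtain p where p: "p \<in> closure (Abs_hs_tuple ` V)"
      "\<And>v. v \<in> closure (Abs_hs_tuple ` V) \<Longrightarrow> cinner (Abs_hs_tuple S - p) v = 0"
    using complex_orthogonal_projection_exists[OF closure_complex_subspace closed_closure] by blast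
  have RS: "Rep_hs_tuple (Abs_hs_tuple S) = S" using S by (simp add: Abs_hs_tuple_inverse)
  have ex: "Rep_hs_tuple p \<in> hs_closure V \<and>
      (\<forall>T\<in>hs_closure V. hs_tuple_inner (\<lambda>j v. S j v - Rep_hs_tuple p j v) T = 0)"
    unfolding hs_closure_eq[OF V]
    using p by (auto simp: cinner_hs_tuple.rep_eq minus_hs_tuple.rep_eq RS)
  have uniq: "P = Rep_hs_tuple p" if P: "P \<in> hs_closure V"
      "\<forall>T\<in>hs_closure V. hs_tuple_inner (\<lambda>j v. S j v - P j v) T = 0" for P
  proof -
    obtain q where q: "q \<in> closure (Abs_hs_tuple ` V)" "P = Rep_hs_tuple q"
      using P(1) unfolding hs_closure_eq[OF V] by blast
    have qo: "cinner (Abs_hs_tuple S - q) v = 0" if "v \<in> closure (Abs_hs_tuple ` V)" for v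
      using P(2) that unfolding hs_closure_eq[OF V]
      by (auto simp: cinner_hs_tuple.rep_eq minus_hs_tuple.rep_eq RS q(2))
    have "cinner (q - p) v = 0" if "v \<in> closure (Abs_hs_tuple ` V)" for v
      using qo[OF that] p(2)[OF that] by (simp add: cinner_diff_left)
    then have "cinner (q - p) (q - p) = 0" using p(1) q(1) by (simp add: cinner_diff_right)
    then show ?thesis using q(2) by simp
  qed
  have "hs_proj (hs_closure V) S = Rep_hs_tuple p"
    unfolding hs_proj_def using ex uniq by (intro the_equality) auto
  then show "hs_proj (hs_closure V) S \<in> hs_closure V"
    "\<And>T. T \<in> hs_closure V \<Longrightarrow> hs_tuple_inner (\<lambda>j v. S j v - hs_proj (hs_closure V) S j v) T = 0"
    using ex by auto
qed

lemma hs_closure_superset: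
  assumes "T \<in> V" "\<forall>j. hilbert_schmidt (T j)"
  shows "T \<in> hs_closure V"
proof -
  have "hs_tuple_dist T T = 0" using assms by (simp add: hs_tuple_dist_eq)
  then show ?thesis using assms unfolding hs_closure_def by (auto intro!: bexI[of _ T])
qed

lemma hs_closure_zero: "hs_closure {\<lambda>j v. 0} = {\<lambda>j v. 0}"
proof -
  have "hs_closure {\<lambda>j v. 0 :: 'b} = Rep_hs_tuple ` closure (Abs_hs_tuple ` {\<lambda>(j::'a) v. 0 :: 'b})"
    by (rule hs_closure_eq) auto
  then show ?thesis by (simp add: zero_hs_tuple.rep_eq flip: zero_hs_tuple_def)
qed

section \<open>Vanishing of the Murray--von Neumann dimension\<close>

text \<open>The dimension is the sum of the squared norms of the projections of the vectors \<open>p \<otimes> e\<^sub>j\<close>,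
  with \<open>p\<close> the trace projection; it vanishes only if these vectors are orthogonal to \<open>V\<close>.\<close>

lemma MvN_dim_eq_0D:
  fixes V :: "('n::finite \<Rightarrow> 'h::complex_hilbert \<Rightarrow> 'h) set"
  assumes V: "\<forall>T\<in>V. \<forall>j. hilbert_schmidt (T j)"
    and V0: "(\<lambda>j v. 0) \<in> V"
    and Vadd: "\<forall>S\<in>V. \<forall>T\<in>V. (\<lambda>j v. S j v + T j v) \<in> V"
    and Vscale: "\<forall>c. \<forall>T\<in>V. (\<lambda>j v. c *\<^sub>C T j v) \<in> V"
    and dim: "MvN_dim \<iota> (hs_closure V) = 0"
    and T: "T \<in> V"
  shows "cinner (T j (\<iota> id)) (\<iota> id) = 0"
proof -
  define E where "E j = (\<lambda>k::'n. if k = j then trace_proj \<iota> else (\<lambda>v. 0))" for j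
  define P where "P j = hs_proj (hs_closure V) (E j)" for j
  have hp: "hilbert_schmidt (trace_proj \<iota>)"
    unfolding trace_proj_def by (rule hilbert_schmidt_rank_one)
  then have hE: "\<forall>k. hilbert_schmidt (E j k)" for j unfolding E_def by simp
  note pw = hs_proj_works[OF V V0 Vadd Vscale hE, folded P_def]
  have hP: "\<forall>k. hilbert_schmidt (P j k)" for j using pw(1) unfolding hs_closure_def by blast
  have inE: "hs_tuple_inner S (E j) = hs_inner (S j) (trace_proj \<iota>)" for S j
  proof -
    have "hs_tuple_inner S (E j) = (\<Sum>k\<in>UNIV. if k = j then hs_inner (S j) (trace_proj \<iota>) else 0)"
      unfolding hs_tuple_inner_def by (intro sum.cong refl) (auto simp: E_def hs_inner_def)
    then show ?thesis by simp
  qed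
  have sub: "hs_tuple_inner (\<lambda>k v. E j k v - P j k v) S
      = hs_tuple_inner (E j) S - hs_tuple_inner (P j) S" if "\<forall>k. hilbert_schmidt (S k)" for S j
    using hs_tuple_inner_add_left[OF hE[of j] _ that, of "\<lambda>k v. (-1) *\<^sub>C P j k v"]
      hs_tuple_inner_scale_left[of "-1" "P j" S] hP[of j]
    by (simp add: hilbert_schmidt_uminus)
  have EP: "hs_tuple_inner (E j) S = hs_tuple_inner (P j) S" if "S \<in> hs_closure V" for S j
    using pw(2)[OF that, of j] sub[of S j] that unfolding hs_closure_def by simp
  \<comment> \<open>The \<open>j\<close>-th diagonal entry contributes \<open>\<langle>P E\<^sub>j, E\<^sub>j\<rangle> = \<parallel>P E\<^sub>j\<parallel>\<^sup>2\<close>, where \<open>E\<^sub>j\<close> is the trace projection in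
    position \<open>j\<close>.\<close>
  have tr: "commutant_trace \<iota> (matrix_entry (hs_proj (hs_closure V)) j j)
      = cnj (hs_tuple_inner (P j) (P j))" for j
  proof -
    have "commutant_trace \<iota> (matrix_entry (hs_proj (hs_closure V)) j j) = hs_tuple_inner (P j) (E j)"
      unfolding commutant_trace_def matrix_entry_def inE P_def E_def[symmetric] ..
    also have "\<dots> = cnj (hs_tuple_inner (E j) (P j))" by (rule hs_tuple_inner_commute)
    finally show ?thesis by (simp add: EP[OF pw(1)])
  qed
  have "(\<Sum>j\<in>UNIV. (norm (Abs_hs_tuple (P j)))\<^sup>2) = 0"
    using dim hP by (simp add: MvN_dim_def tr norm_hs_tuple_sq Abs_hs_tuple_inverse)
  then have "Abs_hs_tuple (P j) = 0" by (simp add: sum_nonneg_eq_0_iff)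
  moreover have "Rep_hs_tuple (Abs_hs_tuple (P j)) = P j" using hP by (simp add: Abs_hs_tuple_inverse)
  ultimately have "P j = (\<lambda>j v. 0)" by (simp add: zero_hs_tuple.rep_eq)
  moreover have TV: "T \<in> hs_closure V" using T V by (intro hs_closure_superset) auto
  ultimately have "hs_tuple_inner (E j) T = 0"
    using EP[OF TV, of j] hs_tuple_inner_commute[of "P j" T] by (simp add: hs_tuple_inner_zero_right)
  then have "hs_inner (T j) (trace_proj \<iota>) = 0"
    using inE[of T j] hs_tuple_inner_commute[of T "E j"] by simp
  then show ?thesis
    using hs_inner_rank_one[OF hilbert_schmidt_bounded[of "T j"], of "\<iota> id" "\<iota> id"] V T
    by (simp add: trace_proj_def)
qed

lemma MvN_dim_zero: "MvN_dim \<iota> {\<lambda>(j::'n::finite) v. 0 :: 'h::complex_hilbert} = 0"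
proof -
  have "hs_proj {\<lambda>(j::'n) v. 0 :: 'h} S = (\<lambda>j v. 0)" for S
    unfolding hs_proj_def by (intro the_equality) (auto simp: hs_tuple_inner_zero_right)
  then show ?thesis by (simp add: MvN_dim_def commutant_trace_def matrix_entry_def hs_inner_def)
qed

section \<open>The standard form of a tracial von Neumann algebra\<close>

lemma continuous_eq_on_dense:
  fixes f g :: "'a::topological_space \<Rightarrow> 'b::t2_space"
  assumes "continuous_on UNIV f" "continuous_on UNIV g" "\<And>x. x \<in> S \<Longrightarrow> f x = g x" "closure S = UNIV"
  shows "f x = g x"
proof -
  have "closed {x. f x = g x}" by (intro closed_Collect_eq assms)
  then have "closure S \<subseteq> {x. f x = g x}" using assms(3) by (intro closure_minimal) auto
  then show ?thesis using assms(4) by auto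
qed

text \<open>Density is used in one variable at a time.\<close>

lemma additive_from_dense:
  fixes g :: "'a::real_normed_vector \<Rightarrow> 'b::real_normed_vector"
  assumes "continuous_on UNIV g" "closure S = UNIV" "\<And>x y. x \<in> S \<Longrightarrow> y \<in> S \<Longrightarrow> g (x + y) = g x + g y"
  shows "g (x + y) = g x + g y"
proof -
  have c: "continuous_on UNIV (\<lambda>x. g (x + y))" for y
    by (intro continuous_on_compose2[OF assms(1)] continuous_intros) auto
  have 1: "g (x + y) = g x + g y" if "y \<in> S" for x y
    by (rule continuous_eq_on_dense[OF c _ _ assms(2)]) (auto intro!: continuous_intros assms(1,3) that)
  show ?thesis
  proof (rule continuous_eq_on_dense[OF c _ _ assms(2)])
    show "continuous_on UNIV (\<lambda>x. g x + g y)" by (intro continuous_intros assms(1))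
    fix x assume "x \<in> S"
    from 1[OF this, of y] show "g (x + y) = g x + g y" by (simp add: add.commute)
  qed
qed

text \<open>The Lipschitz bound makes \<open>h\<close> constant on the fibres of \<open>\<iota>\<close>, so that it descends to the dense
  image of \<open>\<iota>\<close> and extends by uniform continuity.\<close>

lemma Lipschitz_extension_from_dense:
  fixes \<iota> h :: "'m \<Rightarrow> 'h::complete_space"
  assumes dense: "closure (\<iota> ` M) = UNIV" and C: "0 \<le> C"
    and lip: "\<And>a b. a \<in> M \<Longrightarrow> b \<in> M \<Longrightarrow> dist (h a) (h b) \<le> C * dist (\<iota> a) (\<iota> b)"
  shows "\<exists>g. C-lipschitz_on UNIV g \<and> (\<forall>a\<in>M. g (\<iota> a) = h a)"
proof -
  define f where "f x = h (inv_into M \<iota> x)" for x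
  have f: "f (\<iota> a) = h a" if "a \<in> M" for a
  proof -
    have "inv_into M \<iota> (\<iota> a) \<in> M" "\<iota> (inv_into M \<iota> (\<iota> a)) = \<iota> a"
      using that by (auto intro: inv_into_into f_inv_into_f)
    then show ?thesis using lip[of "inv_into M \<iota> (\<iota> a)" a] that by (simp add: f_def)
  qed
  have "C-lipschitz_on (\<iota> ` M) f"
    by (rule lipschitz_onI) (auto simp: f lip C)
  from lipschitz_extend_closure[OF this] show ?thesis unfolding dense using f by auto
qed

lemma commutant_commutantD:
  assumes "von_neumann_algebra M"
  shows "a \<in> M \<longleftrightarrow> bounded_clinear a \<and> (\<forall>b\<in>commutant M. \<forall>x. b (a x) = a (b x))"
proof -
  have "a \<in> M \<longleftrightarrow> a \<in> commutant (commutant M)" using assms unfolding von_neumann_algebra_def by simp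
  then show ?thesis by (simp add: commutant_def[of "commutant M"] fun_eq_iff)
qed

text \<open>A positive square root of \<open>1 - x\<close> is \<open>1 - y\<close> with \<open>y\<close> the fixed point of
  \<open>y \<mapsto> (x + y\<^sup>2) / 2\<close>, which contracts the selfadjoint part of a ball of the algebra.\<close>

lemma von_neumann_algebra_sqrt:
  fixes M :: "('k::complex_hilbert \<Rightarrow> 'k) set"
  assumes M: "von_neumann_algebra M" and x: "x \<in> M" and sa: "\<And>v w. cinner (x v) w = cinner v (x w)"
    and nx: "\<And>v. norm (x v) \<le> 1/2 * norm v"
  shows "\<exists>c\<in>M. cadj c = c \<and> (\<forall>v. c (c v) = v - x v)"
proof -
  have bx: "bounded_clinear x" using M x unfolding von_neumann_algebra_def by blast
  define X where "X = Blinfun x"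
  have X: "blinfun_apply X = x" unfolding X_def
    by (rule bounded_linear_Blinfun_apply[OF bounded_clinear_linear[OF bx]])
  have nX: "norm X \<le> 1/2" by (rule norm_blinfun_bound) (simp, unfold X, rule nx)
  \<comment> \<open>\<open>S\<close> is closed in operator norm because complex linearity, commutation with the commutant and
    selfadjointness are closed conditions; its members belong to the algebra because they commute with
    the commutant.\<close>
  define S where "S = {y :: 'k \<Rightarrow>\<^sub>L 'k. (\<forall>c v. blinfun_apply y (c *\<^sub>C v) = c *\<^sub>C blinfun_apply y v) \<and>
      (\<forall>b\<in>commutant M. \<forall>v. b (blinfun_apply y v) = blinfun_apply y (b v)) \<and> (\<forall>v w. cinner (blinfun_apply y v) w = cinner v (blinfun_apply y w)) \<and> norm y \<le> 1/2}"
  have cont: "continuous_on UNIV (\<lambda>y :: 'k \<Rightarrow>\<^sub>L 'k. blinfun_apply y v)" for v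
    by (intro continuous_intros)
  have cb: "continuous_on UNIV (\<lambda>y :: 'k \<Rightarrow>\<^sub>L 'k. b (blinfun_apply y v))" if "bounded_clinear b" for b v
    using continuous_on_compose2[OF bounded_clinear_continuous[OF that] cont] by auto
  have bc: "bounded_clinear b" if "b \<in> commutant M" for b using that unfolding commutant_def by blast
  have "closed S"
  proof -
    have "closed {y :: 'k \<Rightarrow>\<^sub>L 'k. blinfun_apply y (c *\<^sub>C v) = c *\<^sub>C blinfun_apply y v}" for c v
      by (intro closed_Collect_eq cont cb bounded_clinear_scaleC)
    moreover have "closed {y :: 'k \<Rightarrow>\<^sub>L 'k. b \<in> commutant M \<longrightarrow> b (blinfun_apply y v) = blinfun_apply y (b v)}" for b v
      by (cases "b \<in> commutant M") (auto intro!: closed_Collect_eq cont cb bc)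
    moreover have "closed {y :: 'k \<Rightarrow>\<^sub>L 'k. cinner (blinfun_apply y v) w = cinner v (blinfun_apply y w)}" for v w
      by (intro closed_Collect_eq continuous_on_cinner cont continuous_on_const)
    moreover have "closed {y :: 'k \<Rightarrow>\<^sub>L 'k. norm y \<le> 1/2}"
      by (intro closed_Collect_le continuous_intros)
    ultimately show ?thesis
      unfolding S_def Ball_def all_simps[symmetric]
      by (intro closed_Collect_conj closed_Collect_all)
        (auto simp: all_simps simp del: all_simps intro!: closed_Collect_all)
  qed
  then have cS: "complete S" by (simp add: complete_eq_closed)
  define f where "f y = (1/2) *\<^sub>R (X + (y o\<^sub>L y))" for y
  have "\<exists>!y\<in>S. f y = y"
  proof (rule Banach_fix[OF cS, of "1/2"])
    have "0 \<in> S" by (auto simp: S_def bounded_clinear_simps[OF bc])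
    then show "S \<noteq> {}" by blast
    show "f ` S \<subseteq> S"
    proof clarify
      fix y assume y: "y \<in> S"
      have ny: "norm y \<le> 1/2" using y by (simp only: S_def mem_Collect_eq)
      have "norm (y o\<^sub>L y) \<le> norm y * norm y" by (rule norm_blinfun_compose)
      also have "\<dots> \<le> 1/2 * (1/2)" using ny by (intro mult_mono norm_ge_zero) simp_all
      finally have "norm (X + (y o\<^sub>L y)) \<le> 1"
        using norm_triangle_ineq[of X "y o\<^sub>L y"] nX by linarith
      then have "norm (f y) \<le> 1/2" by (simp add: f_def)
      moreover have "blinfun_apply (f y) v = (1/2 :: complex) *\<^sub>C (x v + blinfun_apply y (blinfun_apply y v))" for v
        using scaleC_of_real[of "1/2" "x v + blinfun_apply y (blinfun_apply y v)"] by (simp add: f_def blinfun.bilinear_simps X)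
      moreover have "b (x v) = x (b v)" if "b \<in> commutant M" for b v
        using x that commutant_commutantD[OF M] by blast
      ultimately show "f y \<in> S" using y
        by (simp add: S_def bounded_clinear_simps[OF bc] bounded_clinear_simps[OF bx] scaleC_scaleC
            scaleC_add_right mult.commute cinner_add_left cinner_add_right cinner_scaleC_left
            cinner_scaleC_right sa)
    qed
    fix y z assume yz: "y \<in> S" "z \<in> S"
    have "f y - f z = (1/2) *\<^sub>R ((y o\<^sub>L (y - z)) + ((y - z) o\<^sub>L z))"
      by (rule blinfun_eqI) (simp add: f_def blinfun.bilinear_simps algebra_simps)
    then have "dist (f y) (f z) \<le> 1/2 * (norm (y o\<^sub>L (y - z)) + norm ((y - z) o\<^sub>L z))"
      unfolding dist_norm by (simp add: norm_triangle_ineq)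
    also have "\<dots> \<le> 1/2 * (norm y * norm (y - z) + norm (y - z) * norm z)"
      by (intro mult_left_mono add_mono norm_blinfun_compose) auto
    also have "\<dots> \<le> 1/2 * (1/2 * norm (y - z) + norm (y - z) * (1/2))"
      using yz by (intro mult_left_mono add_mono mult_right_mono) (auto simp: S_def)
    finally show "dist (f y) (f z) \<le> 1/2 * dist y z" by (simp add: dist_norm)
  qed auto
  then obtain y where y: "y \<in> S" "f y = y" by blast
  define c where "c v = v - blinfun_apply y v" for v
  have by': "bounded_clinear (blinfun_apply y)"
    using y(1) by (auto simp: bounded_clinear_def S_def blinfun.bounded_linear_right)
  have bcc: "bounded_clinear c" unfolding c_def by (intro bounded_clinear_diff by' bounded_clinear_id)
  have "c \<in> M"
    unfolding commutant_commutantD[OF M]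
    using y(1) bcc by (auto simp: c_def S_def bounded_clinear_simps[OF bc])
  moreover have "cadj c = c"
    by (rule cadj_unique) (use y(1) in \<open>simp add: c_def S_def cinner_diff_left cinner_diff_right\<close>)
  moreover have "c (c v) = v - x v" for v
  proof -
    have "2 *\<^sub>R blinfun_apply y v = x v + blinfun_apply y (blinfun_apply y v)"
      using arg_cong[OF y(2), of "\<lambda>z. 2 *\<^sub>R blinfun_apply z v"]
      by (simp add: f_def blinfun.bilinear_simps X)
    then show ?thesis by (simp add: c_def blinfun.bilinear_simps scaleR_2 algebra_simps)
  qed
  ultimately show ?thesis by blast
qed

locale tracial_L2 =
  fixes M :: "('k::complex_hilbert \<Rightarrow> 'k) set" and \<tau> :: "('k \<Rightarrow> 'k) \<Rightarrow> complex"
    and \<iota> :: "('k \<Rightarrow> 'k) \<Rightarrow> 'h::complex_hilbert"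
  assumes tracial: "tracial_Wstar_space M \<tau>" and L2: "is_L2 M \<tau> \<iota>"
begin

lemma vN: "von_neumann_algebra M" using tracial unfolding tracial_Wstar_space_def by blast

lemma bdd [simp]: "a \<in> M \<Longrightarrow> bounded_clinear a" using vN unfolding von_neumann_algebra_def by blast

lemma cadj_M [simp]: "a \<in> M \<Longrightarrow> cadj a \<in> M" using vN unfolding von_neumann_algebra_def by blast

lemma bdd_commutant: "b \<in> commutant M \<Longrightarrow> bounded_clinear b" unfolding commutant_def by blast

lemma id_M [simp]: "id \<in> M"
  unfolding commutant_commutantD[OF vN] by simp

lemma add_M [simp]: "a \<in> M \<Longrightarrow> b \<in> M \<Longrightarrow> (\<lambda>x. a x + b x) \<in> M"
  by (subst commutant_commutantD[OF vN])
    (auto intro!: bounded_clinear_add simp: commutant_commutantD[OF vN] bounded_clinear_simps[OF bdd_commutant])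

lemma scale_M [simp]: "a \<in> M \<Longrightarrow> (\<lambda>x. c *\<^sub>C a x) \<in> M"
  by (subst commutant_commutantD[OF vN])
    (auto intro!: bounded_clinear_scale simp: commutant_commutantD[OF vN] bounded_clinear_simps[OF bdd_commutant])

lemma comp_M [simp]: "a \<in> M \<Longrightarrow> b \<in> M \<Longrightarrow> a \<circ> b \<in> M"
  by (subst commutant_commutantD[OF vN]) (auto intro!: bounded_clinear_comp simp: commutant_commutantD[OF vN])

lemma zero_M [simp]: "(\<lambda>x. 0) \<in> M"
  using scale_M[OF id_M, of 0] by simp

lemma sum_M [simp]: "(\<And>i. i \<in> I \<Longrightarrow> a i \<in> M) \<Longrightarrow> (\<lambda>x. \<Sum>i\<in>I. a i x) \<in> M"
  by (induction I rule: infinite_finite_induct) auto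

lemma tau_trace: "a \<in> M \<Longrightarrow> b \<in> M \<Longrightarrow> \<tau> (a \<circ> b) = \<tau> (b \<circ> a)"
  using tracial unfolding tracial_Wstar_space_def by blast

lemma tau_add: "a \<in> M \<Longrightarrow> b \<in> M \<Longrightarrow> \<tau> (\<lambda>x. a x + b x) = \<tau> a + \<tau> b"
  using tracial unfolding tracial_Wstar_space_def by blast

lemma tau_scale: "a \<in> M \<Longrightarrow> \<tau> (\<lambda>x. c *\<^sub>C a x) = c * \<tau> a"
  using tracial unfolding tracial_Wstar_space_def by blast

lemma iota_add: "a \<in> M \<Longrightarrow> b \<in> M \<Longrightarrow> \<iota> (\<lambda>x. a x + b x) = \<iota> a + \<iota> b"
  using L2 unfolding is_L2_def by blast

lemma iota_scale: "a \<in> M \<Longrightarrow> \<iota> (\<lambda>x. c *\<^sub>C a x) = c *\<^sub>C \<iota> a"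
  using L2 unfolding is_L2_def by blast

lemma iota_cinner: "a \<in> M \<Longrightarrow> b \<in> M \<Longrightarrow> cinner (\<iota> a) (\<iota> b) = \<tau> (cadj b \<circ> a)"
  using L2 unfolding is_L2_def by blast

lemma iota_dense: "closure (\<iota> ` M) = UNIV"
  using L2 unfolding is_L2_def by blast

lemma iota_diff: "a \<in> M \<Longrightarrow> b \<in> M \<Longrightarrow> \<iota> (\<lambda>x. a x - b x) = \<iota> a - \<iota> b"
  using iota_add[of a "\<lambda>x. (-1) *\<^sub>C b x"] iota_scale[of b "-1"] scale_M[of b "-1"] by simp

lemma diff_M [simp]: "a \<in> M \<Longrightarrow> b \<in> M \<Longrightarrow> (\<lambda>x. a x - b x) \<in> M"
  using add_M[OF _ scale_M[of b "-1"], of a] by simp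

text \<open>With \<open>K\<close> a bound of \<open>a*a\<close>, the operator \<open>1 - a*a / (2K)\<close> is \<open>c\<^sup>2\<close> for a selfadjoint \<open>c\<close> in the algebra.
  Hence \<open>b*b - (ab)*(ab) / (2K) = (cb)*(cb)\<close>, and the trace of the right-hand side is nonnegative.\<close>

lemma left_mult_bound:
  assumes a: "a \<in> M"
  shows "\<exists>C\<ge>0. \<forall>b\<in>M. norm (\<iota> (a \<circ> b)) \<le> C * norm (\<iota> b)"
proof -
  have aa: "cadj a \<circ> a \<in> M" using a by simp
  obtain K where K: "0 < K" "\<And>v. norm ((cadj a \<circ> a) v) \<le> K * norm v"
    using bounded_clinear_bound[OF bdd[OF aa]] by blast
  \<comment> \<open>The factor 2 leaves room for the contraction argument behind the square root.\<close>
  define r where "r = complex_of_real (1 / (2 * K))"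
  define x where "x v = r *\<^sub>C (cadj a \<circ> a) v" for v
  have "x \<in> M" unfolding x_def using scale_M[OF aa] .
  moreover have "cinner (x v) w = cinner v (x w)" for v w
    using a by (simp add: x_def cinner_scaleC_left cinner_scaleC_right cadj_works cadj_cadj r_def)
  moreover have "norm (x v) \<le> 1/2 * norm v" for v
    using K by (simp add: x_def r_def norm_divide field_simps del: comp_apply)
  ultimately obtain c where c: "c \<in> M" "cadj c = c" "\<And>v. c (c v) = v - x v"
    using von_neumann_algebra_sqrt[OF vN, of x] by blast
  have "(norm (\<iota> (a \<circ> b)))\<^sup>2 \<le> (sqrt (2 * K) * norm (\<iota> b))\<^sup>2" if b: "b \<in> M" for b
  proof -
    have ab: "a \<circ> b \<in> M" "cadj (a \<circ> b) \<circ> (a \<circ> b) \<in> M" "cadj b \<circ> b \<in> M" using a b by auto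
    have "cadj (c \<circ> b) \<circ> (c \<circ> b) = (\<lambda>v. (cadj b \<circ> b) v - r *\<^sub>C (cadj (a \<circ> b) \<circ> (a \<circ> b)) v)"
      using a b c by (auto simp: cadj_comp x_def bounded_clinear_simps[OF bdd[OF cadj_M[OF b]]])
    also have "\<dots> = (\<lambda>v. (cadj b \<circ> b) v + (- r) *\<^sub>C (cadj (a \<circ> b) \<circ> (a \<circ> b)) v)" by simp
    finally have "cinner (\<iota> (c \<circ> b)) (\<iota> (c \<circ> b))
        = \<tau> (\<lambda>v. (cadj b \<circ> b) v + (- r) *\<^sub>C (cadj (a \<circ> b) \<circ> (a \<circ> b)) v)"
      using c(1) b by (simp add: iota_cinner del: comp_apply)
    also have "\<dots> = \<tau> (cadj b \<circ> b) + (- r) * \<tau> (cadj (a \<circ> b) \<circ> (a \<circ> b))"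
      unfolding tau_add[OF ab(3) scale_M[OF ab(2)]] tau_scale[OF ab(2)] ..
    also have "\<dots> = cinner (\<iota> b) (\<iota> b) - r * cinner (\<iota> (a \<circ> b)) (\<iota> (a \<circ> b))"
      using b ab by (simp add: iota_cinner del: comp_apply)
    finally have "(norm (\<iota> (c \<circ> b)))\<^sup>2 = (norm (\<iota> b))\<^sup>2 - 1 / (2 * K) * (norm (\<iota> (a \<circ> b)))\<^sup>2"
      unfolding cinner_self r_def of_real_mult[symmetric] of_real_diff[symmetric] of_real_eq_iff .
    then have "1 / (2 * K) * (norm (\<iota> (a \<circ> b)))\<^sup>2 \<le> (norm (\<iota> b))\<^sup>2"
      using zero_le_power2[of "norm (\<iota> (c \<circ> b))"] by linarith
    then show ?thesis using K(1) by (simp add: power_mult_distrib field_simps)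
  qed
  then have "norm (\<iota> (a \<circ> b)) \<le> sqrt (2 * K) * norm (\<iota> b)" if "b \<in> M" for b
    by (rule power2_le_imp_le) (use that K(1) in simp_all)
  then show ?thesis using K(1) by (intro exI[of _ "sqrt (2 * K)"]) auto
qed

text \<open>The bound on \<open>b \<mapsto> ab\<close> makes it Lipschitz for the \<open>L\<^sup>2\<close>-norm; linearity passes from the dense image
  of the algebra to the whole space.\<close>

lemma L2_left_exists:
  assumes a: "a \<in> M"
  shows "\<exists>L. bounded_clinear L \<and> (\<forall>b\<in>M. L (\<iota> b) = \<iota> (a \<circ> b))"
proof -
  obtain C where C: "0 \<le> C" "\<And>b. b \<in> M \<Longrightarrow> norm (\<iota> (a \<circ> b)) \<le> C * norm (\<iota> b)"
    using left_mult_bound[OF a] by blast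
  note la = bounded_clinear_simps[OF bdd[OF a]]
  have "dist (\<iota> (a \<circ> b)) (\<iota> (a \<circ> c)) \<le> C * dist (\<iota> b) (\<iota> c)" if "b \<in> M" "c \<in> M" for b c
  proof -
    have "a \<circ> (\<lambda>x. b x - c x) = (\<lambda>x. (a \<circ> b) x - (a \<circ> c) x)" by (auto simp: la)
    then show ?thesis using C(2)[OF diff_M[OF that]] that a by (simp add: dist_norm iota_diff del: comp_apply)
  qed
  from Lipschitz_extension_from_dense[OF iota_dense C(1), of "\<lambda>b. \<iota> (a \<circ> b)", OF this]
  obtain g where g: "C-lipschitz_on UNIV g" "\<And>b. b \<in> M \<Longrightarrow> g (\<iota> b) = \<iota> (a \<circ> b)"
    by blast
  have cont: "continuous_on UNIV g"
    using g(1) by (intro uniformly_continuous_imp_continuous lipschitz_on_uniformly_continuous)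
  have add: "g (x + y) = g x + g y" for x y
  proof (rule additive_from_dense[OF cont iota_dense])
    fix x y assume "x \<in> \<iota> ` M" "y \<in> \<iota> ` M"
    then obtain b c where bc: "b \<in> M" "c \<in> M" "x = \<iota> b" "y = \<iota> c" by blast
    have "a \<circ> (\<lambda>x. b x + c x) = (\<lambda>x. (a \<circ> b) x + (a \<circ> c) x)" by (auto simp: la)
    then show "g (x + y) = g x + g y"
      using bc a g(2)[OF add_M[OF bc(1,2)]] by (simp add: iota_add g(2) del: comp_apply)
  qed
  have scale: "g (c *\<^sub>C x) = c *\<^sub>C g x" for c x
  proof (rule continuous_eq_on_dense[where f = "\<lambda>x. g (c *\<^sub>C x)" and g = "\<lambda>x. c *\<^sub>C g x", OF _ _ _ iota_dense])
    show "continuous_on UNIV (\<lambda>x. g (c *\<^sub>C x))"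
      by (intro continuous_on_compose2[OF cont] bounded_clinear_continuous bounded_clinear_scaleC) auto
    show "continuous_on UNIV (\<lambda>x. c *\<^sub>C g x)"
      using continuous_on_compose2[OF bounded_clinear_continuous[OF bounded_clinear_scaleC] cont] by auto
    fix x assume "x \<in> \<iota> ` M"
    then obtain b where b: "b \<in> M" "x = \<iota> b" by blast
    have "a \<circ> (\<lambda>x. c *\<^sub>C b x) = (\<lambda>x. c *\<^sub>C (a \<circ> b) x)" by (auto simp: la)
    then show "g (c *\<^sub>C x) = c *\<^sub>C g x"
      using b a g(2)[OF scale_M[OF b(1)], of c] by (simp add: iota_scale g(2) del: comp_apply)
  qed
  have "g 0 = 0" using scale[of 0 0] by simp
  then have "norm (g x) \<le> norm x * C" for x
    using lipschitz_onD[OF g(1), of x 0] by (simp add: mult.commute)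
  then show ?thesis using bounded_clinearI[of g C] add scale g(2) by blast
qed

abbreviation "Lm \<equiv> L2_left M \<iota>"
abbreviation "J \<equiv> L2_J M \<iota>"
abbreviation "\<xi> \<equiv> \<iota> id"

lemma eq_on_iotaI:
  assumes "bounded_clinear f" "bounded_clinear g" "\<And>b. b \<in> M \<Longrightarrow> f (\<iota> b) = g (\<iota> b)"
  shows "f = g"
  by (rule bounded_clinear_eq_on_closure[OF assms(1,2) _ iota_dense]) (use assms(3) in auto)

lemma Lm_props: "a \<in> M \<Longrightarrow> bounded_clinear (Lm a) \<and> (\<forall>b\<in>M. Lm a (\<iota> b) = \<iota> (a \<circ> b))"
proof -
  assume "a \<in> M"
  then have "\<exists>!L. bounded_clinear L \<and> (\<forall>b\<in>M. L (\<iota> b) = \<iota> (a \<circ> b))"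
    by (intro ex_ex1I L2_left_exists eq_on_iotaI) auto
  from theI'[OF this] show ?thesis unfolding L2_left_def .
qed

lemma Lm_bdd [simp]: "a \<in> M \<Longrightarrow> bounded_clinear (Lm a)" using Lm_props by blast

lemma Lm_iota [simp]: "a \<in> M \<Longrightarrow> b \<in> M \<Longrightarrow> Lm a (\<iota> b) = \<iota> (a \<circ> b)" using Lm_props by blast

lemma Lm_id: "Lm id = (\<lambda>x. x)"
  by (rule eq_on_iotaI) auto

lemma Lm_add: "a \<in> M \<Longrightarrow> b \<in> M \<Longrightarrow> Lm (\<lambda>x. a x + b x) = (\<lambda>x. Lm a x + Lm b x)"
proof (rule eq_on_iotaI)
  fix c assume "a \<in> M" "b \<in> M" "c \<in> M"
  moreover have "(\<lambda>x. a x + b x) \<circ> c = (\<lambda>x. (a \<circ> c) x + (b \<circ> c) x)" by auto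
  ultimately show "Lm (\<lambda>x. a x + b x) (\<iota> c) = Lm a (\<iota> c) + Lm b (\<iota> c)"
    by (simp add: iota_add del: comp_apply)
qed (auto intro: bounded_clinear_add)

lemma Lm_scale: "a \<in> M \<Longrightarrow> Lm (\<lambda>x. c *\<^sub>C a x) = (\<lambda>x. c *\<^sub>C Lm a x)"
proof (rule eq_on_iotaI)
  fix b assume "a \<in> M" "b \<in> M"
  moreover have "(\<lambda>x. c *\<^sub>C a x) \<circ> b = (\<lambda>x. c *\<^sub>C (a \<circ> b) x)" by auto
  ultimately show "Lm (\<lambda>x. c *\<^sub>C a x) (\<iota> b) = c *\<^sub>C Lm a (\<iota> b)"
    by (simp add: iota_scale del: comp_apply)
qed (auto intro: bounded_clinear_scale)

lemma Lm_sum: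
  "(\<And>i. i \<in> I \<Longrightarrow> a i \<in> M) \<Longrightarrow> Lm (\<lambda>x. \<Sum>i\<in>I. a i x) = (\<lambda>x. \<Sum>i\<in>I. Lm (a i) x)"
proof (induction I rule: infinite_finite_induct)
  case (insert i I) then show ?case by (simp add: Lm_add)
qed (use Lm_scale[OF id_M, of 0] in auto)

lemma Lm_comp: "a \<in> M \<Longrightarrow> b \<in> M \<Longrightarrow> Lm (a \<circ> b) = Lm a \<circ> Lm b"
  by (rule eq_on_iotaI) (auto intro!: bounded_clinear_comp simp: o_assoc simp del: comp_apply, simp add: o_assoc)

lemma Lm_cadj:
  assumes a: "a \<in> M"
  shows "cadj (Lm a) = Lm (cadj a)"
proof (rule eq_on_iotaI)
  fix c assume c: "c \<in> M"
  have eq: "(\<lambda>x. cinner x (cadj (Lm a) (\<iota> c))) = (\<lambda>x. cinner x (Lm (cadj a) (\<iota> c)))"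
  proof
    fix x show "cinner x (cadj (Lm a) (\<iota> c)) = cinner x (Lm (cadj a) (\<iota> c))"
    proof (rule continuous_eq_on_dense[where f = "\<lambda>x. cinner x (cadj (Lm a) (\<iota> c))"
          and g = "\<lambda>x. cinner x (Lm (cadj a) (\<iota> c))", OF _ _ _ iota_dense])
      fix x assume "x \<in> \<iota> ` M"
      then obtain b where b: "b \<in> M" "x = \<iota> b" by blast
      have "cinner x (cadj (Lm a) (\<iota> c)) = cinner (Lm a (\<iota> b)) (\<iota> c)"
        using cadj_works[OF Lm_bdd[OF a]] b by simp
      also have "\<dots> = \<tau> (cadj c \<circ> (a \<circ> b))" using a b c by (simp add: iota_cinner)
      also have "\<dots> = \<tau> (cadj (cadj a \<circ> c) \<circ> b)"
        using a c by (simp add: cadj_comp cadj_cadj o_assoc)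
      also have "\<dots> = cinner x (Lm (cadj a) (\<iota> c))" using a b c by (simp add: iota_cinner)
      finally show "cinner x (cadj (Lm a) (\<iota> c)) = cinner x (Lm (cadj a) (\<iota> c))" .
    qed (intro continuous_intros)+
  qed
  show "cadj (Lm a) (\<iota> c) = Lm (cadj a) (\<iota> c)"
    by (rule cinner_eqI_right) (use eq in metis)
qed (use a in \<open>auto intro: bounded_clinear_cadj\<close>)

lemma Lm_trace: "a \<in> M \<Longrightarrow> b \<in> M \<Longrightarrow> cinner (Lm a (Lm b \<xi>)) \<xi> = cinner (Lm b (Lm a \<xi>)) \<xi>"
  using tau_trace[of a b] by (simp add: iota_cinner o_assoc)

lemma iota_cadj_norm: "a \<in> M \<Longrightarrow> norm (\<iota> (cadj a)) = norm (\<iota> a)"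
proof -
  assume a: "a \<in> M"
  have "cinner (\<iota> (cadj a)) (\<iota> (cadj a)) = cinner (\<iota> a) (\<iota> a)"
    using a tau_trace[of a "cadj a"] by (simp add: iota_cinner cadj_cadj)
  then have "(norm (\<iota> (cadj a)))\<^sup>2 = (norm (\<iota> a))\<^sup>2" unfolding cinner_self of_real_eq_iff .
  then show ?thesis by (simp add: power2_eq_iff_nonneg)
qed

text \<open>Traciality makes \<open>x \<mapsto> x*\<close> isometric for the \<open>L\<^sup>2\<close>-norm, so it extends to the whole space.\<close>

lemma J_exists:
  "\<exists>J. (\<forall>x y. J (x + y) = J x + J y) \<and> (\<forall>c x. J (c *\<^sub>C x) = cnj c *\<^sub>C J x) \<and>
       (\<forall>x. norm (J x) = norm x) \<and> (\<forall>a\<in>M. J (\<iota> a) = \<iota> (cadj a))"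
proof -
  have cd: "cadj (\<lambda>x. a x - b x) = (\<lambda>x. cadj a x - cadj b x)" if "a \<in> M" "b \<in> M" for a b
    by (rule cadj_unique) (use that in \<open>simp add: cadj_works cinner_diff_left cinner_diff_right\<close>)
  have "dist (\<iota> (cadj a)) (\<iota> (cadj b)) \<le> 1 * dist (\<iota> a) (\<iota> b)" if "a \<in> M" "b \<in> M" for a b
    using iota_cadj_norm[OF diff_M[OF that]] that by (simp add: cd iota_diff dist_norm)
  from Lipschitz_extension_from_dense[OF iota_dense zero_le_one, of "\<lambda>b. \<iota> (cadj b)", OF this]
  obtain g where g: "1-lipschitz_on UNIV g" "\<And>b. b \<in> M \<Longrightarrow> g (\<iota> b) = \<iota> (cadj b)"
    by blast
  have cont: "continuous_on UNIV g"
    using g(1) by (intro uniformly_continuous_imp_continuous lipschitz_on_uniformly_continuous)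
  have "g (x + y) = g x + g y" for x y
  proof (rule additive_from_dense[OF cont iota_dense])
    fix x y assume "x \<in> \<iota> ` M" "y \<in> \<iota> ` M"
    then obtain b c where bc: "b \<in> M" "c \<in> M" "x = \<iota> b" "y = \<iota> c" by blast
    then show "g (x + y) = g x + g y"
      using g(2)[OF add_M[OF bc(1,2)]] by (simp add: iota_add g(2) cadj_add)
  qed
  moreover have "g (c *\<^sub>C x) = cnj c *\<^sub>C g x" for c x
  proof (rule continuous_eq_on_dense[where f = "\<lambda>x. g (c *\<^sub>C x)" and g = "\<lambda>x. cnj c *\<^sub>C g x", OF _ _ _ iota_dense])
    show "continuous_on UNIV (\<lambda>x. g (c *\<^sub>C x))"
      by (intro continuous_on_compose2[OF cont] bounded_clinear_continuous bounded_clinear_scaleC) auto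
    show "continuous_on UNIV (\<lambda>x. cnj c *\<^sub>C g x)"
      using continuous_on_compose2[OF bounded_clinear_continuous[OF bounded_clinear_scaleC] cont] by auto
    fix x assume "x \<in> \<iota> ` M"
    then obtain b where b: "b \<in> M" "x = \<iota> b" by blast
    then show "g (c *\<^sub>C x) = cnj c *\<^sub>C g x"
      using g(2)[OF scale_M[OF b(1)], of c] by (simp add: iota_scale g(2) cadj_scale)
  qed
  moreover have "norm (g x) = norm x" for x
    by (rule continuous_eq_on_dense[where f = "\<lambda>x. norm (g x)" and g = norm, OF _ _ _ iota_dense])
      (auto intro!: continuous_intros cont simp: g(2) iota_cadj_norm)
  ultimately show ?thesis using g(2) by blast
qed

text \<open>Continuity and the values on the dense image of the algebra determine such an isometry, so the
  definite description denotes it.\<close>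

lemma J_props:
  "(\<forall>x y. J (x + y) = J x + J y) \<and> (\<forall>c x. J (c *\<^sub>C x) = cnj c *\<^sub>C J x) \<and>
   (\<forall>x. norm (J x) = norm x) \<and> (\<forall>a\<in>M. J (\<iota> a) = \<iota> (cadj a))"
proof -
  have cont: "continuous_on UNIV K" if K: "\<forall>x y. K (x + y) = K x + K y" "\<forall>x. norm (K x) = norm x"
    for K :: "'h \<Rightarrow> 'h"
  proof -
    have "K (x - y) = K x - K y" for x y using K(1) by (metis add_diff_cancel diff_add_cancel)
    then have "dist (K x) (K y) = dist x y" for x y using K(2) by (metis dist_norm)
    then show ?thesis unfolding continuous_on_iff by auto
  qed
  have uniq: "K = K'" if "(\<forall>x y. K (x + y) = K x + K y) \<and> (\<forall>c x. K (c *\<^sub>C x) = cnj c *\<^sub>C K x) \<and>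
       (\<forall>x. norm (K x) = norm x) \<and> (\<forall>a\<in>M. K (\<iota> a) = \<iota> (cadj a))"
    "(\<forall>x y. K' (x + y) = K' x + K' y) \<and> (\<forall>c x. K' (c *\<^sub>C x) = cnj c *\<^sub>C K' x) \<and>
       (\<forall>x. norm (K' x) = norm x) \<and> (\<forall>a\<in>M. K' (\<iota> a) = \<iota> (cadj a))"
    for K K' :: "'h \<Rightarrow> 'h"
  proof
    fix x show "K x = K' x"
    proof (rule continuous_eq_on_dense[where f = K and g = K', OF _ _ _ iota_dense])
      show "continuous_on UNIV K" by (rule cont) (use that(1) in blast)+
      show "continuous_on UNIV K'" by (rule cont) (use that(2) in blast)+
    qed (use that in auto)
  qed
  from theI'[OF ex_ex1I[OF J_exists uniq]] show ?thesis unfolding L2_J_def .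
qed

lemma J_add: "J (x + y) = J x + J y" using J_props by blast
lemma J_scale: "J (c *\<^sub>C x) = cnj c *\<^sub>C J x" using J_props by blast
lemma J_norm: "norm (J x) = norm x" using J_props by blast
lemma J_iota: "a \<in> M \<Longrightarrow> J (\<iota> a) = \<iota> (cadj a)" using J_props by blast

lemma J_sandwich_bdd:
  assumes T: "bounded_clinear T"
  shows "bounded_clinear (\<lambda>x. J (T (J x)))"
proof -
  obtain K where K: "0 < K" "\<And>x. norm (T x) \<le> K * norm x" using bounded_clinear_bound[OF T] by blast
  show ?thesis
    by (rule bounded_clinearI[of _ K])
      (use K(2)[of "J x" for x] in \<open>auto simp: J_add J_scale J_norm bounded_clinear_simps[OF T] mult.commute\<close>)
qed

lemma J_J [simp]: "J (J x) = x"
proof -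
  have "(\<lambda>x. J (J x)) = (\<lambda>x. x)"
    using J_sandwich_bdd[OF bounded_clinear_id(2)]
    by (intro eq_on_iotaI) (auto simp: J_iota cadj_cadj)
  then show ?thesis by metis
qed

lemma J_zero [simp]: "J 0 = 0" using J_norm[of 0] by simp

lemma J_minus: "J (- x) = - J x" using J_scale[of "-1" x] by simp

lemma J_diff: "J (x - y) = J x - J y" using J_add[of x "- y"] J_minus[of y] by simp

lemma J_sum: "J (sum f A) = (\<Sum>i\<in>A. J (f i))"
  by (induction A rule: infinite_finite_induct) (auto simp: J_add)

lemma J_Lm_J_iota: "a \<in> M \<Longrightarrow> b \<in> M \<Longrightarrow> J (Lm a (J (\<iota> b))) = \<iota> (b \<circ> cadj a)"
  by (simp add: J_iota cadj_comp cadj_cadj)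

text \<open>On the image of the algebra \<open>J a J\<close> is right multiplication by \<open>a*\<close>, and right multiplications
  commute with left ones.\<close>

lemma J_Lm_J_commutes:
  assumes "a \<in> M" "b \<in> M"
  shows "Lm b (J (Lm a (J x))) = J (Lm a (J (Lm b x)))"
proof -
  have "(\<lambda>x. Lm b (J (Lm a (J x)))) = (\<lambda>x. J (Lm a (J (Lm b x))))"
  proof (rule eq_on_iotaI)
    show "bounded_clinear (\<lambda>x. Lm b (J (Lm a (J x))))"
      using bounded_clinear_compose[OF Lm_bdd[OF assms(2)] J_sandwich_bdd[OF Lm_bdd[OF assms(1)]]] .
    show "bounded_clinear (\<lambda>x. J (Lm a (J (Lm b x))))"
      using bounded_clinear_compose[OF J_sandwich_bdd[OF Lm_bdd[OF assms(1)]] Lm_bdd[OF assms(2)]] .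
  qed (use assms in \<open>simp add: J_Lm_J_iota o_assoc\<close>)
  then show ?thesis by metis
qed

text \<open>Right multiplication by \<open>b\<close> moves the trace vector to \<open>\<iota> b\<close>, and these vectors are dense.\<close>

lemma right_mult_cyclic:
  "closure {R \<xi> |R. bounded_clinear R \<and> (\<forall>a\<in>Lm ` M. \<forall>x. R (a x) = a (R x))} = UNIV"
proof -
  have "\<iota> ` M \<subseteq> {R \<xi> |R. bounded_clinear R \<and> (\<forall>a\<in>Lm ` M. \<forall>x. R (a x) = a (R x))}"
  proof clarify
    fix b assume b: "b \<in> M"
    show "\<exists>R. \<iota> b = R \<xi> \<and> bounded_clinear R \<and> (\<forall>a\<in>Lm ` M. \<forall>x. R (a x) = a (R x))"
      using b by (intro exI[of _ "\<lambda>x. J (Lm (cadj b) (J x))"])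
        (auto simp: J_Lm_J_iota cadj_cadj J_Lm_J_commutes intro!: J_sandwich_bdd)
  qed
  from closure_mono[OF this] show ?thesis using iota_dense by auto
qed

end

section \<open>Finiteness of matrices over a tracial operator algebra\<close>

definition mact :: "nat \<Rightarrow> (nat \<Rightarrow> nat \<Rightarrow> 'h \<Rightarrow> 'h) \<Rightarrow> (nat \<Rightarrow> 'h) \<Rightarrow> nat \<Rightarrow> 'h::complex_hilbert" where
  "mact N C u i = (\<Sum>j<N. C i j (u j))"

definition ninner :: "nat \<Rightarrow> (nat \<Rightarrow> 'h) \<Rightarrow> (nat \<Rightarrow> 'h::complex_hilbert) \<Rightarrow> complex" where
  "ninner N u v = (\<Sum>i<N. cinner (u i) (v i))"

definition nsq :: "nat \<Rightarrow> (nat \<Rightarrow> 'h::complex_hilbert) \<Rightarrow> real" where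
  "nsq N u = (\<Sum>i<N. (norm (u i))\<^sup>2)"

definition madj :: "(nat \<Rightarrow> nat \<Rightarrow> 'h \<Rightarrow> 'h) \<Rightarrow> nat \<Rightarrow> nat \<Rightarrow> 'h::complex_hilbert \<Rightarrow> 'h" where
  "madj C i j = cadj (C j i)"

text \<open>The operator \<open>1 - \<delta> C D\<close>.  For \<open>D = C*\<close> and small \<open>\<delta> > 0\<close> it is a positive contraction whose fixed
  vectors form the kernel of \<open>C*\<close>; its powers approximate the projection onto that kernel.\<close>

definition damp :: "nat \<Rightarrow> real \<Rightarrow> (nat \<Rightarrow> nat \<Rightarrow> 'h \<Rightarrow> 'h) \<Rightarrow> (nat \<Rightarrow> nat \<Rightarrow> 'h \<Rightarrow> 'h) \<Rightarrow>
    (nat \<Rightarrow> 'h) \<Rightarrow> nat \<Rightarrow> 'h::complex_hilbert" where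
  "damp N \<delta> C D u i = u i - complex_of_real \<delta> *\<^sub>C mact N C (mact N D u) i"

definition mbounded :: "(nat \<Rightarrow> nat \<Rightarrow> 'h \<Rightarrow> 'h::complex_hilbert) \<Rightarrow> bool" where
  "mbounded C \<longleftrightarrow> (\<forall>i j. bounded_clinear (C i j))"

lemma mboundedD: "mbounded C \<Longrightarrow> bounded_clinear (C i j)"
  by (simp add: mbounded_def)

lemma mbounded_madj: "mbounded C \<Longrightarrow> mbounded (madj C)"
  by (simp add: mbounded_def madj_def bounded_clinear_cadj)

lemma nsq_nonneg [simp]: "0 \<le> nsq N u"
  unfolding nsq_def by (simp add: sum_nonneg)

lemma ninner_self: "ninner N u u = complex_of_real (nsq N u)"
  by (simp add: ninner_def nsq_def cinner_self)

lemma ninner_diff_left: "ninner N (\<lambda>i. u i - c *\<^sub>C v i) w = ninner N u w - c * ninner N v w"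
  by (simp add: ninner_def cinner_diff_left cinner_scaleC_left sum_subtractf sum_distrib_left)

lemma ninner_diff_right: "ninner N w (\<lambda>i. u i - c *\<^sub>C v i) = ninner N w u - cnj c * ninner N w v"
  by (simp add: ninner_def cinner_diff_right cinner_scaleC_right sum_subtractf sum_distrib_left)

lemma ninner_madj:
  assumes "mbounded C"
  shows "ninner N (mact N C u) v = ninner N u (mact N (madj C) v)"
proof -
  have "ninner N (mact N C u) v = (\<Sum>i<N. \<Sum>j<N. cinner (u j) (cadj (C i j) (v i)))"
    by (simp add: ninner_def mact_def cinner_sum_left cadj_works[OF mboundedD[OF assms]])
  also have "\<dots> = (\<Sum>j<N. \<Sum>i<N. cinner (u j) (cadj (C i j) (v i)))" by (rule sum.swap)
  finally show ?thesis by (simp add: ninner_def mact_def madj_def cinner_sum_right)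
qed

lemma madj_madj: "mbounded C \<Longrightarrow> madj (madj C) = C"
  by (simp add: madj_def cadj_cadj fun_eq_iff mboundedD)

lemma ninner_madj':
  assumes "mbounded C"
  shows "ninner N (mact N (madj C) u) v = ninner N u (mact N C v)"
  using ninner_madj[OF mbounded_madj[OF assms]] by (simp add: madj_madj assms)

lemma nsq_mact_bound:
  assumes "mbounded C"
  shows "\<exists>K>0. \<forall>u. nsq N (mact N C u) \<le> K * nsq N u"
proof -
  have "\<exists>k\<ge>0. \<forall>x. norm (C i j x) \<le> k * norm x" for i j
    using bounded_clinear_bound[OF mboundedD[OF assms, of i j]] by (metis less_imp_le)
  then obtain k where k: "\<And>i j. 0 \<le> k i j" "\<And>i j x. norm (C i j x) \<le> k i j * norm x" by metis
  define K where "K = (\<Sum>i<N. \<Sum>j<N. (k i j)\<^sup>2) + 1"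
  have "nsq N (mact N C u) \<le> K * nsq N u" for u
  proof -
    have "(norm (mact N C u i))\<^sup>2 \<le> (\<Sum>j<N. (k i j)\<^sup>2) * nsq N u" for i
    proof -
      have "norm (mact N C u i) \<le> (\<Sum>j<N. k i j * norm (u j))"
        unfolding mact_def by (rule order_trans[OF norm_sum]) (intro sum_mono k)
      then have "(norm (mact N C u i))\<^sup>2 \<le> (\<Sum>j<N. k i j * norm (u j))\<^sup>2" by (rule power_mono) auto
      also have "\<dots> \<le> (\<Sum>j<N. (k i j)\<^sup>2) * nsq N u"
        unfolding nsq_def by (rule Cauchy_Schwarz_ineq_sum)
      finally show ?thesis .
    qed
    then have "nsq N (mact N C u) \<le> (\<Sum>i<N. (\<Sum>j<N. (k i j)\<^sup>2) * nsq N u)"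
      unfolding nsq_def[of N "mact N C u"] by (intro sum_mono)
    also have "\<dots> \<le> K * nsq N u" by (simp add: K_def sum_distrib_right[symmetric] mult_right_mono)
    finally show ?thesis .
  qed
  moreover have "0 < K" unfolding K_def by (simp add: sum_nonneg add_nonneg_pos)
  ultimately show ?thesis by blast
qed

lemma damp_selfadjoint:
  assumes "mbounded C"
  shows "ninner N (damp N \<delta> C (madj C) u) v = ninner N u (damp N \<delta> C (madj C) v)"
    and "ninner N (damp N \<delta> (madj C) C u) v = ninner N u (damp N \<delta> (madj C) C v)"
  by (simp_all add: damp_def[abs_def] ninner_diff_left ninner_diff_right ninner_madj[OF assms]
      ninner_madj'[OF assms])

lemma damp_funpow_selfadjoint:
  assumes "mbounded C"
  shows "ninner N ((damp N \<delta> C (madj C) ^^ k) u) v = ninner N u ((damp N \<delta> C (madj C) ^^ k) v)"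
    and "ninner N ((damp N \<delta> (madj C) C ^^ k) u) v = ninner N u ((damp N \<delta> (madj C) C ^^ k) v)"
  by (induction k arbitrary: u v) (simp_all add: damp_selfadjoint[OF assms] funpow_swap1)

text \<open>If \<open>C*\<close> is injective, the powers of the positive contraction \<open>S = 1 - \<delta> C C*\<close> tend to zero
  strongly: the numbers \<open>\<langle>S\<^sup>m u, u\<rangle>\<close> converge, hence \<open>S\<^sup>k u\<close> is Cauchy, and its limit is annihilated
  by \<open>C*\<close>.\<close>

lemma damp_funpow_tendsto_zero:
  fixes C :: "nat \<Rightarrow> nat \<Rightarrow> 'h::complex_hilbert \<Rightarrow> 'h"
  assumes C: "mbounded C"
    and K: "0 < K" "\<And>u. nsq N (mact N C u) \<le> K * nsq N u"
    and inj: "\<And>u. (\<forall>i<N. mact N (madj C) u i = 0) \<Longrightarrow> \<forall>i<N. u i = 0"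
  shows "(\<lambda>k. nsq N ((damp N (1/K) C (madj C) ^^ k) u)) \<longlonglongrightarrow> 0"
proof -
  define S where "S = damp N (1/K) C (madj C)"
  define w where "w k = (S ^^ k) u" for k
  define b where "b k = nsq N (w k)" for k
  define a where "a m = Re (ninner N (w m) u)" for m
  define d where "d k = nsq N (mact N (madj C) (w k)) / K" for k
  have w_Suc: "w (Suc k) = S (w k)" for k by (simp add: w_def)
  have ip: "Re (ninner N (S x) x) = nsq N x - nsq N (mact N (madj C) x) / K" for x
    by (simp add: S_def damp_def[abs_def] ninner_diff_left ninner_madj[OF C] ninner_self)
  \<comment> \<open>With \<open>\<delta> = 1/K\<close> the quadratic term in the expansion of \<open>\<parallel>S x\<parallel>\<^sup>2\<close> absorbs only half of the linear one.\<close>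
  have dec: "nsq N (S x) \<le> nsq N x - nsq N (mact N (madj C) x) / K" for x
  proof -
    let ?y = "mact N (madj C) x"
    have "complex_of_real (nsq N (S x)) = ninner N (S x) (S x)" by (simp add: ninner_self)
    also have "\<dots> = complex_of_real (nsq N x - 2 / K * nsq N ?y + (1/K)\<^sup>2 * nsq N (mact N C ?y))"
    proof -
      have "ninner N x (mact N C ?y) = complex_of_real (nsq N ?y)"
        using ninner_madj'[OF C, of N x ?y] by (simp add: ninner_self)
      then show ?thesis
        by (simp add: S_def damp_def[abs_def] ninner_diff_left ninner_diff_right ninner_madj[OF C]
            ninner_self power2_eq_square algebra_simps)
    qed
    finally have "nsq N (S x) = nsq N x - 2 / K * nsq N ?y + (1/K)\<^sup>2 * nsq N (mact N C ?y)"
      unfolding of_real_eq_iff .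
    also have "\<dots> \<le> nsq N x - 2 / K * nsq N ?y + (1/K)\<^sup>2 * (K * nsq N ?y)"
      by (intro add_left_mono mult_left_mono K(2)) auto
    also have "\<dots> = nsq N x - nsq N ?y / K" using K(1) by (simp add: power2_eq_square field_simps)
    finally show ?thesis .
  qed
  have b_dec: "b (Suc k) \<le> b k - d k" for k unfolding b_def d_def w_Suc by (rule dec)
  have d0: "0 \<le> d k" for k using K(1) by (simp add: d_def)
  have "decseq b"
  proof (rule decseq_SucI)
    fix k show "b (Suc k) \<le> b k" using b_dec[of k] d0[of k] by linarith
  qed
  moreover have "0 \<le> b k" for k by (simp add: b_def)
  ultimately have "\<exists>L. b \<longlonglongrightarrow> L" by (metis decseq_convergent)
  then obtain L where L: "b \<longlonglongrightarrow> L" by blast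
  have sym: "ninner N (w (j + k)) u = ninner N (w j) (w k)" for j k
  proof -
    have "ninner N (w j) (w k) = ninner N ((S ^^ k) (w j)) u"
      unfolding w_def[of k] S_def by (rule damp_funpow_selfadjoint(1)[OF C, symmetric])
    then show ?thesis by (simp add: w_def add.commute[of j k] funpow_add)
  qed
  \<comment> \<open>The even moments \<open>\<langle>S\<^sup>2\<^sup>k u, u\<rangle> = \<parallel>S\<^sup>k u\<parallel>\<^sup>2\<close> decrease and the odd ones lie between their neighbours.\<close>
  have a_even: "a (2 * k) = b k" for k
    using sym[of k k] by (simp add: a_def b_def mult_2 ninner_self)
  have a_odd: "a (2 * k + 1) = b k - d k" for k
    using sym[of "Suc k" k] ip[of "w k"] by (simp add: a_def b_def d_def w_Suc mult_2)
  have a_bounds: "b (m div 2 + 1) \<le> a m" "a m \<le> b (m div 2)" for m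
  proof -
    have "m = 2 * (m div 2) \<or> m = 2 * (m div 2) + 1" by presburger
    then have "a m = b (m div 2) \<or> a m = b (m div 2) - d (m div 2)"
      using a_even[of "m div 2"] a_odd[of "m div 2"] by metis
    then show "b (m div 2 + 1) \<le> a m" "a m \<le> b (m div 2)"
      using b_dec[of "m div 2"] d0[of "m div 2"] by auto
  qed
  have half: "filterlim (\<lambda>m::nat. m div 2) sequentially sequentially"
    unfolding filterlim_at_top eventually_sequentially
  proof
    fix Z :: nat show "\<exists>M. \<forall>m\<ge>M. Z \<le> m div 2" by (intro exI[of _ "2 * Z"]) auto
  qed
  have aL: "a \<longlonglongrightarrow> L"
  proof (rule tendsto_sandwich[where f = "\<lambda>m. b (m div 2 + 1)" and h = "\<lambda>m. b (m div 2)",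
        OF always_eventually always_eventually])
    show "(\<lambda>m. b (m div 2)) \<longlonglongrightarrow> L" by (rule filterlim_compose[OF L half])
    show "(\<lambda>m. b (m div 2 + 1)) \<longlonglongrightarrow> L"
      using filterlim_compose[OF LIMSEQ_Suc[OF L] half] by simp
  qed (use a_bounds in auto)
  have dist: "nsq N (\<lambda>i. w j i - w k i) = a (2 * j) - 2 * a (j + k) + a (2 * k)" for j k
  proof -
    have "complex_of_real (nsq N (\<lambda>i. w j i - 1 *\<^sub>C w k i)) =
        ninner N (w j) (w j) - ninner N (w j) (w k) - (ninner N (w k) (w j) - ninner N (w k) (w k))"
      unfolding ninner_self[symmetric] ninner_diff_left ninner_diff_right by simp
    then have "Re (complex_of_real (nsq N (\<lambda>i. w j i - w k i))) = Re (ninner N (w (j + j)) u) - Re (ninner N (w (j + k)) u)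
        - (Re (ninner N (w (k + j)) u) - Re (ninner N (w (k + k)) u))"
      unfolding sym by simp
    then show ?thesis unfolding a_def mult_2[of j] mult_2[of k] add.commute[of k j] by simp
  qed
  have "Cauchy (\<lambda>k. w k i)" if i: "i < N" for i
  proof (rule metric_CauchyI)
    fix e :: real assume e: "0 < e"
    then have "0 < e\<^sup>2 / 4" by simp
    then obtain m where m: "\<And>n. n \<ge> m \<Longrightarrow> \<bar>a n - L\<bar> < e\<^sup>2 / 4"
      using LIMSEQ_D[OF aL, of "e\<^sup>2 / 4"] by auto
    have "dist (w j i) (w k i) < e" if "j \<ge> m" "k \<ge> m" for j k
    proof -
      have "(norm (w j i - w k i))\<^sup>2 \<le> nsq N (\<lambda>i. w j i - w k i)"
        unfolding nsq_def using i member_le_sum[of i "{..<N}" "\<lambda>i. (norm (w j i - w k i))\<^sup>2"] by simp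
      also have "\<dots> < e\<^sup>2"
        unfolding dist using m[of "2 * j"] m[of "j + k"] m[of "2 * k"] that by (simp add: abs_if split: if_splits)
      finally show ?thesis using e by (simp add: dist_norm power2_less_imp_less)
    qed
    then show "\<exists>M. \<forall>m\<ge>M. \<forall>n\<ge>M. dist (w m i) (w n i) < e" by blast
  qed
  then have "\<exists>v. \<forall>i<N. (\<lambda>k. w k i) \<longlonglongrightarrow> v i"
    by (intro exI[of _ "\<lambda>i. lim (\<lambda>k. w k i)"]) (simp add: Cauchy_convergent convergent_LIMSEQ_iff[symmetric])
  then obtain v where v: "\<And>i. i < N \<Longrightarrow> (\<lambda>k. w k i) \<longlonglongrightarrow> v i" by blast
  have "(\<lambda>k. K * (b k - b (Suc k))) \<longlonglongrightarrow> K * (L - L)"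
    by (intro tendsto_intros L LIMSEQ_Suc)
  then have "(\<lambda>k. K * (b k - b (Suc k))) \<longlonglongrightarrow> 0" by simp
  then have d_lim: "(\<lambda>k. nsq N (mact N (madj C) (w k))) \<longlonglongrightarrow> 0"
  proof (rule tendsto_sandwich[OF always_eventually always_eventually tendsto_const, rotated 2])
    show "\<forall>k. nsq N (mact N (madj C) (w k)) \<le> K * (b k - b (Suc k))"
    proof
      fix k
      have "d k \<le> b k - b (Suc k)" using b_dec[of k] by simp
      then show "nsq N (mact N (madj C) (w k)) \<le> K * (b k - b (Suc k))"
        using K(1) by (simp add: d_def divide_le_eq mult.commute)
    qed
  qed simp
  have bm: "bounded_linear (madj C i j)" for i j
    by (intro bounded_clinear_linear mboundedD mbounded_madj C)
  have "(\<lambda>k. nsq N (mact N (madj C) (w k))) \<longlonglongrightarrow> nsq N (mact N (madj C) v)"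
    unfolding nsq_def mact_def
    by (intro tendsto_sum tendsto_power tendsto_norm bounded_linear.tendsto[OF bm] v) auto
  then have "nsq N (mact N (madj C) v) = 0" using d_lim LIMSEQ_unique by blast
  then have "\<forall>i<N. mact N (madj C) v i = 0" unfolding nsq_def by (simp add: sum_nonneg_eq_0_iff)
  then have v0: "\<forall>i<N. v i = 0" by (rule inj)
  have "b \<longlonglongrightarrow> nsq N v"
    unfolding b_def nsq_def by (intro tendsto_sum tendsto_power tendsto_norm v) auto
  then have "b \<longlonglongrightarrow> 0" using v0 by (simp add: nsq_def)
  then show ?thesis by (simp add: b_def[abs_def] w_def S_def)
qed

text \<open>The trace is the vector state of \<open>\<xi>\<close>.  Cyclicity of \<open>\<xi>\<close> for the commutant spreads an identity at \<open>\<xi>\<close>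
  over the whole space, as right multiplications do in the standard form of a von Neumann algebra.\<close>

locale tracial_operator_algebra =
  fixes A :: "('h::complex_hilbert \<Rightarrow> 'h) set" and \<xi> :: 'h
  assumes bdd: "a \<in> A \<Longrightarrow> bounded_clinear a"
    and id: "(\<lambda>x. x) \<in> A"
    and add: "a \<in> A \<Longrightarrow> b \<in> A \<Longrightarrow> (\<lambda>x. a x + b x) \<in> A"
    and scale: "a \<in> A \<Longrightarrow> (\<lambda>x. c *\<^sub>C a x) \<in> A"
    and mult: "a \<in> A \<Longrightarrow> b \<in> A \<Longrightarrow> (\<lambda>x. a (b x)) \<in> A"
    and adj: "a \<in> A \<Longrightarrow> cadj a \<in> A"
    and trace: "a \<in> A \<Longrightarrow> b \<in> A \<Longrightarrow> cinner (a (b \<xi>)) \<xi> = cinner (b (a \<xi>)) \<xi>"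
    and cyclic: "closure {R \<xi> |R. bounded_clinear R \<and> (\<forall>a\<in>A. \<forall>x. R (a x) = a (R x))} = UNIV"
begin

lemma zero: "(\<lambda>x. 0) \<in> A" using scale[OF id, of 0] by simp

lemma sum: "(\<And>i. i \<in> I \<Longrightarrow> a i \<in> A) \<Longrightarrow> (\<lambda>x. \<Sum>i\<in>I. a i x) \<in> A"
  by (induction I rule: infinite_finite_induct) (auto intro: add zero)

definition mmul :: "nat \<Rightarrow> (nat \<Rightarrow> nat \<Rightarrow> 'h \<Rightarrow> 'h) \<Rightarrow> (nat \<Rightarrow> nat \<Rightarrow> 'h \<Rightarrow> 'h) \<Rightarrow> nat \<Rightarrow> nat \<Rightarrow> 'h \<Rightarrow> 'h" where
  "mmul N C D i j = (\<lambda>x. \<Sum>m<N. C i m (D m j x))"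

definition mtr :: "nat \<Rightarrow> (nat \<Rightarrow> nat \<Rightarrow> 'h \<Rightarrow> 'h) \<Rightarrow> complex" where
  "mtr N C = (\<Sum>i<N. cinner (C i i \<xi>) \<xi>)"

definition mats :: "(nat \<Rightarrow> nat \<Rightarrow> 'h \<Rightarrow> 'h) set" where
  "mats = {C. \<forall>i j. C i j \<in> A}"

lemma mats_bdd: "C \<in> mats \<Longrightarrow> bounded_clinear (C i j)" unfolding mats_def using bdd by blast

lemma mats_mbounded: "C \<in> mats \<Longrightarrow> mbounded C" unfolding mbounded_def by (simp add: mats_bdd)

lemma mats_madj: "C \<in> mats \<Longrightarrow> madj C \<in> mats" unfolding mats_def madj_def using adj by blast

lemma mats_mmul: "C \<in> mats \<Longrightarrow> D \<in> mats \<Longrightarrow> mmul N C D \<in> mats"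
proof -
  assume "C \<in> mats" "D \<in> mats"
  then have "(\<lambda>x. C i m (D m j x)) \<in> A" for i m j
    using mult[of "C i m" "D m j"] by (simp add: mats_def)
  then show ?thesis unfolding mats_def mmul_def
    using sum[of "{..<N}" "\<lambda>m x. C i m (D m j x)" for i j] by blast
qed

lemma mtr_commute:
  assumes "C \<in> mats" "D \<in> mats"
  shows "mtr N (mmul N C D) = mtr N (mmul N D C)"
proof -
  have "mtr N (mmul N C D) = (\<Sum>i<N. \<Sum>m<N. cinner (C i m (D m i \<xi>)) \<xi>)"
    by (simp add: mtr_def mmul_def cinner_sum_left)
  also have "\<dots> = (\<Sum>m<N. \<Sum>i<N. cinner (D m i (C i m \<xi>)) \<xi>)"
    using assms by (subst sum.swap) (intro sum.cong refl trace, auto simp: mats_def)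
  finally show ?thesis by (simp add: mtr_def mmul_def cinner_sum_left)
qed

lemma mmul_assoc:
  assumes "C \<in> mats"
  shows "mmul N (mmul N C D) E = mmul N C (mmul N D E)"
  unfolding mmul_def
  by (intro ext, simp add: bounded_clinear_simps[OF mats_bdd[OF assms]]) (rule sum.swap)

text \<open>The \<open>k\<close>-th power of \<open>1 - \<delta> C D\<close> as a matrix over the algebra, to which the matrix trace applies.\<close>

fun damp_mat :: "nat \<Rightarrow> real \<Rightarrow> (nat \<Rightarrow> nat \<Rightarrow> 'h \<Rightarrow> 'h) \<Rightarrow> (nat \<Rightarrow> nat \<Rightarrow> 'h \<Rightarrow> 'h) \<Rightarrow> nat \<Rightarrow> nat \<Rightarrow> nat \<Rightarrow> 'h \<Rightarrow> 'h"
  where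
  "damp_mat N \<delta> C D 0 i j = (\<lambda>x. if i = j then x else 0)"
| "damp_mat N \<delta> C D (Suc k) i j =
     (\<lambda>x. damp_mat N \<delta> C D k i j x - complex_of_real \<delta> *\<^sub>C mmul N C (mmul N D (damp_mat N \<delta> C D k)) i j x)"

lemma diff: "a \<in> A \<Longrightarrow> b \<in> A \<Longrightarrow> (\<lambda>x. a x - c *\<^sub>C b x) \<in> A"
  using add[OF _ scale[of b "- c"], of a] by simp

lemma damp_mat_mats: "C \<in> mats \<Longrightarrow> D \<in> mats \<Longrightarrow> damp_mat N \<delta> C D k \<in> mats"
proof (induction k)
  case 0
  have "damp_mat N \<delta> C D 0 i j \<in> A" for i j using id zero by (cases "i = j") simp_all
  then show ?case by (simp add: mats_def)
next
  case (Suc k)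
  then have "mmul N C (mmul N D (damp_mat N \<delta> C D k)) \<in> mats" by (intro mats_mmul) auto
  then show ?case
    using Suc diff[of "damp_mat N \<delta> C D k i j" "mmul N C (mmul N D (damp_mat N \<delta> C D k)) i j" for i j]
    by (simp add: mats_def)
qed

lemma damp_mat_funpow:
  assumes "C \<in> mats" "D \<in> mats"
  shows "damp_mat N \<delta> C D k i j x = (damp N \<delta> C D ^^ k) (\<lambda>m. if m = j then x else 0) i"
proof (induction k arbitrary: i)
  case (Suc k) then show ?case by (simp add: damp_def mmul_def mact_def)
qed auto

lemma damp_mat_intertwine:
  assumes "C \<in> mats" "D \<in> mats" "j < N"
  shows "i < N \<Longrightarrow> mmul N (damp_mat N \<delta> C D k) C i j x = mmul N C (damp_mat N \<delta> D C k) i j x"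
proof (induction k arbitrary: i x)
  case 0
  have "(\<Sum>m<N. if i = m then C m j x else 0) = C i j x" using 0 by (simp add: sum.delta)
  moreover have "(\<Sum>m<N. C i m (if m = j then x else 0)) = (\<Sum>m<N. if m = j then C i m x else 0)"
    using bounded_clinear_simps[OF mats_bdd[OF assms(1)]] by (intro sum.cong) auto
  ultimately show ?case using assms(3) by (simp add: mmul_def)
next
  case (Suc k)
  let ?P = "damp_mat N \<delta> C D k" and ?Q = "damp_mat N \<delta> D C k"
  have P: "?P \<in> mats" using damp_mat_mats[OF assms(1,2)] .
  note lC = bounded_clinear_simps[OF mats_bdd[OF assms(1)]]
  have "mmul N (damp_mat N \<delta> C D (Suc k)) C i j x
      = mmul N ?P C i j x - complex_of_real \<delta> *\<^sub>C mmul N (mmul N C (mmul N D ?P)) C i j x"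
    by (simp add: mmul_def[of N _ C] sum_subtractf scaleC_sum_right)
  also have "mmul N (mmul N C (mmul N D ?P)) C = mmul N C (mmul N D (mmul N ?P C))"
    using assms by (simp add: mmul_assoc)
  also have "mmul N C (mmul N D (mmul N ?P C)) i j x = mmul N C (mmul N D (mmul N C ?Q)) i j x"
    using Suc.IH unfolding mmul_def[of N C "mmul N D _"] mmul_def[of N D] by simp
  also have "mmul N ?P C i j x = mmul N C ?Q i j x" using Suc.IH[OF Suc.prems] .
  finally have "mmul N (damp_mat N \<delta> C D (Suc k)) C i j x
      = mmul N C ?Q i j x - complex_of_real \<delta> *\<^sub>C mmul N C (mmul N D (mmul N C ?Q)) i j x" .
  moreover define W where "W = mmul N D (mmul N C ?Q)"
  moreover have "mmul N C (damp_mat N \<delta> D C (Suc k)) i j x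
      = mmul N C ?Q i j x - complex_of_real \<delta> *\<^sub>C mmul N C W i j x"
  proof -
    have "mmul N C (damp_mat N \<delta> D C (Suc k)) i j x
        = (\<Sum>m<N. C i m (?Q m j x - complex_of_real \<delta> *\<^sub>C W m j x))"
      unfolding W_def mmul_def[of N C "damp_mat N \<delta> D C (Suc k)"] damp_mat.simps ..
    then show ?thesis
      by (simp add: mmul_def[of N C ?Q] mmul_def[of N C W] lC sum_subtractf scaleC_sum_right)
  qed
  ultimately show ?case by (simp only:)
qed

text \<open>Splitting off one factor \<open>C D\<close>, the trace is moved from one side to the other by its cyclicity and
  the identity \<open>(1 - \<delta> C D)\<^sup>k C = C (1 - \<delta> D C)\<^sup>k\<close>.\<close>

lemma mtr_damp_mat:
  assumes "C \<in> mats" "D \<in> mats"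
  shows "mtr N (damp_mat N \<delta> C D k) = mtr N (damp_mat N \<delta> D C k)"
proof (induction k)
  case 0 then show ?case by (simp add: mtr_def)
next
  case (Suc k)
  let ?P = "damp_mat N \<delta> C D k" and ?Q = "damp_mat N \<delta> D C k"
  have P: "?P \<in> mats" using damp_mat_mats[OF assms] .
  have "mtr N (mmul N C (mmul N D ?P)) = mtr N (mmul N (mmul N D ?P) C)"
    by (rule mtr_commute[OF assms(1) mats_mmul[OF assms(2) P]])
  also have "\<dots> = mtr N (mmul N D (mmul N ?P C))" by (simp add: mmul_assoc assms)
  also have "\<dots> = mtr N (mmul N D (mmul N C ?Q))"
    unfolding mtr_def mmul_def[of N D] by (simp add: damp_mat_intertwine[OF assms])
  finally show ?case using Suc
    by (simp add: mtr_def cinner_diff_left cinner_scaleC_left sum_subtractf sum_distrib_left[symmetric])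
qed

text \<open>Traciality equates the traces of the powers of \<open>1 - \<delta> C C*\<close> and \<open>1 - \<delta> C* C\<close>.  If \<open>C*\<close> is
  injective the former tend to zero, so the latter do, and a vector fixed by
  \<open>1 - \<delta> C* C\<close> must vanish.\<close>

theorem matrix_injective_if_adjoint_injective:
  assumes C: "C \<in> mats"
    and inj: "\<And>u. (\<forall>i<N. mact N (madj C) u i = 0) \<Longrightarrow> \<forall>i<N. u i = 0"
    and f: "\<forall>i<N. mact N C f i = 0" and j: "j < N"
  shows "f j = 0"
proof -
  let ?D = "madj C"
  have D: "?D \<in> mats" using mats_madj[OF C] .
  note bC = mats_mbounded[OF C] and bD = mats_bdd[OF D]
  obtain K where K: "0 < K" "\<And>u. nsq N (mact N C u) \<le> K * nsq N u"
    using nsq_mact_bound[of C N] bC by blast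
  define e where "e i = (\<lambda>m. if m = i then \<xi> else 0)" for i :: nat
  define P where "P = damp N (1/K) C ?D"
  define Q where "Q = damp N (1/K) ?D C"
  have Q_apply: "Q u i = u i - complex_of_real (1/K) *\<^sub>C mact N ?D (mact N C u) i" for u i
    by (simp add: Q_def damp_def)
  have tr: "mtr N (damp_mat N (1/K) C ?D (k + k)) = (\<Sum>i<N. complex_of_real (nsq N ((P ^^ k) (e i))))"
      (is ?t1)
    and tr': "mtr N (damp_mat N (1/K) ?D C (k + k)) = (\<Sum>i<N. complex_of_real (nsq N ((Q ^^ k) (e i))))"
      (is ?t2) for k
  proof -
    have ne: "cinner (u i) \<xi> = ninner N u (e i)" if "i < N" for u i
    proof -
      have "ninner N u (e i) = (\<Sum>m<N. if m = i then cinner (u i) \<xi> else 0)"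
        unfolding ninner_def e_def by (intro sum.cong) auto
      then show ?thesis using that by simp
    qed
    have "ninner N ((P ^^ (k + k)) (e i)) (e i) = complex_of_real (nsq N ((P ^^ k) (e i)))" for i
      unfolding ninner_self[symmetric] funpow_add comp_apply
      unfolding P_def by (subst damp_funpow_selfadjoint(1)[OF bC]) simp
    then show ?t1
      unfolding mtr_def damp_mat_funpow[OF C D] e_def[symmetric] P_def[symmetric] by (simp add: ne)
    have "ninner N ((Q ^^ (k + k)) (e i)) (e i) = complex_of_real (nsq N ((Q ^^ k) (e i)))" for i
      unfolding ninner_self[symmetric] funpow_add comp_apply
      unfolding Q_def by (subst damp_funpow_selfadjoint(2)[OF bC]) simp
    then show ?t2
      unfolding mtr_def damp_mat_funpow[OF D C] e_def[symmetric] Q_def[symmetric] by (simp add: ne)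
  qed
  have eq: "(\<Sum>i<N. nsq N ((Q ^^ k) (e i))) = (\<Sum>i<N. nsq N ((P ^^ k) (e i)))" for k
    using tr[of k] tr'[of k] mtr_damp_mat[OF C D, of N "1/K" "k + k"]
    unfolding of_real_sum[symmetric] by (metis of_real_eq_iff)
  have "(\<lambda>k. \<Sum>i<N. nsq N ((P ^^ k) (e i))) \<longlonglongrightarrow> (\<Sum>i<N. 0)"
    unfolding P_def by (intro tendsto_sum damp_funpow_tendsto_zero[OF bC K inj]) auto
  then have limQ: "(\<lambda>k. \<Sum>i<N. nsq N ((Q ^^ k) (e i))) \<longlonglongrightarrow> 0" by (simp add: eq)
  have Q_lim: "(\<lambda>k. (Q ^^ k) (e j) m) \<longlonglongrightarrow> 0" if "m < N" for m
  proof -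
    have "(\<lambda>k. (norm ((Q ^^ k) (e j) m))\<^sup>2) \<longlonglongrightarrow> 0"
    proof (rule tendsto_sandwich[OF always_eventually always_eventually tendsto_const limQ])
      show "\<forall>k. (norm ((Q ^^ k) (e j) m))\<^sup>2 \<le> (\<Sum>i<N. nsq N ((Q ^^ k) (e i)))"
      proof
        fix k
        have "(norm ((Q ^^ k) (e j) m))\<^sup>2 \<le> nsq N ((Q ^^ k) (e j))"
          unfolding nsq_def using that
          by (intro member_le_sum[of m "{..<N}" "\<lambda>m. (norm ((Q ^^ k) (e j) m))\<^sup>2"]) auto
        also have "\<dots> \<le> (\<Sum>i<N. nsq N ((Q ^^ k) (e i)))"
          using j by (intro member_le_sum[of j "{..<N}" "\<lambda>i. nsq N ((Q ^^ k) (e i))"]) auto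
        finally show "(norm ((Q ^^ k) (e j) m))\<^sup>2 \<le> (\<Sum>i<N. nsq N ((Q ^^ k) (e i)))" .
      qed
    qed simp
    from tendsto_real_sqrt[OF this] show ?thesis by (simp add: tendsto_norm_zero_iff)
  qed
  have Qcong: "\<forall>i<N. (Q ^^ k) u i = (Q ^^ k) v i" if "\<forall>i<N. u i = v i" for u v k
  proof (induction k)
    case (Suc k)
    then have "mact N C ((Q ^^ k) u) = mact N C ((Q ^^ k) v)" by (auto simp: mact_def fun_eq_iff)
    then show ?case using Suc by (simp add: Q_apply[of "(Q ^^ k) u"] Q_apply[of "(Q ^^ k) v"])
  qed (use that in simp)
  have Qf: "\<forall>i<N. (Q ^^ k) f i = f i" for k
  proof (induction k)
    case (Suc k)
    have "mact N ?D (mact N C f) i = 0" for i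
      using f unfolding mact_def[of N ?D] by (simp add: bounded_clinear_simps[OF bD])
    then have "\<forall>i<N. Q f i = f i" by (simp add: Q_apply[of f])
    then show ?case using Qcong[OF Suc.IH, of 1] by simp
  qed simp
  \<comment> \<open>\<open>\<langle>f\<^sub>j, R \<xi>\<rangle> = \<langle>Q\<^sup>k f, R e\<^sub>j\<rangle> = \<langle>f, R Q\<^sup>k e\<^sub>j\<rangle>\<close>, as \<open>Q\<close> fixes \<open>f\<close>, is selfadjoint and commutes with \<open>R\<close>;
    and \<open>Q\<^sup>k e\<^sub>j\<close> tends to zero.\<close>
  have "cinner (f j) (R \<xi>) = 0" if R: "bounded_clinear R" "\<And>a x. a \<in> A \<Longrightarrow> R (a x) = a (R x)" for R
  proof -
    note lR = bounded_clinear_simps[OF R(1)]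
    have RM: "R (mact N E u i) = mact N E (\<lambda>m. R (u m)) i" if "E \<in> mats" for E u i
      using that R(2) by (simp add: mact_def lR mats_def)
    have RQ: "(Q ^^ k) (\<lambda>m. R (u m)) = (\<lambda>m. R ((Q ^^ k) u m))" for k u
    proof (induction k)
      case (Suc k)
      let ?w = "(Q ^^ k) u"
      have "mact N C (\<lambda>m. R (?w m)) = (\<lambda>i. R (mact N C ?w i))" using RM[OF C] by auto
      then have "Q (\<lambda>m. R (?w m)) = (\<lambda>m. R (Q ?w m))"
        unfolding Q_apply[of "\<lambda>m. R (?w m)", abs_def] Q_apply[of ?w] by (auto simp: lR RM[OF D])
      then show ?case using Suc by simp
    qed simp
    have "cinner (f j) (R \<xi>) = ninner N f (\<lambda>m. R ((Q ^^ k) (e j) m))" for k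
    proof -
      have "cinner (f j) (R \<xi>) = (\<Sum>m<N. if m = j then cinner (f j) (R \<xi>) else 0)" using j by simp
      also have "\<dots> = ninner N f (\<lambda>m. R (e j m))"
        unfolding ninner_def e_def by (intro sum.cong) (auto simp: lR)
      also have "\<dots> = ninner N ((Q ^^ k) f) (\<lambda>m. R (e j m))"
        unfolding ninner_def using Qf by (intro sum.cong) auto
      also have "\<dots> = ninner N f ((Q ^^ k) (\<lambda>m. R (e j m)))"
        unfolding Q_def by (rule damp_funpow_selfadjoint(2)[OF bC])
      finally show ?thesis by (simp add: RQ)
    qed
    moreover have "(\<lambda>k. ninner N f (\<lambda>m. R ((Q ^^ k) (e j) m))) \<longlonglongrightarrow> (\<Sum>m<N. cinner (f m) (R 0))"
      unfolding ninner_def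
      by (intro tendsto_sum tendsto_cinner tendsto_const bounded_linear.tendsto[OF bounded_clinear_linear[OF R(1)]] Q_lim)
        auto
    ultimately have "(\<lambda>k::nat. cinner (f j) (R \<xi>)) \<longlonglongrightarrow> 0" by (simp add: lR)
    then show ?thesis by (simp add: LIMSEQ_const_iff)
  qed
  then have "{R \<xi> |R. bounded_clinear R \<and> (\<forall>a\<in>A. \<forall>x. R (a x) = a (R x))} \<subseteq> {x. cinner (f j) x = 0}"
    by blast
  moreover have "closed {x. cinner (f j) x = 0}" by (intro closed_Collect_eq continuous_intros)
  ultimately have "UNIV \<subseteq> {x. cinner (f j) x = 0}" unfolding cyclic[symmetric] by (rule closure_minimal)
  then have "cinner (f j) (f j) = 0" by blast
  then show ?thesis by simp
qed

end

section \<open>Elementary operations on linear pencils\<close>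

text \<open>A pencil stands for the matrix \<open>\<Sum>\<^sub>r A r \<otimes> x\<^sub>r\<close> with scalar coefficient matrices \<open>A r\<close>.  The index
  functions are total and the size \<open>p \<times> q\<close> is passed separately, so that a leading block is the same
  function with other bounds.\<close>

type_synonym 'r pencil = "'r \<Rightarrow> nat \<Rightarrow> nat \<Rightarrow> complex"

definition tp :: "'r pencil \<Rightarrow> 'r pencil" where "tp A r k l = A r l k"

definition dag :: "'r pencil \<Rightarrow> 'r pencil" where "dag A r k l = cnj (A r l k)"

definition sw :: "nat \<Rightarrow> nat \<Rightarrow> nat \<Rightarrow> nat" where
  "sw i j k = (if k = i then j else if k = j then i else k)"

definition col_add :: "nat \<Rightarrow> (nat \<Rightarrow> complex) \<Rightarrow> 'r pencil \<Rightarrow> 'r pencil" where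
  "col_add j d A r k l = A r k l + d l * A r k j"

definition col_swap :: "nat \<Rightarrow> nat \<Rightarrow> 'r pencil \<Rightarrow> 'r pencil" where
  "col_swap i j A r k l = A r k (sw i j l)"

inductive col_step :: "nat \<Rightarrow> 'r pencil \<Rightarrow> 'r pencil \<Rightarrow> bool" for q where
  add: "j < q \<Longrightarrow> d j = 0 \<Longrightarrow> \<forall>l\<ge>q. d l = 0 \<Longrightarrow> col_step q A (col_add j d A)"
| swap: "i < q \<Longrightarrow> j < q \<Longrightarrow> col_step q A (col_swap i j A)"

definition col_eqv :: "nat \<Rightarrow> 'r pencil \<Rightarrow> 'r pencil \<Rightarrow> bool" where
  "col_eqv q = (col_step q)\<^sup>*\<^sup>*"

text \<open>Sequences of elementary operations, rather than pairs of invertible matrices, let every invariance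
  be checked on a single step.\<close>

definition eqv :: "nat \<Rightarrow> nat \<Rightarrow> 'r pencil \<Rightarrow> 'r pencil \<Rightarrow> bool" where
  "eqv p q = (\<lambda>A B. col_step q A B \<or> col_step p (tp A) (tp B))\<^sup>*\<^sup>*"

lemma tp_tp [simp]: "tp (tp A) = A" by (simp add: tp_def fun_eq_iff)
lemma dag_dag [simp]: "dag (dag A) = A" by (simp add: dag_def fun_eq_iff)
lemma sw_sw [simp]: "sw i j (sw i j k) = k" by (simp add: sw_def)
lemma sw_less: "i < q \<Longrightarrow> j < q \<Longrightarrow> k < q \<Longrightarrow> sw i j k < q" by (simp add: sw_def)

lemma sum_sw:
  fixes g :: "nat \<Rightarrow> 'a::comm_monoid_add"
  assumes "i < q" "j < q"
  shows "(\<Sum>l<q. g (sw i j l)) = (\<Sum>l<q. g l)"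
  by (rule sum.reindex_bij_witness[of _ "sw i j" "sw i j"]) (use assms in \<open>auto simp: sw_less\<close>)

lemma col_add_inverse:
  assumes "d j = 0" shows "col_add j (\<lambda>l. - d l) (col_add j d A) = A"
  using assms by (simp add: col_add_def fun_eq_iff)

lemma col_swap_inverse: "col_swap i j (col_swap i j A) = A"
  by (simp add: col_swap_def fun_eq_iff)

lemma col_step_sym: "col_step q A B \<Longrightarrow> col_step q B A"
proof (induction rule: col_step.induct)
  case (add j d A)
  then show ?case using col_step.add[of j q "\<lambda>l. - d l" "col_add j d A"] by (simp add: col_add_inverse)
next
  case (swap i j A)
  then show ?case using col_step.swap[of i q j "col_swap i j A"] by (simp add: col_swap_inverse)
qed

lemma col_step_mono: "col_step q A B \<Longrightarrow> q \<le> q' \<Longrightarrow> col_step q' A B"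
  by (induction rule: col_step.induct) (auto intro: col_step.intros)

lemma col_step_dag:
  fixes A B :: "'r pencil"
  shows "col_step p (tp A) (tp B) \<longleftrightarrow> col_step p (dag A) (dag B)"
proof -
  define cj :: "'r pencil \<Rightarrow> 'r pencil" where "cj A r k l = cnj (A r k l)" for A r k l
  have *: "col_step p A B \<Longrightarrow> col_step p (cj A) (cj B)" for A B :: "'r pencil"
  proof (induction rule: col_step.induct)
    case (add j d A)
    have "cj (col_add j d A) = col_add j (\<lambda>l. cnj (d l)) (cj A)"
      by (simp add: cj_def col_add_def fun_eq_iff)
    then show ?case using add col_step.add[of j p "\<lambda>l. cnj (d l)" "cj A"] by simp
  next
    case (swap i j A)
    have "cj (col_swap i j A) = col_swap i j (cj A)"
      by (simp add: cj_def col_swap_def fun_eq_iff)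
    then show ?case using swap col_step.swap[of i p j "cj A"] by simp
  qed
  have "cj (tp X) = dag X" "cj (dag X) = tp X" for X :: "'r pencil"
    by (simp_all add: cj_def tp_def dag_def fun_eq_iff)
  then show ?thesis using *[of "tp A" "tp B"] *[of "dag A" "dag B"] by auto
qed

lemma col_eqv_refl [simp]: "col_eqv q A A" by (simp add: col_eqv_def)
lemma col_eqv_trans: "col_eqv q A B \<Longrightarrow> col_eqv q B C \<Longrightarrow> col_eqv q A C"
  unfolding col_eqv_def by (rule rtranclp_trans)
lemma col_eqv_step: "col_step q A B \<Longrightarrow> col_eqv q A B" unfolding col_eqv_def by blast

lemma eqv_refl [simp]: "eqv p q A A" by (simp add: eqv_def)
lemma eqv_trans: "eqv p q A B \<Longrightarrow> eqv p q B C \<Longrightarrow> eqv p q A C"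
  unfolding eqv_def by (rule rtranclp_trans)
lemma eqv_col_step: "col_step q A B \<Longrightarrow> eqv p q A B" unfolding eqv_def by blast
lemma eqv_row_step: "col_step p (tp A) (tp B) \<Longrightarrow> eqv p q A B" unfolding eqv_def by blast

lemma eqv_induct [consumes 1, case_names refl col row]:
  assumes "eqv p q A B" "P A"
    and "\<And>B C. eqv p q A B \<Longrightarrow> P B \<Longrightarrow> col_step q B C \<Longrightarrow> P C"
    and "\<And>B C. eqv p q A B \<Longrightarrow> P B \<Longrightarrow> col_step p (tp B) (tp C) \<Longrightarrow> P C"
  shows "P B"
  using assms(1)[unfolded eqv_def]
proof (induction rule: rtranclp_induct)
  case base show ?case by (rule assms(2))
next
  case (step B C)
  have B: "eqv p q A B" unfolding eqv_def by (rule step(1))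
  from step(2) show ?case using assms(3)[OF B step.IH] assms(4)[OF B step.IH] by blast
qed

lemma eqv_mono: "eqv p q A B \<Longrightarrow> p \<le> p' \<Longrightarrow> q \<le> q' \<Longrightarrow> eqv p' q' A B"
  by (induction rule: eqv_induct)
    (use eqv_refl eqv_trans[OF _ eqv_col_step[OF col_step_mono]] eqv_trans[OF _ eqv_row_step[OF col_step_mono]]
     in \<open>blast+\<close>)

lemma col_eqv_eqv: "col_eqv q A B \<Longrightarrow> eqv p q A B"
  unfolding col_eqv_def
proof (induction rule: rtranclp_induct)
  case (step B C) then show ?case using eqv_trans eqv_col_step by blast
qed simp

lemma eqv_tp: "eqv p q A B \<Longrightarrow> eqv q p (tp A) (tp B)"
proof (induction rule: eqv_induct)
  case (col B C)
  then have "eqv q p (tp B) (tp C)" by (intro eqv_row_step) simp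
  then show ?case using col eqv_trans by blast
next
  case (row B C) then show ?case using eqv_trans eqv_col_step by blast
qed simp

lemma eqv_dag: "eqv p q A B \<Longrightarrow> eqv q p (dag A) (dag B)"
proof (induction rule: eqv_induct)
  case (col B C)
  then have "col_step q (tp (dag B)) (tp (dag C))" using col_step_dag[of q "dag B" "dag C"] by simp
  then show ?case using col by (blast intro: eqv_trans eqv_row_step)
next
  case (row B C)
  then show ?case using col_step_dag[of p B C] eqv_trans eqv_col_step by blast
qed simp

lemma row_eqv_eqv: "col_eqv p (tp A) (tp B) \<Longrightarrow> eqv p q A B"
  using eqv_tp[OF col_eqv_eqv[of p "tp A" "tp B" q]] by simp

lemma row_eqv_dag: "col_eqv p (dag A) D \<Longrightarrow> eqv p q A (dag D)"
  using eqv_dag[OF col_eqv_eqv[of p "dag A" D q]] by simp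

text \<open>Operations on the block to the right of a zero block combine only the columns from \<open>t\<close> on and the
  first \<open>s\<close> rows.  They extend to the whole pencil by the same operations, which preserve the zero block because
  its rows are combined only with each other.\<close>

lemma eqv_lift_right:
  assumes "eqv s q R R'" "R = (\<lambda>r k l. A r k (t + l))" "\<forall>r k l. k < s \<longrightarrow> l < t \<longrightarrow> A r k l = 0"
  shows "\<exists>B. eqv s (t + q) A B \<and> R' = (\<lambda>r k l. B r k (t + l)) \<and>
             (\<forall>r k l. k < s \<longrightarrow> l < t \<longrightarrow> B r k l = 0)"
  using assms(1)
proof (induction rule: eqv_induct)
  case refl then show ?case using assms(2,3) by (intro exI[of _ A]) simp
next
  case (col X Y)
  then obtain B where B: "eqv s (t + q) A B" "X = (\<lambda>r k l. B r k (t + l))"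
      "\<forall>r k l. k < s \<longrightarrow> l < t \<longrightarrow> B r k l = 0" by blast
  from col.hyps(2) show ?case
  proof cases
    case (add j d)
    define d' where "d' l = (if t \<le> l then d (l - t) else 0)" for l
    have "col_step (t + q) B (col_add (t + j) d' B)"
      by (rule col_step.add) (use add in \<open>auto simp: d'_def\<close>)
    then have "eqv s (t + q) A (col_add (t + j) d' B)" using B(1) by (blast intro: eqv_trans eqv_col_step)
    moreover have "Y = (\<lambda>r k l. col_add (t + j) d' B r k (t + l))"
      by (simp add: add(1) B(2) col_add_def d'_def fun_eq_iff)
    moreover have "\<forall>r k l. k < s \<longrightarrow> l < t \<longrightarrow> col_add (t + j) d' B r k l = 0"
      using B(3) by (auto simp: col_add_def d'_def)
    ultimately show ?thesis by blast
  next
    case (swap i j)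
    have "col_step (t + q) B (col_swap (t + i) (t + j) B)"
      by (rule col_step.swap) (use swap in auto)
    then have "eqv s (t + q) A (col_swap (t + i) (t + j) B)" using B(1) by (blast intro: eqv_trans eqv_col_step)
    moreover have "Y = (\<lambda>r k l. col_swap (t + i) (t + j) B r k (t + l))"
      by (simp add: swap(1) B(2) col_swap_def sw_def fun_eq_iff)
    moreover have "\<forall>r k l. k < s \<longrightarrow> l < t \<longrightarrow> col_swap (t + i) (t + j) B r k l = 0"
      using B(3) by (auto simp: col_swap_def sw_def)
    ultimately show ?thesis by blast
  qed
next
  case (row X Y)
  then obtain B where B: "eqv s (t + q) A B" "X = (\<lambda>r k l. B r k (t + l))"
      "\<forall>r k l. k < s \<longrightarrow> l < t \<longrightarrow> B r k l = 0" by blast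
  from row.hyps(2) show ?case
  proof cases
    case (add j d)
    define C where "C = tp (col_add j d (tp B))"
    have "col_step s (tp B) (tp C)" unfolding C_def tp_tp by (rule col_step.add) (use add in auto)
    then have "eqv s (t + q) A C" using B(1) by (blast intro: eqv_trans eqv_row_step)
    moreover have "Y = (\<lambda>r k l. C r k (t + l))"
      using arg_cong[OF add(1), of tp] by (simp add: B(2) C_def col_add_def tp_def fun_eq_iff)
    moreover have "\<forall>r k l. k < s \<longrightarrow> l < t \<longrightarrow> C r k l = 0"
      using B(3) add by (auto simp: C_def col_add_def tp_def)
    ultimately show ?thesis by blast
  next
    case (swap i j)
    define C where "C = tp (col_swap i j (tp B))"
    have "col_step s (tp B) (tp C)" unfolding C_def tp_tp by (rule col_step.swap) (use swap in auto)
    then have "eqv s (t + q) A C" using B(1) by (blast intro: eqv_trans eqv_row_step)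
    moreover have "Y = (\<lambda>r k l. C r k (t + l))"
      using arg_cong[OF swap(1), of tp] by (simp add: B(2) C_def col_swap_def tp_def fun_eq_iff)
    moreover have "\<forall>r k l. k < s \<longrightarrow> l < t \<longrightarrow> C r k l = 0"
      using B(3) swap by (auto simp: C_def col_swap_def tp_def sw_def)
    ultimately show ?thesis by blast
  qed
qed

lemma eqv_lift_down:
  assumes "eqv p t P P'" "P = (\<lambda>r k l. A r (s + k) l)" "\<forall>r k l. k < s \<longrightarrow> l < t \<longrightarrow> A r k l = 0"
  shows "\<exists>B. eqv (s + p) t A B \<and> P' = (\<lambda>r k l. B r (s + k) l) \<and>
             (\<forall>r k l. k < s \<longrightarrow> l < t \<longrightarrow> B r k l = 0)"
proof -
  have "tp P = (\<lambda>r k l. tp A r k (s + l))" using assms(2) by (simp add: tp_def fun_eq_iff)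
  moreover have "\<forall>r k l. k < t \<longrightarrow> l < s \<longrightarrow> tp A r k l = 0" using assms(3) by (simp add: tp_def)
  ultimately obtain B where B: "eqv t (s + p) (tp A) B" "tp P' = (\<lambda>r k l. B r k (s + l))"
      "\<forall>r k l. k < t \<longrightarrow> l < s \<longrightarrow> B r k l = 0"
    using eqv_lift_right[OF eqv_tp[OF assms(1)]] by blast
  have "P' = (\<lambda>r k l. tp B r (s + k) l)" using arg_cong[OF B(2), of tp] by (simp add: tp_def fun_eq_iff)
  then show ?thesis
    using eqv_tp[OF B(1)] B(3) by (intro exI[of _ "tp B"]) (auto simp: tp_def)
qed

lemma eqv_zero:
  assumes "eqv p q A B" "\<forall>r k l. k < p \<longrightarrow> l < q \<longrightarrow> B r k l = 0"
  shows "\<forall>r k l. k < p \<longrightarrow> l < q \<longrightarrow> A r k l = 0"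
proof -
  have step: "\<forall>r k l. k < p \<longrightarrow> l < q \<longrightarrow> B r k l = 0"
    if "col_step q B C" "\<forall>r k l. k < p \<longrightarrow> l < q \<longrightarrow> C r k l = 0" for p q and B C :: "'a pencil"
    using col_step_sym[OF that(1)]
    by cases (use that(2) in \<open>auto simp: col_add_def col_swap_def sw_less\<close>)
  have "(\<forall>r k l. k < p \<longrightarrow> l < q \<longrightarrow> B r k l = 0) \<longrightarrow> (\<forall>r k l. k < p \<longrightarrow> l < q \<longrightarrow> A r k l = 0)"
    using assms(1)
  proof (induction rule: eqv_induct)
    case (col B C) then show ?case using step[of q B C p] by blast
  next
    case (row B C) then show ?case using step[of p "tp B" "tp C" q] by (simp add: tp_def)
  qed simp
  then show ?thesis using assms(2) by blast
qed

text \<open>A zero block with \<open>s + t > p\<close> leaves the first \<open>t\<close> columns supported in fewer than \<open>t\<close> rows.  The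
  condition counts rows, so that every pencil with more columns than rows has such a block with
  \<open>s = 0\<close>.\<close>

definition hollow :: "nat \<Rightarrow> nat \<Rightarrow> 'r pencil \<Rightarrow> bool" where
  "hollow p q A \<longleftrightarrow> (\<exists>B s t. eqv p q A B \<and> s \<le> p \<and> t \<le> q \<and> p < s + t \<and>
      (\<forall>r k l. k < s \<longrightarrow> l < t \<longrightarrow> B r k l = 0))"

lemma hollow_dag: "hollow N N (dag A) \<Longrightarrow> hollow N N A"
  unfolding hollow_def
  by (elim exE conjE, rule_tac x = "dag B" in exI, rule_tac x = t in exI, rule_tac x = s in exI)
    (auto dest: eqv_dag simp: dag_def[of "_ :: 'a pencil", abs_def])

text \<open>The scalar rows \<open>\<gamma>' b\<close> do not depend on the coefficient index.  Where such a row is nonzero at some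
  column, that column serves as a pivot to clear the row from all the others and is then moved out of
  the range; so each term costs one column.\<close>

lemma column_elimination:
  assumes "q' \<le> q"
    and "\<forall>r k l. k < p \<longrightarrow> l < q' \<longrightarrow>
      A r k l = (\<Sum>a<m. \<beta> k a * \<gamma> r a l) + (\<Sum>b<n. \<beta>' r k b * \<gamma>' b l)"
  shows "\<exists>B \<gamma>2. col_eqv q A B \<and>
      (\<forall>r k l. k < p \<longrightarrow> l < q' - n \<longrightarrow> B r k l = (\<Sum>a<m. \<beta> k a * \<gamma>2 r a l))"
  using assms
proof (induction n arbitrary: q' A \<gamma> \<gamma>')
  case 0
  then show ?case by (intro exI[of _ A] exI[of _ \<gamma>]) simp
next
  case (Suc n)
  show ?case
  proof (cases "\<forall>l<q'. \<gamma>' n l = 0")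
    case True
    then obtain B \<gamma>2 where "col_eqv q A B"
        "\<forall>r k l. k < p \<longrightarrow> l < q' - n \<longrightarrow> B r k l = (\<Sum>a<m. \<beta> k a * \<gamma>2 r a l)"
      using Suc.IH[of q' A \<gamma> \<gamma>'] Suc.prems by auto
    then show ?thesis by (intro exI[of _ B] exI[of _ \<gamma>2]) auto
  next
    case False
    then obtain j where j: "j < q'" "\<gamma>' n j \<noteq> 0" by blast
    define d where "d l = (if l < q' \<and> l \<noteq> j then - (\<gamma>' n l / \<gamma>' n j) else 0)" for l
    define B where "B = col_swap j (q' - 1) (col_add j d A)"
    define up where "up g l = g (sw j (q' - 1) l) + d (sw j (q' - 1) l) * g j"
      for g :: "nat \<Rightarrow> complex" and l
    have "col_step q A (col_add j d A)"
      by (rule col_step.add) (use j Suc.prems(1) in \<open>auto simp: d_def\<close>)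
    moreover have "col_step q (col_add j d A) B"
      unfolding B_def by (rule col_step.swap) (use j Suc.prems(1) in auto)
    ultimately have AB: "col_eqv q A B" by (blast intro: col_eqv_step col_eqv_trans)
    have "B r k l = (\<Sum>a<m. \<beta> k a * up (\<gamma> r a) l) + (\<Sum>b<n. \<beta>' r k b * up (\<gamma>' b) l)"
      if "k < p" "l < q' - 1" for r k l
    proof -
      have l: "sw j (q' - 1) l < q'" "sw j (q' - 1) l \<noteq> j" using j that by (auto simp: sw_def)
      then have "up (\<gamma>' n) l = 0" using j by (simp add: up_def d_def)
      moreover have "B r k l = (\<Sum>a<m. \<beta> k a * up (\<gamma> r a) l) + (\<Sum>b<Suc n. \<beta>' r k b * up (\<gamma>' b) l)"
        unfolding B_def col_swap_def col_add_def up_def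
        using Suc.prems(2) that(1) l(1) j(1)
        by (simp add: sum.distrib sum_distrib_left algebra_simps)
      ultimately show ?thesis by simp
    qed
    then have "\<forall>r k l. k < p \<longrightarrow> l < q' - 1 \<longrightarrow>
        B r k l = (\<Sum>a<m. \<beta> k a * up (\<gamma> r a) l) + (\<Sum>b<n. \<beta>' r k b * up (\<gamma>' b) l)"
      by simp
    moreover have "q' - 1 \<le> q" using Suc.prems(1) by linarith
    ultimately have "\<exists>C \<gamma>2. col_eqv q B C \<and>
        (\<forall>r k l. k < p \<longrightarrow> l < q' - 1 - n \<longrightarrow> C r k l = (\<Sum>a<m. \<beta> k a * \<gamma>2 r a l))"
      by (intro Suc.IH[of "q' - 1" B "\<lambda>r a. up (\<gamma> r a)" "\<lambda>b. up (\<gamma>' b)"])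
    then obtain C \<gamma>2 where C: "col_eqv q B C"
        "\<forall>r k l. k < p \<longrightarrow> l < q' - 1 - n \<longrightarrow> C r k l = (\<Sum>a<m. \<beta> k a * \<gamma>2 r a l)"
      by blast
    have "col_eqv q A C" using AB C(1) by (rule col_eqv_trans)
    then show ?thesis using C(2) by (intro exI[of _ C] exI[of _ \<gamma>2]) simp
  qed
qed

text \<open>Column operations remove the \<open>n\<close> terms whose right factor is scalar and leave \<open>N - n\<close> columns;
  row operations remove the other \<open>m\<close> terms and leave \<open>N - m\<close> rows.\<close>

lemma hollow_if_factorized:
  assumes "\<forall>r k l. k < N \<longrightarrow> l < N \<longrightarrow>
      A r k l = (\<Sum>a<m. \<beta> k a * \<gamma> r a l) + (\<Sum>b<n. \<beta>' r k b * \<gamma>' b l)"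
    and "m + n < N"
  shows "hollow N N A"
proof -
  obtain B \<gamma>2 where B: "col_eqv N A B"
      "\<forall>r k l. k < N \<longrightarrow> l < N - n \<longrightarrow> B r k l = (\<Sum>a<m. \<beta> k a * \<gamma>2 r a l)"
    using column_elimination[OF order_refl assms(1)] by blast
  have "tp B r k l = (\<Sum>a<m. \<gamma>2 r a k * \<beta> l a)" if "k < N - n" "l < N" for r k l
    unfolding tp_def using B(2) that by (simp add: mult.commute[of "\<gamma>2 _ _ _"])
  then obtain C where C: "col_eqv N (tp B) C" "\<forall>r k l. k < N - n \<longrightarrow> l < N - m \<longrightarrow> C r k l = 0"
    using column_elimination[where q' = N and q = N and p = "N - n" and A = "tp B" and m = 0
        and \<beta> = "\<lambda>_ _. 0" and \<gamma> = "\<lambda>_ _ _. 0" and n = m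
        and \<beta>' = "\<lambda>r k a. \<gamma>2 r a k" and \<gamma>' = "\<lambda>a l. \<beta> l a"] by auto
  have "eqv N N A (tp C)"
    by (rule eqv_trans[OF col_eqv_eqv[OF B(1)] row_eqv_eqv]) (simp add: C(1))
  then show ?thesis
    unfolding hollow_def using C(2) assms(2)
    by (intro exI[of _ "tp C"] exI[of _ "N - m"] exI[of _ "N - n"]) (auto simp: tp_def)
qed

section \<open>Kernels of evaluated pencils\<close>

definition pker :: "nat \<Rightarrow> nat \<Rightarrow> 'r::finite pencil \<Rightarrow> ('r \<Rightarrow> 'h \<Rightarrow> 'h) \<Rightarrow> (nat \<Rightarrow> 'h::complex_hilbert) set" where
  "pker p q A Z = {f. \<forall>k<p. (\<Sum>l<q. \<Sum>r\<in>UNIV. A r k l *\<^sub>C Z r (f l)) = 0}"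

definition indep :: "nat \<Rightarrow> (nat \<Rightarrow> 'h::complex_hilbert) \<Rightarrow> bool" where
  "indep q f \<longleftrightarrow> (\<forall>c. (\<Sum>l<q. c l *\<^sub>C f l) = 0 \<longrightarrow> (\<forall>l<q. c l = 0))"

definition trivial_pker :: "nat \<Rightarrow> nat \<Rightarrow> 'r::finite pencil \<Rightarrow> ('r \<Rightarrow> 'h \<Rightarrow> 'h::complex_hilbert) \<Rightarrow> bool" where
  "trivial_pker p q A Z \<longleftrightarrow> (\<forall>f\<in>pker p q A Z. \<forall>l<q. f l = 0)"

lemma pker_row_step:
  assumes "col_step p (tp A) (tp B)"
  shows "pker p q A Z = pker p q B Z"
proof -
  have sub: "pker p q A Z \<subseteq> pker p q B Z" if "col_step p (tp A) (tp B)" for A B :: "'a pencil"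
    using that
  proof cases
    case (add j d)
    have "B = tp (col_add j d (tp A))" using arg_cong[OF add(1), of tp] by simp
    then have B: "B r k l = A r k l + d k * A r j l" for r k l by (simp add: tp_def col_add_def)
    show ?thesis
    proof
      fix f assume f: "f \<in> pker p q A Z"
      have "(\<Sum>l<q. \<Sum>r\<in>UNIV. B r k l *\<^sub>C Z r (f l)) =
          (\<Sum>l<q. \<Sum>r\<in>UNIV. A r k l *\<^sub>C Z r (f l)) + d k *\<^sub>C (\<Sum>l<q. \<Sum>r\<in>UNIV. A r j l *\<^sub>C Z r (f l))" for k
        by (simp add: B scaleC_add_left sum.distrib scaleC_sum_right scaleC_scaleC)
      then show "f \<in> pker p q B Z" using f add(2) by (simp add: pker_def)
    qed
  next
    case (swap i j)
    have "B = tp (col_swap i j (tp A))" using arg_cong[OF swap(1), of tp] by simp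
    then have B: "B r k l = A r (sw i j k) l" for r k l by (simp add: tp_def col_swap_def)
    show ?thesis using swap(2,3) by (auto simp: pker_def B sw_less)
  qed
  from sub[OF assms] sub[OF col_step_sym[OF assms]] show ?thesis by blast
qed

lemma pker_row_eqv_dag:
  assumes "col_eqv p (dag A) D"
  shows "pker p q A Z = pker p q (dag D) Z"
  using assms unfolding col_eqv_def
proof (induction rule: rtranclp_induct)
  case (step D E)
  then have "col_step p (tp (dag D)) (tp (dag E))" using col_step_dag[of p "dag D" "dag E"] by simp
  then show ?case using step(3) pker_row_step by blast
qed simp

text \<open>The substitution of unknowns that accompanies \<open>col_add\<close>: the added multiples of column \<open>j\<close> are
  compensated in the \<open>j\<close>-th unknown.\<close>

definition subst_add :: "nat \<Rightarrow> nat \<Rightarrow> (nat \<Rightarrow> complex) \<Rightarrow> (nat \<Rightarrow> 'h) \<Rightarrow> nat \<Rightarrow> 'h::complex_hilbert" where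
  "subst_add q j d f l = (if l = j then f j - (\<Sum>i<q. d i *\<^sub>C f i) else f l)"

lemma pker_col_add:
  assumes Z: "\<forall>r. bounded_clinear (Z r)" and j: "j < q" "d j = 0" and f: "f \<in> pker p q A Z"
  shows "subst_add q j d f \<in> pker p q (col_add j d A) Z"
  unfolding pker_def
proof (intro CollectI allI impI)
  fix k assume k: "k < p"
  define T where "T l x = (\<Sum>r\<in>UNIV. A r k l *\<^sub>C Z r x)" for l x
  have "bounded_clinear (T l)" for l
    unfolding T_def[abs_def] by (intro bounded_clinear_sum bounded_clinear_scale Z[rule_format])
  note T = bounded_clinear_simps[OF this]
  let ?g = "subst_add q j d f"
  have sd: "(\<Sum>l<q. d l *\<^sub>C ?g l) = (\<Sum>l<q. d l *\<^sub>C f l)"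
    by (intro sum.cong refl) (use j in \<open>auto simp: subst_add_def\<close>)
  have "(\<Sum>l<q. \<Sum>r\<in>UNIV. col_add j d A r k l *\<^sub>C Z r (?g l)) = (\<Sum>l<q. T l (?g l) + d l *\<^sub>C T j (?g l))"
    by (simp add: T_def col_add_def scaleC_add_left sum.distrib scaleC_sum_right scaleC_scaleC)
  also have "\<dots> = (\<Sum>l<q. T l (?g l)) + T j (\<Sum>l<q. d l *\<^sub>C ?g l)"
    by (simp add: sum.distrib T)
  also have "(\<Sum>l<q. T l (?g l)) = (\<Sum>l<q. T l (f l) - (if l = j then T j (\<Sum>i<q. d i *\<^sub>C f i) else 0))"
    by (intro sum.cong refl) (simp add: subst_add_def T)
  also have "\<dots> + T j (\<Sum>l<q. d l *\<^sub>C ?g l) = (\<Sum>l<q. T l (f l))"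
    using j by (simp add: sum_subtractf sd)
  also have "\<dots> = 0" using f k by (simp add: pker_def T_def)
  finally show "(\<Sum>l<q. \<Sum>r\<in>UNIV. col_add j d A r k l *\<^sub>C Z r (?g l)) = 0" .
qed

lemma pker_col_swap:
  assumes "i < q" "j < q" and f: "f \<in> pker p q A Z"
  shows "(\<lambda>l. f (sw i j l)) \<in> pker p q (col_swap i j A) Z"
  using f sum_sw[OF assms(1,2), of "\<lambda>l. \<Sum>r\<in>UNIV. A r k l *\<^sub>C Z r (f l)" for k]
  by (simp add: pker_def col_swap_def)

text \<open>Column operations act on the unknowns by an invertible scalar substitution, which preserves both
  nonvanishing and linear independence.\<close>

lemma pker_col_step:
  assumes Z: "\<forall>r. bounded_clinear (Z r)" and "col_step q A B" and f: "f \<in> pker p q A Z"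
  shows "\<exists>g\<in>pker p q B Z. ((\<forall>l<q. g l = 0) \<longrightarrow> (\<forall>l<q. f l = 0)) \<and> (indep q f \<longrightarrow> indep q g)"
  using assms(2)
proof cases
  case (add j d)
  let ?g = "subst_add q j d f"
  have "(\<forall>l<q. ?g l = 0) \<longrightarrow> (\<forall>l<q. f l = 0)"
  proof (intro impI)
    assume g: "\<forall>l<q. ?g l = 0"
    then have "f l = 0" if "l < q" "l \<noteq> j" for l using that by (auto simp: subst_add_def)
    moreover from this have "(\<Sum>i<q. d i *\<^sub>C f i) = 0" using add by (intro sum.neutral) auto
    moreover have "?g j = 0" using g add by blast
    ultimately show "\<forall>l<q. f l = 0" by (auto simp: subst_add_def)
  qed
  moreover have "indep q ?g" if ind: "indep q f"
    unfolding indep_def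
  proof (intro allI impI)
    fix c l assume c: "(\<Sum>l<q. c l *\<^sub>C ?g l) = 0" and l: "l < q"
    have "(\<Sum>l<q. c l *\<^sub>C ?g l) = (\<Sum>l<q. c l *\<^sub>C f l - (if l = j then c j *\<^sub>C (\<Sum>i<q. d i *\<^sub>C f i) else 0))"
      by (intro sum.cong refl) (simp add: subst_add_def scaleC_diff_right)
    also have "\<dots> = (\<Sum>l<q. (c l - c j * d l) *\<^sub>C f l)"
      using add by (simp add: sum_subtractf complex_vector.scale_left_diff_distrib scaleC_sum_right scaleC_scaleC)
    finally have "(\<Sum>l<q. (c l - c j * d l) *\<^sub>C f l) = 0" using c by simp
    then have "\<forall>l<q. c l - c j * d l = 0"
      using ind[unfolded indep_def, THEN spec, of "\<lambda>l. c l - c j * d l"] by blast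
    then have "c j - c j * d j = 0" "c l - c j * d l = 0" using add l by blast+
    then show "c l = 0" using add by simp
  qed
  moreover have "?g \<in> pker p q B Z" unfolding add(1) by (rule pker_col_add[where d = d and j = j, OF Z add(2,3) f])
  ultimately show ?thesis by blast
next
  case (swap i j)
  let ?g = "\<lambda>l. f (sw i j l)"
  have "(\<forall>l<q. ?g l = 0) \<longrightarrow> (\<forall>l<q. f l = 0)"
    using swap by (metis sw_less sw_sw)
  moreover have "indep q ?g" if ind: "indep q f"
    unfolding indep_def
  proof (intro allI impI)
    fix c l assume c: "(\<Sum>l<q. c l *\<^sub>C ?g l) = 0" and l: "l < q"
    have "(\<Sum>l<q. c (sw i j l) *\<^sub>C f l) = 0"
      using sum_sw[of i q j "\<lambda>l. c l *\<^sub>C ?g l"] c swap by simp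
    then have "\<forall>l<q. c (sw i j l) = 0"
      using ind[unfolded indep_def, THEN spec, of "\<lambda>l. c (sw i j l)"] by blast
    then show "c l = 0" using swap l by (metis sw_less sw_sw)
  qed
  moreover have "?g \<in> pker p q B Z" unfolding swap(1) by (rule pker_col_swap[OF swap(2,3) f])
  ultimately show ?thesis by (intro bexI[where x = ?g] conjI) simp_all
qed

lemma pker_eqv:
  assumes Z: "\<forall>r. bounded_clinear (Z r)" and "eqv p q A B" and f: "f \<in> pker p q A Z"
  shows "\<exists>g\<in>pker p q B Z. ((\<forall>l<q. g l = 0) \<longrightarrow> (\<forall>l<q. f l = 0)) \<and> (indep q f \<longrightarrow> indep q g)"
  using assms(2)
proof (induction rule: eqv_induct)
  case (col B C)
  then obtain g where g: "g \<in> pker p q B Z" "(\<forall>l<q. g l = 0) \<longrightarrow> (\<forall>l<q. f l = 0)" "indep q f \<longrightarrow> indep q g"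
    by blast
  from pker_col_step[OF Z col.hyps(2) g(1)] g(2,3) show ?case by blast
next
  case (row B C) then show ?case using pker_row_step by blast
qed (use f in blast)

lemma trivial_pker_eqv:
  assumes "\<forall>r. bounded_clinear (Z r)" "eqv p q A B" "trivial_pker p q B Z"
  shows "trivial_pker p q A Z"
  unfolding trivial_pker_def
proof
  fix f assume "f \<in> pker p q A Z"
  then obtain g where "g \<in> pker p q B Z" "(\<forall>l<q. g l = 0) \<longrightarrow> (\<forall>l<q. f l = 0)"
    using pker_eqv[OF assms(1,2)] by blast
  then show "\<forall>l<q. f l = 0" using assms(3) unfolding trivial_pker_def by blast
qed

text \<open>Take \<open>t\<close> minimal such that, after column operations, the kernel lives in the first \<open>t\<close> coordinates.
  A scalar linear relation satisfied there by all kernel vectors would clear one more coordinate.\<close>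

lemma pker_nondegenerate_form:
  fixes A :: "'r::finite pencil" and Z :: "'r \<Rightarrow> 'h \<Rightarrow> 'h::complex_hilbert"
  assumes Z: "\<forall>r. bounded_clinear (Z r)"
  shows "\<exists>B t. col_eqv q A B \<and> t \<le> q \<and> (\<forall>f\<in>pker p q B Z. \<forall>l<q. t \<le> l \<longrightarrow> f l = 0) \<and>
     (\<forall>c. (\<forall>f\<in>pker p q B Z. (\<Sum>l<t. c l *\<^sub>C f l) = 0) \<longrightarrow> (\<forall>l<t. c l = 0))"
proof -
  define P where "P t \<longleftrightarrow> t \<le> q \<and> (\<exists>B. col_eqv q A B \<and> (\<forall>f\<in>pker p q B Z. \<forall>l<q. t \<le> l \<longrightarrow> f l = 0))" for t
  have "P q" unfolding P_def by (auto intro: exI[of _ A])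
  define t where "t = (LEAST t. P t)"
  have "P t" unfolding t_def by (rule LeastI[of P, OF \<open>P q\<close>])
  then obtain B where B: "t \<le> q" "col_eqv q A B" "\<forall>f\<in>pker p q B Z. \<forall>l<q. t \<le> l \<longrightarrow> f l = 0"
    unfolding P_def by blast
  have "\<forall>l<t. c l = 0" if c: "\<forall>f\<in>pker p q B Z. (\<Sum>l<t. c l *\<^sub>C f l) = 0" for c
  proof (rule ccontr)
    assume "\<not> (\<forall>l<t. c l = 0)"
    then obtain j where j: "j < t" "c j \<noteq> 0" by blast
    define d where "d l = (if l < t \<and> l \<noteq> j then - (c l / c j) else 0)" for l
    have jq: "j < q" "d j = 0" using j B(1) by (auto simp: d_def)
    define C where "C = col_swap j (t - 1) (col_add j d B)"
    have "col_step q B (col_add j d B)"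
      by (rule col_step.add) (use jq B(1) in \<open>auto simp: d_def\<close>)
    moreover have "col_step q (col_add j d B) C"
      unfolding C_def by (rule col_step.swap) (use j B(1) in auto)
    ultimately have "col_eqv q A C" using B(2) by (blast intro: col_eqv_step col_eqv_trans)
    moreover have "g l = 0" if g: "g \<in> pker p q C Z" and l: "l < q" "t - 1 \<le> l" for g l
    proof -
      define h where "h l = g (sw j (t - 1) l)" for l
      have "h \<in> pker p q (col_add j d B) Z"
        using pker_col_swap[of j q "t - 1" g p C Z] g j B(1)
        unfolding C_def col_swap_inverse h_def[abs_def] by simp
      from pker_col_add[OF Z, of j q "\<lambda>l. - d l" h p "col_add j d B"] this jq
      have "subst_add q j (\<lambda>l. - d l) h \<in> pker p q B Z" by (simp add: col_add_inverse)
      moreover define f where "f = subst_add q j (\<lambda>l. - d l) h"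
      ultimately have f: "f \<in> pker p q B Z" by simp
      have fh: "f l = h l" if "l \<noteq> j" for l using that by (simp add: f_def subst_add_def)
      have hj: "h j = f j - (\<Sum>i<q. d i *\<^sub>C f i)"
      proof -
        have "(\<Sum>i<q. d i *\<^sub>C f i) = (\<Sum>i<q. d i *\<^sub>C h i)"
          by (intro sum.cong refl) (metis fh jq(2) scaleC_simps(1))
        then show ?thesis by (simp add: f_def subst_add_def sum_negf)
      qed
      have "(\<Sum>i<q. d i *\<^sub>C f i) = (\<Sum>i<t. d i *\<^sub>C f i)"
        using B(1) by (intro sum.mono_neutral_right) (auto simp: d_def)
      also have "\<dots> = (\<Sum>i<t. (if i = j then f j else 0) - (c i / c j) *\<^sub>C f i)"
        by (intro sum.cong refl) (use j in \<open>auto simp: d_def\<close>)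
      also have "\<dots> = f j - (\<Sum>i<t. (1 / c j) *\<^sub>C (c i *\<^sub>C f i))"
        using j by (simp add: sum_subtractf scaleC_scaleC)
      also have "\<dots> = f j" using c f unfolding scaleC_sum_right[symmetric] by simp
      finally have "h j = 0" using hj by simp
      moreover have "h l = 0" if "t \<le> l" "l < q" for l
        using B(3) f fh[of l] that j by auto
      moreover have "g l = h (sw j (t - 1) l)" by (simp add: h_def)
      ultimately show "g l = 0" using l j by (auto simp: sw_def)
    qed
    ultimately have "P (t - 1)" unfolding P_def using B(1) by auto
    then have "t \<le> t - 1" unfolding t_def by (rule Least_le)
    then show False using j by simp
  qed
  then show ?thesis using B by blast
qed

lemma sum_split_lessThan: "t \<le> q \<Longrightarrow> (\<Sum>l<q. g l) = (\<Sum>l<t. g l) + (\<Sum>l<q - t. g (t + l))"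
  for g :: "nat \<Rightarrow> 'a::comm_monoid_add"
proof -
  assume "t \<le> q"
  have "(\<Sum>l<t + m. g l) = (\<Sum>l<t. g l) + (\<Sum>l<m. g (t + l))" for m
    by (induction m) (auto simp: add.assoc)
  from this[of "q - t"] \<open>t \<le> q\<close> show ?thesis by simp
qed

lemma pker_right_block:
  assumes f: "f \<in> pker p q B Z" and s: "s \<le> p" and t: "t \<le> q"
    and B: "\<forall>r k l. k < s \<longrightarrow> l < t \<longrightarrow> B r k l = 0"
  shows "(\<lambda>l. f (t + l)) \<in> pker s (q - t) (\<lambda>r k l. B r k (t + l)) Z"
  unfolding pker_def
proof (intro CollectI allI impI)
  fix k assume k: "k < s"
  have "(\<Sum>l<t. \<Sum>r\<in>UNIV. B r k l *\<^sub>C Z r (f l)) = 0" using B k by (intro sum.neutral) auto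
  moreover have "(\<Sum>l<q. \<Sum>r\<in>UNIV. B r k l *\<^sub>C Z r (f l)) = 0" using f k s by (auto simp: pker_def)
  ultimately show "(\<Sum>l<q - t. \<Sum>r\<in>UNIV. B r k (t + l) *\<^sub>C Z r (f (t + l))) = 0"
    using sum_split_lessThan[OF t, of "\<lambda>l. \<Sum>r\<in>UNIV. B r k l *\<^sub>C Z r (f l)"] by simp
qed

text \<open>Suppose square pencils without an oversized zero block have trivial kernel.  Then so have all
  pencils without one: delete a row, unless this creates a zero block; in that case the block splits
  the pencil into two smaller ones.\<close>

lemma trivial_pker_if_not_hollow:
  fixes A :: "'r::finite pencil" and Z :: "'r \<Rightarrow> 'h \<Rightarrow> 'h::complex_hilbert"
  assumes Z: "\<forall>r. bounded_clinear (Z r)"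
    and sq: "\<forall>N A. \<not> hollow N N A \<longrightarrow> trivial_pker N N A Z"
  shows "\<not> hollow p q A \<Longrightarrow> trivial_pker p q A Z"
proof (induction "p + q" arbitrary: p q A rule: less_induct)
  case less
  have "q \<le> p"
  proof (rule ccontr)
    assume "\<not> q \<le> p"
    then have "hollow p q A" unfolding hollow_def by (intro exI[of _ A] exI[of _ 0] exI[of _ q]) auto
    then show False using less.prems by simp
  qed
  then consider "p = q" | "q < p" by linarith
  then show ?case
  proof cases
    case 1 then show ?thesis using sq less.prems by blast
  next
    case 2
    show ?thesis
    proof (cases "hollow (p - 1) q A")
      case False
      then have "trivial_pker (p - 1) q A Z" using less.hyps 2 by simp
      moreover have "pker p q A Z \<subseteq> pker (p - 1) q A Z" unfolding pker_def by auto
      ultimately show ?thesis unfolding trivial_pker_def by blast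
    next
      case True
      then obtain B s t where B: "eqv (p - 1) q A B" "s \<le> p - 1" "t \<le> q" "p - 1 < s + t"
          "\<forall>r k l. k < s \<longrightarrow> l < t \<longrightarrow> B r k l = 0" unfolding hollow_def by blast
      have AB: "eqv p q A B" using eqv_mono[OF B(1)] by simp
      have nohollow: "s' + t' \<le> p"
        if "eqv p q B C" "s' \<le> p" "t' \<le> q" "\<forall>r k l. k < s' \<longrightarrow> l < t' \<longrightarrow> C r k l = 0" for C s' t'
      proof (rule ccontr)
        assume "\<not> s' + t' \<le> p"
        then have "hollow p q A"
          unfolding hollow_def using that eqv_trans[OF AB that(1)]
          by (intro exI[of _ C] exI[of _ s'] exI[of _ t']) auto
        then show False using less.prems by simp
      qed
      have "s + t \<le> p" using B 2 by (intro nohollow[of B s t]) auto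
      \<comment> \<open>An oversized zero block in the upper right or the lower left part would enlarge this tight block beyond \<open>p\<close>.\<close>
      then have st: "s + t = p" using B(4) by linarith
      define R where "R = (\<lambda>r k l. B r k (t + l))"
      define P where "P = (\<lambda>r k l. B r (s + k) l)"
      have "\<not> hollow s (q - t) R"
      proof
        assume "hollow s (q - t) R"
        then obtain R' s' t' where R': "eqv s (q - t) R R'" "s' \<le> s" "t' \<le> q - t" "s < s' + t'"
            "\<forall>r k l. k < s' \<longrightarrow> l < t' \<longrightarrow> R' r k l = 0" unfolding hollow_def by blast
        obtain C where C: "eqv s (t + (q - t)) B C" "R' = (\<lambda>r k l. C r k (t + l))"
            "\<forall>r k l. k < s \<longrightarrow> l < t \<longrightarrow> C r k l = 0"
          using eqv_lift_right[OF R'(1) R_def B(5)] by blast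
        have "C r k l = 0" if "k < s'" "l < t + t'" for r k l
        proof (cases "l < t")
          case False
          then have "C r k l = R' r k (l - t)" by (simp add: C(2))
          then show ?thesis using False that R'(5) by simp
        qed (use C(3) R'(2) that in auto)
        moreover have "eqv p q B C" using eqv_mono[OF C(1)] B(2,3) by simp
        ultimately have "s' + (t + t') \<le> p"
          by (intro nohollow[of C s' "t + t'"]) (use R'(2,3) B(2,3) in auto)
        then show False using st R'(4) by simp
      qed
      then have R: "trivial_pker s (q - t) R Z" using less.hyps[of s "q - t"] B(2) 2 by simp
      have "\<not> hollow t t P"
      proof
        assume "hollow t t P"
        then obtain P' s' t' where P': "eqv t t P P'" "s' \<le> t" "t' \<le> t" "t < s' + t'"
            "\<forall>r k l. k < s' \<longrightarrow> l < t' \<longrightarrow> P' r k l = 0" unfolding hollow_def by blast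
        obtain C where C: "eqv (s + t) t B C" "P' = (\<lambda>r k l. C r (s + k) l)"
            "\<forall>r k l. k < s \<longrightarrow> l < t \<longrightarrow> C r k l = 0"
          using eqv_lift_down[OF P'(1) P_def B(5)] by blast
        have "C r k l = 0" if "k < s + s'" "l < t'" for r k l
        proof (cases "k < s")
          case False
          then have "C r k l = P' r (k - s) l" by (simp add: C(2))
          then show ?thesis using False that P'(5) by simp
        qed (use C(3) P'(3) that in auto)
        moreover have "eqv p q B C" using eqv_mono[OF C(1)] B(3) st by simp
        ultimately have "s + s' + t' \<le> p"
          by (intro nohollow[of C "s + s'" t']) (use P'(2,3) B(3) st in auto)
        then show False using st P'(4) by simp
      qed
      then have P: "trivial_pker t t P Z" using less.hyps[of t t] B(3) 2 by simp
      have "trivial_pker p q B Z"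
        unfolding trivial_pker_def
      proof
        fix f assume f: "f \<in> pker p q B Z"
        note split = sum_split_lessThan[OF B(3)]
        have "(\<lambda>l. f (t + l)) \<in> pker s (q - t) R Z"
          unfolding R_def by (rule pker_right_block[OF f _ B(3,5)]) (use B(2) in simp)
        from R[unfolded trivial_pker_def, THEN bspec, OF this]
        have f2: "f (t + l) = 0" if "l < q - t" for l using that by simp
        have z: "Z r 0 = 0" for r using bounded_clinear_simps(3)[OF Z[rule_format]] .
        have "f \<in> pker t t P Z"
          using f st by (auto simp: pker_def P_def split f2 z)
        from P[unfolded trivial_pker_def, THEN bspec, OF this]
        have f1: "f l = 0" if "l < t" for l using that by simp
        show "\<forall>l<q. f l = 0"
        proof (intro allI impI)
          fix l assume "l < q"
          then show "f l = 0" using f1[of l] f2[of "l - t"] by (cases "l < t") auto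
        qed
      qed
      then show ?thesis by (rule trivial_pker_eqv[OF Z AB])
    qed
  qed
qed

text \<open>Take a zero block of maximal size among all equivalent pencils.  If it does not reach the last
  column, the block to its right has no oversized zero block by maximality, hence trivial kernel; this
  makes a component of an independent kernel vector vanish.  The cokernel side excludes in the same way
  that it misses a row.\<close>

lemma pencil_zero_if_indep_kernels:
  fixes A :: "'r::finite pencil" and Z Zs :: "'r \<Rightarrow> 'h \<Rightarrow> 'h::complex_hilbert"
  assumes Z: "\<forall>r. bounded_clinear (Z r)" and Zs: "\<forall>r. bounded_clinear (Zs r)"
    and sq: "\<forall>N A. \<not> hollow N N A \<longrightarrow> trivial_pker N N A Z"
    and sqs: "\<forall>N A. \<not> hollow N N A \<longrightarrow> trivial_pker N N A Zs"
    and f: "f \<in> pker N N A Z" "indep N f" and e: "e \<in> pker N N (dag A) Zs" "indep N e"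
  shows "\<forall>r k l. k < N \<longrightarrow> l < N \<longrightarrow> A r k l = 0"
proof -
  define Q where "Q n \<longleftrightarrow> (\<exists>B s t. eqv N N A B \<and> s \<le> N \<and> t \<le> N \<and> n = s + t \<and>
      (\<forall>r k l. k < s \<longrightarrow> l < t \<longrightarrow> B r k l = 0))" for n
  have "Q 0" unfolding Q_def by (intro exI[of _ A] exI[of _ 0]) auto
  have bnd: "\<forall>n. Q n \<longrightarrow> n \<le> 2 * N" unfolding Q_def by auto
  define n0 where "n0 = Greatest Q"
  have "Q n0" unfolding n0_def using \<open>Q 0\<close> bnd by (metis GreatestI_nat)
  then obtain B s t where B: "eqv N N A B" "s \<le> N" "t \<le> N" "n0 = s + t"
      "\<forall>r k l. k < s \<longrightarrow> l < t \<longrightarrow> B r k l = 0" unfolding Q_def by blast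
  have max: "s' + t' \<le> s + t"
    if "eqv N N B C" "s' \<le> N" "t' \<le> N" "\<forall>r k l. k < s' \<longrightarrow> l < t' \<longrightarrow> C r k l = 0" for C s' t'
  proof -
    have "Q (s' + t')" unfolding Q_def using that eqv_trans[OF B(1) that(1)] by blast
    then show ?thesis using Greatest_le_nat[of Q "s' + t'" "2 * N"] bnd B(4) by (simp add: n0_def)
  qed
  have indep0: "\<not> l < n" if "indep n g" "g l = 0" for n l and g :: "nat \<Rightarrow> 'h"
  proof
    assume l: "l < n"
    have "(\<Sum>i<n. (if i = l then 1 else 0) *\<^sub>C g i) = 0" by (intro sum.neutral) (use that in auto)
    then have "(if l = l then 1 else 0 :: complex) = 0"
      using that(1) l unfolding indep_def by (elim allE[of _ "\<lambda>i. if i = l then 1 else 0"]) auto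
    then show False by simp
  qed
  obtain g where g: "g \<in> pker N N B Z" "indep N g" using pker_eqv[OF Z B(1) f(1)] f(2) by blast
  obtain h where h: "h \<in> pker N N (dag B) Zs" "indep N h" using pker_eqv[OF Zs eqv_dag[OF B(1)] e(1)] e(2) by blast
  have tN: "t = N"
  proof (rule ccontr)
    assume "t \<noteq> N"
    define R where "R = (\<lambda>r k l. B r k (t + l))"
    have "\<not> hollow s (N - t) R"
    proof
      assume "hollow s (N - t) R"
      then obtain R' s' t' where R': "eqv s (N - t) R R'" "s' \<le> s" "t' \<le> N - t" "s < s' + t'"
          "\<forall>r k l. k < s' \<longrightarrow> l < t' \<longrightarrow> R' r k l = 0" unfolding hollow_def by blast
      obtain C where C: "eqv s (t + (N - t)) B C" "R' = (\<lambda>r k l. C r k (t + l))"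
          "\<forall>r k l. k < s \<longrightarrow> l < t \<longrightarrow> C r k l = 0"
        using eqv_lift_right[OF R'(1) R_def B(5)] by blast
      have "C r k l = 0" if "k < s'" "l < t + t'" for r k l
      proof (cases "l < t")
        case False
        then have "C r k l = R' r k (l - t)" by (simp add: C(2))
        then show ?thesis using False that R'(5) by simp
      qed (use C(3) R'(2) that in auto)
      moreover have "eqv N N B C" using eqv_mono[OF C(1)] B(2,3) by simp
      ultimately have "s' + (t + t') \<le> s + t"
        by (intro max[of C s' "t + t'"]) (use R'(2,3) B(2,3) in auto)
      then show False using R'(4) by simp
    qed
    then have R: "trivial_pker s (N - t) R Z" by (rule trivial_pker_if_not_hollow[OF Z sq])
    have "(\<lambda>l. g (t + l)) \<in> pker s (N - t) R Z"
      unfolding R_def by (rule pker_right_block[OF g(1) B(2,3,5)])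
    from R[unfolded trivial_pker_def, THEN bspec, OF this] have "g (t + 0) = 0"
      using \<open>t \<noteq> N\<close> B(3) by (metis le_neq_implies_less zero_less_diff)
    then show False using indep0[OF g(2), of t] \<open>t \<noteq> N\<close> B(3) by simp
  qed
  have sN: "s = N"
  proof (rule ccontr)
    assume "s \<noteq> N"
    define P where "P = (\<lambda>r k l. B r (s + k) l)"
    have "\<not> hollow N (N - s) (dag P)"
    proof
      assume "hollow N (N - s) (dag P)"
      then obtain D s' t' where D: "eqv N (N - s) (dag P) D" "s' \<le> N" "t' \<le> N - s" "N < s' + t'"
          "\<forall>r k l. k < s' \<longrightarrow> l < t' \<longrightarrow> D r k l = 0" unfolding hollow_def by blast
      have "eqv (N - s) N P (dag D)" using eqv_dag[OF D(1)] by simp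
      from eqv_lift_down[OF this P_def] obtain C where C: "eqv (s + (N - s)) N B C"
          "dag D = (\<lambda>r k l. C r (s + k) l)" "\<forall>r k l. k < s \<longrightarrow> l < N \<longrightarrow> C r k l = 0"
        using B(5) tN by blast
      have "C r k l = 0" if "k < s + t'" "l < s'" for r k l
      proof (cases "k < s")
        case False
        then have "C r k l = dag D r (k - s) l" by (simp add: C(2))
        then show ?thesis using False that D(5) by (simp add: dag_def)
      qed (use C(3) D(2) that in auto)
      moreover have "eqv N N B C" using C(1) B(2) by simp
      ultimately have "(s + t') + s' \<le> s + t"
        by (intro max[of C "s + t'" s']) (use D(2,3) B(2) in auto)
      then show False using D(4) tN by simp
    qed
    then have P: "trivial_pker N (N - s) (dag P) Zs" by (rule trivial_pker_if_not_hollow[OF Zs sqs])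
    have "(\<lambda>l. h (s + l)) \<in> pker N (N - s) (dag P) Zs"
      using pker_right_block[OF h(1) order_refl B(2)] B(5) tN
      by (simp add: P_def dag_def[abs_def])
    from P[unfolded trivial_pker_def, THEN bspec, OF this] have "h (s + 0) = 0"
      using \<open>s \<noteq> N\<close> B(2) by (metis le_neq_implies_less zero_less_diff)
    then show False using indep0[OF h(2), of s] \<open>s \<noteq> N\<close> B(2) by simp
  qed
  show ?thesis using eqv_zero[OF B(1)] B(5) tN sN by blast
qed

section \<open>Linear matrices over the free algebra\<close>

definition cf :: "'n ncpoly \<Rightarrow> 'n list \<Rightarrow> complex" where
  "cf p w = Poly_Mapping.lookup p (Word w)"

lemma cf_simps [simp]:
  "cf 0 w = 0" "cf (p + q) w = cf p w + cf q w" "cf (p - q) w = cf p w - cf q w"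
  "cf (Poly_Mapping.single (Word u) a) w = (if u = w then a else 0)"
  by (auto simp: cf_def lookup_add lookup_minus lookup_single when_def)

lemma cf_sum: "cf (sum f I) w = (\<Sum>i\<in>I. cf (f i) w)"
  by (induction I rule: infinite_finite_induct) auto

lemma cf_eqI: "(\<And>w. cf p w = cf q w) \<Longrightarrow> p = q"
  by (rule poly_mapping_eqI) (metis cf_def free_word.collapse)

lemma finite_cf_support: "finite {w. cf p w \<noteq> 0}"
proof -
  have "finite (Word -` Poly_Mapping.keys p)" by (rule finite_vimageI) (auto intro: injI)
  moreover have "{w. cf p w \<noteq> 0} = Word -` Poly_Mapping.keys p"
    by (auto simp: cf_def in_keys_iff)
  ultimately show ?thesis by simp
qed

text \<open>The factorizations of a word into two words are its cuts.\<close>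

lemma cf_mult: "cf (p * q) w = (\<Sum>i\<le>length w. cf p (take i w) * cf q (drop i w))"
proof -
  have inner: "(\<Sum>x. Poly_Mapping.lookup q x when Word w = Word u + x)
      = (if take (length u) w = u then cf q (drop (length u) w) else 0)" for u
  proof (cases "take (length u) w = u")
    case True
    have "(Poly_Mapping.lookup q x when Word w = Word u + x)
        = (cf q (drop (length u) w) when x = Word (drop (length u) w))" for x
    proof (cases x)
      case (Word v)
      have "w = u @ v \<longleftrightarrow> v = drop (length u) w" using True by (metis append_eq_conv_conj append_take_drop_id)
      then show ?thesis using Word by (auto simp: plus_free_word_def cf_def when_def)
    qed
    then show ?thesis using True by simp
  next
    case False
    have "(Poly_Mapping.lookup q x when Word w = Word u + x) = 0" for x
      using False by (cases x) (auto simp: plus_free_word_def when_def)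
    then show ?thesis using False by simp
  qed
  have "cf (p * q) w = (\<Sum>x. Poly_Mapping.lookup p x * (\<Sum>y. Poly_Mapping.lookup q y when Word w = x + y))"
    by (simp add: cf_def lookup_mult)
  also have "\<dots> = (\<Sum>x\<in>(\<lambda>i. Word (take i w)) ` {..length w}.
      Poly_Mapping.lookup p x * (\<Sum>y. Poly_Mapping.lookup q y when Word w = x + y))"
  proof (rule Sum_any.expand_superset)
    show "{x. Poly_Mapping.lookup p x * (\<Sum>y. Poly_Mapping.lookup q y when Word w = x + y) \<noteq> 0}
        \<subseteq> (\<lambda>i. Word (take i w)) ` {..length w}"
    proof clarify
      fix x assume nz: "Poly_Mapping.lookup p x * (\<Sum>y. Poly_Mapping.lookup q y when Word w = x + y) \<noteq> 0"
      obtain u where u: "x = Word u" by (cases x)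
      then have "take (length u) w = u" using nz inner[of u] by (auto split: if_splits)
      moreover from this have "length u \<le> length w" by (metis length_take min.cobounded1)
      ultimately show "x \<in> (\<lambda>i. Word (take i w)) ` {..length w}"
        using u by (intro image_eqI[of _ _ "length u"]) auto
    qed
  qed simp
  also have "\<dots> = (\<Sum>i\<le>length w. cf p (take i w) * cf q (drop i w))"
  proof (subst sum.reindex)
    show "inj_on (\<lambda>i. Word (take i w)) {..length w}"
      by (rule inj_onI) (metis atMost_iff free_word.inject length_take min.absorb2)
    show "sum ((\<lambda>x. Poly_Mapping.lookup p x * (\<Sum>y. Poly_Mapping.lookup q y when Word w = x + y))
        \<circ> (\<lambda>i. Word (take i w))) {..length w} = (\<Sum>i\<le>length w. cf p (take i w) * cf q (drop i w))"
      by (intro sum.cong refl) (simp add: inner cf_def min_def)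
  qed
  finally show ?thesis .
qed

lemma finite_nonempty_has_max:
  fixes f :: "'a \<Rightarrow> nat"
  assumes "finite S" "S \<noteq> {}"
  shows "\<exists>x\<in>S. \<forall>y\<in>S. f y \<le> f x"
proof -
  have "Max (f ` S) \<in> f ` S" using assms by (intro Max_in) auto
  then obtain x where x: "x \<in> S" "Max (f ` S) = f x" by blast
  have "f y \<le> f x" if "y \<in> S" for y
    unfolding x(2)[symmetric] using assms(1) that by (intro Max_ge) auto
  then show ?thesis using x(1) by blast
qed

text \<open>This is the weak algorithm of the free algebra, applied to the columns \<open>b j\<close> of the left factor, where
  \<open>d j\<close> bounds the degree of \<open>b j\<close> plus one.  If some term of the product has degree above one, the
  terms of maximal degree cancel, because the total is linear.  Comparing coefficients of the words
  that end in a suitable word \<open>ws\<close> expresses the leading form of one of the columns involved as a right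
  combination of the others; subtracting this combination lowers the degree, and the inverse operation
  on the rows \<open>c j\<close> keeps the product.\<close>

lemma degree_reduction:
  fixes b c :: "nat \<Rightarrow> nat \<Rightarrow> 'n::finite ncpoly"
  assumes bd: "\<forall>j<r. \<forall>k<N. \<forall>w. d j \<le> length w \<longrightarrow> cf (b j k) w = 0"
    and lin: "\<forall>k<N. \<forall>l<N. \<forall>w. 2 \<le> length w \<longrightarrow> cf (\<Sum>j<r. b j k * c j l) w = 0"
    and l: "l < N" and bad: "j0 < r" "1 \<le> d j0" "2 < length w0 + d j0" "cf (c j0 l) w0 \<noteq> 0"
  shows "\<exists>b' c' js. js < r \<and> 1 \<le> d js \<and>
      (\<forall>j<r. \<forall>k<N. \<forall>w. (d(js := d js - 1)) j \<le> length w \<longrightarrow> cf (b' j k) w = 0) \<and>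
      (\<forall>k<N. \<forall>l<N. (\<Sum>j<r. b' j k * c' j l) = (\<Sum>j<r. b j k * c j l))"
proof -
  \<comment> \<open>All terms of the product: a column together with a word that occurs in the row opposite to it.\<close>
  define S where "S = (SIGMA j:{j. j < r \<and> 1 \<le> d j}. {w. cf (c j l) w \<noteq> 0})"
  have fS: "finite S" unfolding S_def by (intro finite_SigmaI finite_cf_support) auto
  have neS: "(j0, w0) \<in> S" using bad by (simp add: S_def)
  obtain x0 where x0: "x0 \<in> S" "\<forall>y\<in>S. length (snd y) + d (fst y) \<le> length (snd x0) + d (fst x0)"
    using finite_nonempty_has_max[OF fS, of "\<lambda>y. length (snd y) + d (fst y)"] neS by blast
  define m where "m = length (snd x0) + d (fst x0)"
  \<comment> \<open>Among the terms of maximal degree \<open>m - 1\<close>, a column of largest degree is the one to be reduced: the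
    coefficients of the combination then are forms of degree \<open>d js - d j \<ge> 0\<close>.\<close>
  define S' where "S' = {y \<in> S. length (snd y) + d (fst y) = m}"
  have "finite S'" "x0 \<in> S'" using fS x0 by (auto simp: S'_def m_def)
  then obtain y0 where y0: "y0 \<in> S'" "\<forall>y\<in>S'. d (fst y) \<le> d (fst y0)"
    using finite_nonempty_has_max[of S' "\<lambda>y. d (fst y)"] by blast
  define js ws where "js = fst y0" and "ws = snd y0"
  define \<mu> where "\<mu> = cf (c js l) ws"
  have m3: "3 \<le> m" using x0(2) neS bad(3) unfolding m_def by fastforce
  have js: "js < r" "1 \<le> d js" "\<mu> \<noteq> 0" "length ws + d js = m"
    using y0(1) by (auto simp: S'_def S_def js_def ws_def \<mu>_def)
  have F1: "length w + d j \<le> m" if "j < r" "1 \<le> d j" "cf (c j l) w \<noteq> 0" for j w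
    using x0(2) that unfolding m_def S_def by force
  have F2: "d j \<le> d js" if "j < r" "1 \<le> d j" "cf (c j l) w \<noteq> 0" "length w + d j = m" for j w
    using y0(2) that unfolding S'_def S_def js_def by force
  define ok where "ok j \<longleftrightarrow> j \<noteq> js \<and> 1 \<le> d j \<and> d j \<le> d js" for j
  define \<gamma> :: "nat \<Rightarrow> 'n ncpoly" where
    "\<gamma> j = (if ok j then \<Sum>v\<in>{v. length v = d js - d j}. Poly_Mapping.single (Word v) (cf (c j l) (v @ ws) / \<mu>)
       else 0)" for j
  have fin: "finite {v :: 'n list. length v = n}" for n
    using finite_lists_length_eq[of "UNIV :: 'n set" n] by simp
  have cf\<gamma>: "cf (\<gamma> j) v = (if ok j \<and> length v = d js - d j then cf (c j l) (v @ ws) / \<mu> else 0)" for j v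
    by (simp add: \<gamma>_def cf_sum fin sum.delta)
  have \<gamma>js: "\<gamma> js = 0" by (simp add: \<gamma>_def ok_def)
  define b' where "b' j k = b j k + (if j = js then \<Sum>i<r. b i k * \<gamma> i else 0)" for j k
  define c' where "c' j l' = c j l' - \<gamma> j * c js l'" for j l'
  have prod: "(\<Sum>j<r. b' j k * c' j l') = (\<Sum>j<r. b j k * c j l')" for k l'
  proof -
    have "(\<Sum>j<r. b' j k * c' j l') = (\<Sum>j<r. b j k * c j l' - b j k * \<gamma> j * c js l'
        + (if j = js then (\<Sum>i<r. b i k * \<gamma> i) * c js l' else 0))"
      by (intro sum.cong refl) (auto simp: b'_def c'_def \<gamma>js algebra_simps)
    also have "\<dots> = (\<Sum>j<r. b j k * c j l') - (\<Sum>j<r. b j k * \<gamma> j * c js l') + (\<Sum>i<r. b i k * \<gamma> i) * c js l'"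
      using js(1) by (simp add: sum.distrib sum_subtractf)
    also have "\<dots> = (\<Sum>j<r. b j k * c j l')" by (simp add: sum_distrib_right)
    finally show ?thesis .
  qed
  have cf_b\<gamma>: "cf (b i k * \<gamma> i) x =
      (if ok i \<and> length x = d js - 1 then cf (b i k) (take (d i - 1) x) * cf (c i l) (drop (d i - 1) x @ ws) / \<mu> else 0)"
    if i: "i < r" and k: "k < N" and x: "d js - 1 \<le> length x" for i k x
  proof (cases "ok i")
    case True
    have "cf (b i k * \<gamma> i) x = (\<Sum>h\<le>length x. if h = d i - 1 \<and> length x = d js - 1
        then cf (b i k) (take (d i - 1) x) * cf (c i l) (drop (d i - 1) x @ ws) / \<mu> else 0)"
      unfolding cf_mult
    proof (intro sum.cong refl)
      fix h assume h: "h \<in> {..length x}"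
      show "cf (b i k) (take h x) * cf (\<gamma> i) (drop h x) = (if h = d i - 1 \<and> length x = d js - 1
        then cf (b i k) (take (d i - 1) x) * cf (c i l) (drop (d i - 1) x @ ws) / \<mu> else 0)"
      proof (cases "d i \<le> h")
        case True
        then have "cf (b i k) (take h x) = 0" using bd i k h by simp
        moreover have "h \<noteq> d i - 1" using True \<open>ok i\<close> by (auto simp: ok_def)
        ultimately show ?thesis by simp
      next
        case False
        have "length (drop h x) = d js - d i \<longleftrightarrow> h = d i - 1 \<and> length x = d js - 1"
          using False \<open>ok i\<close> x h by (auto simp: ok_def)
        then show ?thesis using \<open>ok i\<close> by (auto simp: cf\<gamma>)
      qed
    qed
    also have "\<dots> = (if length x = d js - 1
        then cf (b i k) (take (d i - 1) x) * cf (c i l) (drop (d i - 1) x @ ws) / \<mu> else 0)"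
      using True by (auto simp: ok_def)
    finally show ?thesis using True by simp
  qed (simp add: \<gamma>_def)
  have zero: "cf (b' js k) x = 0" if k: "k < N" and x: "d js - 1 \<le> length x" for k x
  proof (cases "length x = d js - 1")
    case False
    then have "cf (b js k) x = 0" using bd js(1) k x by simp
    then show ?thesis using False k x by (simp add: b'_def cf_sum cf_b\<gamma>)
  next
    case True
    let ?t = "\<lambda>j. cf (b j k) (take (d j - 1) x) * cf (c j l) (drop (d j - 1) x @ ws)"
    have len: "length (x @ ws) = m - 1" using True js(2,4) by simp
    have coef: "cf (b j k * c j l) (x @ ws) = (if ok j \<or> j = js then ?t j else 0)" if j: "j < r" for j
    proof -
      have "cf (b j k * c j l) (x @ ws) = (\<Sum>h\<le>length (x @ ws). if h = d j - 1 \<and> (ok j \<or> j = js) then ?t j else 0)"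
        unfolding cf_mult
      proof (intro sum.cong refl)
        fix h assume h: "h \<in> {..length (x @ ws)}"
        show "cf (b j k) (take h (x @ ws)) * cf (c j l) (drop h (x @ ws))
            = (if h = d j - 1 \<and> (ok j \<or> j = js) then ?t j else 0)"
        proof (cases "h = d j - 1 \<and> (ok j \<or> j = js)")
          case t: True
          then have "h \<le> length x" using True by (auto simp: ok_def)
          then show ?thesis using t by simp
        next
          case f: False
          show ?thesis
          proof (rule ccontr)
            assume "\<not> ?thesis"
            then have nz: "cf (b j k) (take h (x @ ws)) \<noteq> 0" "cf (c j l) (drop h (x @ ws)) \<noteq> 0"
              using f by auto
            have "length (take h (x @ ws)) = h" using h by simp
            then have hd: "h < d j" using nz(1) bd j k by (metis not_le)
            have ld: "length (drop h (x @ ws)) = m - 1 - h" using len by simp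
            have d1: "1 \<le> d j" using hd by simp
            have "m - 1 - h + d j \<le> m" using F1[OF j d1 nz(2)] ld by simp
            then have he: "h = d j - 1" using hd h len by auto
            have "h \<le> m - 1" using h len by simp
            then have "length (drop h (x @ ws)) + d j = m" unfolding ld using he hd m3 by arith
            then have "d j \<le> d js" using F2[OF j d1 nz(2)] by simp
            then show False using f he d1 by (auto simp: ok_def)
          qed
        qed
      qed
      also have "\<dots> = (if ok j \<or> j = js then ?t j else 0)"
        using True js(2) len by (auto simp: ok_def)
      finally show ?thesis .
    qed
    have "2 \<le> length (x @ ws)" using len m3 by linarith
    then have "cf (\<Sum>j<r. b j k * c j l) (x @ ws) = 0" using lin k l by blast
    then have "0 = (\<Sum>j<r. if ok j \<or> j = js then ?t j else 0)" by (simp add: cf_sum coef)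
    also have "\<dots> = (\<Sum>j<r. (if ok j then ?t j else 0) + (if j = js then ?t js else 0))"
      by (intro sum.cong refl) (auto simp: ok_def)
    also have "\<dots> = (\<Sum>j<r. if ok j then ?t j else 0) + cf (b js k) x * \<mu>"
      using js(1) True by (simp add: sum.distrib \<mu>_def)
    finally have rel: "cf (b js k) x * \<mu> = - (\<Sum>j<r. if ok j then ?t j else 0)"
      by (simp add: eq_neg_iff_add_eq_0 add.commute)
    have "cf (b' js k) x = cf (b js k) x + (\<Sum>j<r. if ok j then ?t j / \<mu> else 0)"
      using k x True by (simp add: b'_def cf_sum cf_b\<gamma>)
    also have "(\<Sum>j<r. if ok j then ?t j / \<mu> else 0) = (\<Sum>j<r. if ok j then ?t j else 0) / \<mu>"
      unfolding sum_divide_distrib by (intro sum.cong) auto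
    also have "cf (b js k) x + \<dots> = (cf (b js k) x * \<mu> + (\<Sum>j<r. if ok j then ?t j else 0)) / \<mu>"
      using js(3) by (simp add: field_simps)
    also have "\<dots> = 0" unfolding rel by simp
    finally show ?thesis .
  qed
  have "\<forall>j<r. \<forall>k<N. \<forall>w. (d(js := d js - 1)) j \<le> length w \<longrightarrow> cf (b' j k) w = 0"
    using zero bd by (auto simp: b'_def)
  then show ?thesis using js(1,2) prod by blast
qed

text \<open>The degree reduction terminates because each application lowers the total of the degree bounds.\<close>

lemma degree_reduced_factorization:
  fixes b c :: "nat \<Rightarrow> nat \<Rightarrow> 'n::finite ncpoly"
  assumes "\<forall>j<r. \<forall>k<N. \<forall>w. d j \<le> length w \<longrightarrow> cf (b j k) w = 0"
    and "\<forall>k<N. \<forall>l<N. \<forall>w. 2 \<le> length w \<longrightarrow> cf (\<Sum>j<r. b j k * c j l) w = 0"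
  shows "\<exists>b' c' d'. (\<forall>j<r. \<forall>k<N. \<forall>w. d' j \<le> length w \<longrightarrow> cf (b' j k) w = 0) \<and>
      (\<forall>k<N. \<forall>l<N. (\<Sum>j<r. b' j k * c' j l) = (\<Sum>j<r. b j k * c j l)) \<and>
      (\<forall>j<r. \<forall>l<N. \<forall>w. 1 \<le> d' j \<longrightarrow> 2 < length w + d' j \<longrightarrow> cf (c' j l) w = 0)"
  using assms
proof (induction "\<Sum>j<r. d j" arbitrary: b c d rule: less_induct)
  case less
  show ?case
  proof (cases "\<forall>j<r. \<forall>l<N. \<forall>w. 1 \<le> d j \<longrightarrow> 2 < length w + d j \<longrightarrow> cf (c j l) w = 0")
    case True
    then show ?thesis using less.prems(1) by (intro exI[of _ b] exI[of _ c] exI[of _ d] conjI) simp_all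
  next
    case False
    then obtain j0 l w0 where bad: "l < N" "j0 < r" "1 \<le> d j0" "2 < length w0 + d j0" "cf (c j0 l) w0 \<noteq> 0"
      by blast
    obtain b' c' js where n: "js < r" "1 \<le> d js"
        "\<forall>j<r. \<forall>k<N. \<forall>w. (d(js := d js - 1)) j \<le> length w \<longrightarrow> cf (b' j k) w = 0"
        "\<forall>k<N. \<forall>l<N. (\<Sum>j<r. b' j k * c' j l) = (\<Sum>j<r. b j k * c j l)"
      using degree_reduction[OF less.prems bad] by (elim exE conjE)
    have lt: "(\<Sum>j<r. (d(js := d js - 1)) j) < (\<Sum>j<r. d j)"
      by (rule sum_strict_mono_ex1) (use n(1,2) in auto)
    have lin': "\<forall>k<N. \<forall>l<N. \<forall>w. 2 \<le> length w \<longrightarrow> cf (\<Sum>j<r. b' j k * c' j l) w = 0"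
      using n(4) less.prems(2) by simp
    show ?thesis using less.hyps[OF lt n(3) lin'] n(4) by simp
  qed
qed

definition lin :: "'n::finite option pencil \<Rightarrow> nat \<Rightarrow> nat \<Rightarrow> 'n ncpoly" where
  "lin A k l = nc_const (A None k l) + (\<Sum>i\<in>UNIV. nc_const (A (Some i) k l) * nc_var i)"

lemma nc_const_var: "nc_const a * nc_var i = Poly_Mapping.single (Word [i]) a"
  by (simp add: nc_const_def nc_var_def mult_single)

lemma nc_const_Word: "nc_const a = Poly_Mapping.single (Word []) a"
  by (simp add: nc_const_def zero_free_word_def)

lemma cf_lin: "cf (lin A k l) w = (case w of [] \<Rightarrow> A None k l | [i] \<Rightarrow> A (Some i) k l | _ \<Rightarrow> 0)"
proof -
  have "cf (lin A k l) w = (if [] = w then A None k l else 0) + (\<Sum>i\<in>UNIV. if [i] = w then A (Some i) k l else 0)"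
    unfolding lin_def nc_const_var by (simp add: nc_const_Word cf_sum)
  also have "\<dots> = (case w of [] \<Rightarrow> A None k l | [i] \<Rightarrow> A (Some i) k l | _ \<Rightarrow> 0)"
    by (auto split: list.splits)
  finally show ?thesis .
qed

lemma cf_nc_const_mult: "cf (nc_const a * p) w = a * cf p w" "cf (p * nc_const a) w = cf p w * a"
proof -
  have "cf (nc_const a * p) w = (\<Sum>i\<le>length w. if i = 0 then a * cf p w else 0)"
    unfolding cf_mult by (intro sum.cong refl) (auto simp: nc_const_Word)
  then show "cf (nc_const a * p) w = a * cf p w" by simp
  have "cf (p * nc_const a) w = (\<Sum>i\<le>length w. if i = length w then cf p w * a else 0)"
    unfolding cf_mult by (intro sum.cong refl) (auto simp: nc_const_Word)
  then show "cf (p * nc_const a) w = cf p w * a" by simp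
qed

definition factorizes :: "nat \<Rightarrow> nat \<Rightarrow> (nat \<Rightarrow> nat \<Rightarrow> 'n ncpoly) \<Rightarrow> bool" where
  "factorizes N r P \<longleftrightarrow> (\<exists>X Y. \<forall>k<N. \<forall>l<N. P k l = (\<Sum>j<r. X j k * Y j l))"

text \<open>Cohn's theorem for linear matrices.  After the degree reduction, every column of the left factor is
  constant with a linear row opposite to it, or linear with a constant row, or one of the two is zero.
  Comparing coefficients turns this into a factorization over the scalars.\<close>

theorem hollow_if_factorizes:
  fixes A :: "'n::finite option pencil"
  assumes "factorizes N r (lin A)" "r < N"
  shows "hollow N N A"
proof -
  obtain b0 c0 :: "nat \<Rightarrow> nat \<Rightarrow> 'n ncpoly" where bc0: "\<forall>k<N. \<forall>l<N. lin A k l = (\<Sum>j<r. b0 j k * c0 j l)"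
    using assms(1) unfolding factorizes_def by blast
  \<comment> \<open>The degree of a column plus one; the zero word length covers zero columns.\<close>
  define d0 where "d0 j = Suc (Max (insert 0 (\<Union>k<N. length ` {w. cf (b0 j k) w \<noteq> 0})))" for j
  have "cf (b0 j k) w = 0" if "k < N" "d0 j \<le> length w" for j k w
  proof (rule ccontr)
    assume "cf (b0 j k) w \<noteq> 0"
    then have "length w \<le> Max (insert 0 (\<Union>k<N. length ` {w. cf (b0 j k) w \<noteq> 0}))"
      using that(1) by (intro Max_ge) (auto intro: finite_cf_support)
    then show False using that(2) by (simp add: d0_def)
  qed
  moreover have "\<forall>k<N. \<forall>l<N. \<forall>w. 2 \<le> length w \<longrightarrow> cf (\<Sum>j<r. b0 j k * c0 j l) w = 0"
  proof (intro allI impI)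
    fix k l w assume "k < N" "l < N" "2 \<le> length (w :: 'n list)"
    then show "cf (\<Sum>j<r. b0 j k * c0 j l) w = 0"
      using bc0 cf_lin[of A k l w] by (auto split: list.splits)
  qed
  ultimately obtain b c d where b: "\<forall>j<r. \<forall>k<N. \<forall>w. d j \<le> length w \<longrightarrow> cf (b j k) w = 0"
      "\<forall>k<N. \<forall>l<N. (\<Sum>j<r. b j k * c j l) = lin A k l"
      "\<forall>j<r. \<forall>l<N. \<forall>w. 1 \<le> d j \<longrightarrow> 2 < length w + d j \<longrightarrow> cf (c j l) w = 0"
    using degree_reduced_factorization[of r N d0 b0 c0] bc0 by auto
  define wd :: "'n option \<Rightarrow> 'n list" where "wd s = (case s of None \<Rightarrow> [] | Some i \<Rightarrow> [i])" for s
  \<comment> \<open>The constant columns and the linear ones.  Where \<open>d j = 0\<close> the column is zero, and where \<open>d j \<ge> 3\<close> the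
    row opposite to it is.\<close>
  define J1 where "J1 = {j. j < r \<and> d j = 1}"
  define J2 where "J2 = {j. j < r \<and> d j = 2}"
  have J: "finite J1" "finite J2" "J1 \<inter> J2 = {}" "J1 \<union> J2 \<subseteq> {..<r}" by (auto simp: J1_def J2_def)
  have A: "A s k l = (\<Sum>j\<in>J1. cf (b j k) [] * cf (c j l) (wd s)) + (\<Sum>j\<in>J2. cf (b j k) (wd s) * cf (c j l) [])"
    if k: "k < N" and l: "l < N" for s k l
  proof -
    have "A s k l = cf (lin A k l) (wd s)" by (simp add: cf_lin wd_def split: option.split)
    also have "\<dots> = (\<Sum>j<r. cf (b j k * c j l) (wd s))" using b(2) k l by (simp add: cf_sum[symmetric])
    also have "\<dots> = (\<Sum>j<r. (if j \<in> J1 then cf (b j k) [] * cf (c j l) (wd s) else 0)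
        + (if j \<in> J2 then cf (b j k) (wd s) * cf (c j l) [] else 0))"
    proof (intro sum.cong refl)
      fix j assume "j \<in> {..<r}"
      then have j: "j < r" by simp
      have bz: "cf (b j k) w = 0" if "d j \<le> length w" for w using b(1) j k that by blast
      have cz: "cf (c j l) w = 0" if "1 \<le> d j" "2 < length w + d j" for w using b(3) j l that by blast
      consider "d j = 0" | "d j = 1" | "d j = 2" | "3 \<le> d j" by linarith
      then show "cf (b j k * c j l) (wd s) = (if j \<in> J1 then cf (b j k) [] * cf (c j l) (wd s) else 0)
        + (if j \<in> J2 then cf (b j k) (wd s) * cf (c j l) [] else 0)"
        by cases (use j in \<open>auto simp: cf_mult wd_def J1_def J2_def bz cz split: option.split\<close>)
    qed
    also have "\<dots> = (\<Sum>j\<in>J1. cf (b j k) [] * cf (c j l) (wd s)) + (\<Sum>j\<in>J2. cf (b j k) (wd s) * cf (c j l) [])"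
    proof -
      have "{..<r} \<inter> J1 = J1" "{..<r} \<inter> J2 = J2" using J(4) by auto
      then show ?thesis unfolding sum.distrib by (simp add: sum.inter_restrict[symmetric])
    qed
    finally show ?thesis .
  qed
  obtain h1 h2 where h: "bij_betw h1 {0..<card J1} J1" "bij_betw h2 {0..<card J2} J2"
    using ex_bij_betw_nat_finite J(1,2) by blast
  have "card J1 + card J2 = card (J1 \<union> J2)" using J by (simp add: card_Un_disjoint)
  also have "\<dots> \<le> r" using card_mono[OF _ J(4)] by simp
  finally have card: "card J1 + card J2 < N" using assms(2) by simp
  have "A s k l = (\<Sum>a<card J1. cf (b (h1 a) k) [] * cf (c (h1 a) l) (wd s))
      + (\<Sum>a<card J2. cf (b (h2 a) k) (wd s) * cf (c (h2 a) l) [])" if "k < N" "l < N" for s k l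
    unfolding A[OF that] lessThan_atLeast0
    using sum.reindex_bij_betw[OF h(1), of "\<lambda>j. cf (b j k) [] * cf (c j l) (wd s)"]
      sum.reindex_bij_betw[OF h(2), of "\<lambda>j. cf (b j k) (wd s) * cf (c j l) []"] by simp
  then have "\<forall>s k l. k < N \<longrightarrow> l < N \<longrightarrow> A s k l = (\<Sum>a<card J1. (\<lambda>k a. cf (b (h1 a) k) []) k a * (\<lambda>s a l. cf (c (h1 a) l) (wd s)) s a l)
      + (\<Sum>a<card J2. (\<lambda>s k a. cf (b (h2 a) k) (wd s)) s k a * (\<lambda>a l. cf (c (h2 a) l) []) a l)" by blast
  then show ?thesis using card by (rule hollow_if_factorized)
qed

lemma factorizes_col_step:
  fixes A B :: "'n::finite option pencil"
  assumes "col_step N A B" "factorizes N r (lin A)"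
  shows "factorizes N r (lin B)"
proof -
  obtain X Y :: "nat \<Rightarrow> nat \<Rightarrow> 'n ncpoly" where XY: "\<forall>k<N. \<forall>l<N. lin A k l = (\<Sum>j<r. X j k * Y j l)"
    using assms(2) unfolding factorizes_def by blast
  from assms(1) show ?thesis
  proof cases
    case (add j d)
    have "lin B k l = lin A k l + lin A k j * nc_const (d l)" for k l
      by (rule cf_eqI) (simp add: add(1) cf_lin cf_nc_const_mult col_add_def split: list.split)
    then have "\<forall>k<N. \<forall>l<N. lin B k l = (\<Sum>i<r. X i k * (Y i l + Y i j * nc_const (d l)))"
      using XY add(2) by (simp add: sum.distrib sum_distrib_right algebra_simps)
    then show ?thesis unfolding factorizes_def
      by (intro exI[of _ X] exI[of _ "\<lambda>i l. Y i l + Y i j * nc_const (d l)"])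
  next
    case (swap i j)
    have "lin B k l = lin A k (sw i j l)" for k l
      by (simp add: swap(1) lin_def col_swap_def)
    then have "\<forall>k<N. \<forall>l<N. lin B k l = (\<Sum>a<r. X a k * Y a (sw i j l))"
      using XY swap(2,3) by (simp add: sw_less)
    then show ?thesis unfolding factorizes_def by (intro exI[of _ X] exI[of _ "\<lambda>a l. Y a (sw i j l)"])
  qed
qed

lemma factorizes_row_step:
  fixes A B :: "'n::finite option pencil"
  assumes "col_step N (tp A) (tp B)" "factorizes N r (lin A)"
  shows "factorizes N r (lin B)"
proof -
  obtain X Y :: "nat \<Rightarrow> nat \<Rightarrow> 'n ncpoly" where XY: "\<forall>k<N. \<forall>l<N. lin A k l = (\<Sum>j<r. X j k * Y j l)"
    using assms(2) unfolding factorizes_def by blast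
  from assms(1) show ?thesis
  proof cases
    case (add j d)
    have B: "B = tp (col_add j d (tp A))" using arg_cong[OF add(1), of tp] by simp
    have "lin B k l = lin A k l + nc_const (d k) * lin A j l" for k l
      by (rule cf_eqI) (simp add: B cf_lin cf_nc_const_mult col_add_def tp_def split: list.split)
    then have "\<forall>k<N. \<forall>l<N. lin B k l = (\<Sum>i<r. (X i k + nc_const (d k) * X i j) * Y i l)"
      using XY add(2) by (simp add: sum.distrib sum_distrib_left algebra_simps)
    then show ?thesis unfolding factorizes_def
      by (intro exI[of _ "\<lambda>i k. X i k + nc_const (d k) * X i j"] exI[of _ Y])
  next
    case (swap i j)
    have B: "B = tp (col_swap i j (tp A))" using arg_cong[OF swap(1), of tp] by simp
    have "lin B k l = lin A (sw i j k) l" for k l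
      by (simp add: B lin_def col_swap_def tp_def)
    then have "\<forall>k<N. \<forall>l<N. lin B k l = (\<Sum>a<r. X a (sw i j k) * Y a l)"
      using XY swap(2,3) by (simp add: sw_less)
    then show ?thesis unfolding factorizes_def by (intro exI[of _ "\<lambda>a k. X a (sw i j k)"] exI[of _ Y])
  qed
qed

text \<open>A matrix with upper left zero block factors as \<open>(0 Q; R S) = (0 Q; 1 0) (R S; 0 1)\<close>, with inner
  dimension \<open>(N - s) + (N - t) < N\<close>.\<close>

lemma factorizes_if_hollow:
  fixes A :: "'n::finite option pencil"
  assumes "hollow N N A"
  shows "\<exists>r<N. factorizes N r (lin A)"
proof -
  obtain B s t where B: "eqv N N A B" "s \<le> N" "t \<le> N" "N < s + t"
      "\<forall>r k l. k < s \<longrightarrow> l < t \<longrightarrow> B r k l = 0" using assms unfolding hollow_def by blast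
  define r where "r = (N - s) + (N - t)"
  have z: "lin B k l = 0" if "k < s" "l < t" for k l
    by (rule cf_eqI) (use B(5) that in \<open>simp add: cf_lin split: list.split\<close>)
  define X where "X j k = (if j < N - s then (if k = s + j then 1 else 0)
      else if k < s then lin B k (t + (j - (N - s))) else 0)" for j k
  define Y where "Y j l = (if j < N - s then lin B (s + j) l
      else if l = t + (j - (N - s)) then 1 else 0)" for j l
  have "lin B k l = (\<Sum>j<r. X j k * Y j l)" if kl: "k < N" "l < N" for k l
  proof -
    have "(\<Sum>j<r. X j k * Y j l) = (\<Sum>j<N - s. X j k * Y j l) + (\<Sum>j<N - t. X (N - s + j) k * Y (N - s + j) l)"
      using sum_split_lessThan[of "N - s" r] by (simp add: r_def)
    also have "(\<Sum>j<N - s. X j k * Y j l) = (\<Sum>j<N - s. if j = k - s then (if s \<le> k then lin B k l else 0) else 0)"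
      by (intro sum.cong refl) (auto simp: X_def Y_def)
    also have "\<dots> = (if s \<le> k then lin B k l else 0)" using kl by auto
    also have "(\<Sum>j<N - t. X (N - s + j) k * Y (N - s + j) l)
        = (\<Sum>j<N - t. if j = l - t then (if k < s \<and> t \<le> l then lin B k l else 0) else 0)"
      by (intro sum.cong refl) (auto simp: X_def Y_def)
    also have "\<dots> = (if k < s \<and> t \<le> l then lin B k l else 0)" using kl by auto
    finally show ?thesis using z[of k l] by auto
  qed
  then have fB: "factorizes N r (lin B)" unfolding factorizes_def by (intro exI[of _ X] exI[of _ Y]) simp
  have "factorizes N r (lin B) \<longrightarrow> factorizes N r (lin A)"
    using B(1)
  proof (induction rule: eqv_induct)
    case (col C D) then show ?case using factorizes_col_step[OF col_step_sym] by blast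
  next
    case (row C D) then show ?case using factorizes_row_step[OF col_step_sym] by blast
  qed simp
  then show ?thesis using fB B(2-4) by (intro exI[of _ r]) (auto simp: r_def)
qed

definition lin_mat :: "nat \<Rightarrow> 'n::finite option pencil \<Rightarrow> 'n ncpoly mat" where
  "lin_mat N A = Matrix.mat N N (\<lambda>(k, l). lin A k l)"

lemma lin_mat_index: "k < N \<Longrightarrow> l < N \<Longrightarrow> lin_mat N A $$ (k, l) = lin A k l"
  by (simp add: lin_mat_def)

lemma linear_nc_mat_iff: "linear_nc_mat N P \<longleftrightarrow> (\<exists>A. P = lin_mat N A)"
proof
  assume "linear_nc_mat N P"
  then obtain A0 A1 where P: "P = Matrix.mat N N (\<lambda>(k, l). nc_const (A0 $$ (k, l)) + (\<Sum>i\<in>UNIV. nc_const (A1 i $$ (k, l)) * nc_var i))"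
    unfolding linear_nc_mat_def by blast
  define A where "A s k l = (case s of None \<Rightarrow> A0 $$ (k, l) | Some i \<Rightarrow> A1 i $$ (k, l))" for s k l
  have "P = lin_mat N A" unfolding P lin_mat_def lin_def A_def by simp
  then show "\<exists>A. P = lin_mat N A" by blast
next
  assume "\<exists>A. P = lin_mat N A"
  then obtain A where "P = lin_mat N A" by blast
  then show "linear_nc_mat N P"
    unfolding linear_nc_mat_def
    by (intro exI[of _ "Matrix.mat N N (\<lambda>(k, l). A None k l)"] exI[of _ "\<lambda>i. Matrix.mat N N (\<lambda>(k, l). A (Some i) k l)"])
      (auto simp: lin_mat_def lin_def intro!: eq_matI)
qed

lemma lin_mat_eq_0_iff: "lin_mat N A = 0\<^sub>m N N \<longleftrightarrow> (\<forall>s k l. k < N \<longrightarrow> l < N \<longrightarrow> A s k l = 0)"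
proof
  assume z0: "lin_mat N A = 0\<^sub>m N N"
  have z: "lin A k l = 0" if "k < N" "l < N" for k l
    using lin_mat_index[OF that, of A] that unfolding z0 by simp
  have "A s k l = cf (lin A k l) (case s of None \<Rightarrow> [] | Some i \<Rightarrow> [i])" for s k l
    by (simp add: cf_lin split: option.split)
  then show "\<forall>s k l. k < N \<longrightarrow> l < N \<longrightarrow> A s k l = 0" using z by simp
next
  assume A: "\<forall>s k l. k < N \<longrightarrow> l < N \<longrightarrow> A s k l = 0"
  have "lin A k l = 0" if "k < N" "l < N" for k l
    by (rule cf_eqI) (use A that in \<open>simp add: cf_lin split: list.split\<close>)
  then show "lin_mat N A = 0\<^sub>m N N" by (intro eq_matI) (auto simp: lin_mat_def)
qed

text \<open>For \<open>N > 0\<close> the zero matrix is itself an oversized zero block; for \<open>N = 0\<close> it is the only matrix.\<close>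

theorem full_lin_mat_iff: "full_mat N (lin_mat N A) \<longleftrightarrow> 0 < N \<and> \<not> hollow N N A"
proof -
  have fac: "(\<exists>B\<in>carrier_mat N r. \<exists>C\<in>carrier_mat r N. lin_mat N A = B * C) \<longleftrightarrow> factorizes N r (lin A)" for r
  proof
    assume "\<exists>B\<in>carrier_mat N r. \<exists>C\<in>carrier_mat r N. lin_mat N A = B * C"
    then obtain B C where BC: "B \<in> carrier_mat N r" "C \<in> carrier_mat r N" "lin_mat N A = B * C" by blast
    have "lin A k l = (\<Sum>j<r. B $$ (k, j) * C $$ (j, l))" if "k < N" "l < N" for k l
      using lin_mat_index[OF that, of A] BC(1,2) that unfolding BC(3)
      by (simp add: scalar_prod_def lessThan_atLeast0)
    then show "factorizes N r (lin A)"
      unfolding factorizes_def by (intro exI[of _ "\<lambda>j k. B $$ (k, j)"] exI[of _ "\<lambda>j l. C $$ (j, l)"]) simp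
  next
    assume "factorizes N r (lin A)"
    then obtain X Y where XY: "\<forall>k<N. \<forall>l<N. lin A k l = (\<Sum>j<r. X j k * Y j l)"
      unfolding factorizes_def by blast
    have "lin_mat N A = Matrix.mat N r (\<lambda>(k, j). X j k) * Matrix.mat r N (\<lambda>(j, l). Y j l)"
      by (rule eq_matI) (use XY in \<open>simp_all add: lin_mat_def scalar_prod_def lessThan_atLeast0\<close>)
    then show "\<exists>B\<in>carrier_mat N r. \<exists>C\<in>carrier_mat r N. lin_mat N A = B * C"
      by (intro bexI[of _ "Matrix.mat N r (\<lambda>(k, j). X j k)"] bexI[of _ "Matrix.mat r N (\<lambda>(j, l). Y j l)"]) auto
  qed
  have "hollow N N A" if "0 < N" "lin_mat N A = 0\<^sub>m N N"
    using that unfolding hollow_def lin_mat_eq_0_iff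
    by (intro exI[of _ A] exI[of _ N]) auto
  moreover have "lin_mat N A = 0\<^sub>m N N" if "N = 0" using that by (intro eq_matI) (auto simp: lin_mat_def)
  moreover have "lin_mat N A \<in> carrier_mat N N" by (simp add: lin_mat_def)
  ultimately show ?thesis
    unfolding full_mat_def fac using hollow_if_factorizes factorizes_if_hollow by blast
qed

section \<open>Finite rank relations and kernels of pencils\<close>

definition rel_tuples :: "('n::finite \<Rightarrow> 'h \<Rightarrow> 'h) \<Rightarrow> ('n \<Rightarrow> 'h::complex_hilbert \<Rightarrow> 'h) set" where
  "rel_tuples Z = {T. (\<forall>j. finite_rank (T j)) \<and> (\<forall>v. (\<Sum>j\<in>UNIV. commutator (T j) (Z j) v) = 0)}"

text \<open>The constant term of a linear pencil is evaluated at the identity.\<close>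

definition augment :: "('n \<Rightarrow> 'h \<Rightarrow> 'h) \<Rightarrow> 'n option \<Rightarrow> 'h \<Rightarrow> 'h" where
  "augment Z r = (case r of None \<Rightarrow> (\<lambda>x. x) | Some j \<Rightarrow> Z j)"

lemma sum_option: "(\<Sum>r\<in>UNIV. g r) = g None + (\<Sum>j\<in>UNIV. g (Some j))"
  for g :: "'n::finite option \<Rightarrow> 'a::comm_monoid_add"
  unfolding UNIV_option_conv by (subst sum.insert) (auto simp: sum.reindex)

lemma augment_simps [simp]: "augment Z None = (\<lambda>x. x)" "augment Z (Some j) = Z j"
  by (simp_all add: augment_def)

lemma finite_rank_bounded: "finite_rank T \<Longrightarrow> bounded_clinear T"
  by (simp add: finite_rank_def)

lemma finite_rank_add:
  assumes "finite_rank S" "finite_rank T"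
  shows "finite_rank (\<lambda>v. S v + T v)"
proof -
  obtain B C where B: "finite B" "range S \<subseteq> complex_vector.span B" "bounded_clinear S"
    and C: "finite C" "range T \<subseteq> complex_vector.span C" "bounded_clinear T"
    using assms unfolding finite_rank_def by blast
  have "S v + T v \<in> complex_vector.span (B \<union> C)" for v
  proof (rule complex_vector.span_add)
    show "S v \<in> complex_vector.span (B \<union> C)"
      using B(2) complex_vector.span_mono[of B "B \<union> C"] by auto
    show "T v \<in> complex_vector.span (B \<union> C)"
      using C(2) complex_vector.span_mono[of C "B \<union> C"] by auto
  qed
  then show ?thesis
    unfolding finite_rank_def using bounded_clinear_add[OF B(3) C(3)] B(1) C(1)
    by (intro conjI exI[of _ "B \<union> C"]) auto
qed

lemma finite_rank_scale:
  assumes "finite_rank T"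
  shows "finite_rank (\<lambda>v. c *\<^sub>C T v)"
proof -
  obtain C where C: "finite C" "range T \<subseteq> complex_vector.span C" "bounded_clinear T"
    using assms unfolding finite_rank_def by blast
  then have "range (\<lambda>v. c *\<^sub>C T v) \<subseteq> complex_vector.span C"
    by (auto intro: complex_vector.span_scale)
  then show ?thesis unfolding finite_rank_def using bounded_clinear_scale[OF C(3)] C(1) by blast
qed

text \<open>The rank one terms \<open>\<langle>-, h\<rangle> f\<close> become \<open>\<langle>-, b* h\<rangle> a f\<close>.\<close>

lemma finite_rank_sandwich:
  fixes T a b :: "'h::complex_hilbert \<Rightarrow> 'h"
  assumes T: "finite_rank T" and a: "bounded_clinear a" and b: "bounded_clinear b"
  shows "finite_rank (\<lambda>v. a (T (b v)))"
proof -
  obtain F where F: "finite F" "\<And>v. T v = (\<Sum>f\<in>F. cinner v (cadj T f) *\<^sub>C f)"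
    using finite_rank_representation[OF T] by blast
  have "(\<lambda>v. a (T (b v))) = (\<lambda>v. \<Sum>f\<in>F. cinner v (cadj b (cadj T f)) *\<^sub>C a f)"
    by (rule ext) (subst F(2), simp add: bounded_clinear_simps[OF a] cadj_works[OF b])
  then show ?thesis using finite_rank_rank_one_sum[OF F(1)] by simp
qed

lemma rel_tuples_zero: "(\<lambda>j v. 0) \<in> rel_tuples Z" if "\<And>j. bounded_clinear (Z j)"
  using that
  by (auto simp: rel_tuples_def commutator_def finite_rank_def bounded_clinear_simps(3)
      intro!: exI[of _ "{}"])

lemma rel_tuples_add:
  assumes Z: "\<And>j. bounded_clinear (Z j)" and S: "S \<in> rel_tuples Z" and T: "T \<in> rel_tuples Z"
  shows "(\<lambda>j v. S j v + T j v) \<in> rel_tuples Z"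
proof -
  have "commutator (\<lambda>v. S j v + T j v) (Z j) v = commutator (S j) (Z j) v + commutator (T j) (Z j) v" for j v
    by (simp add: commutator_def bounded_clinear_simps[OF Z])
  then show ?thesis
    using S T finite_rank_add[of "S _" "T _"] unfolding rel_tuples_def
    by (auto simp: sum.distrib simp del: add.commute intro: finite_rank_add)
qed

lemma rel_tuples_scale:
  assumes Z: "\<And>j. bounded_clinear (Z j)" and T: "T \<in> rel_tuples Z"
  shows "(\<lambda>j v. c *\<^sub>C T j v) \<in> rel_tuples Z"
proof -
  have "commutator (\<lambda>v. c *\<^sub>C T j v) (Z j) v = c *\<^sub>C commutator (T j) (Z j) v" for j v
    by (simp add: commutator_def bounded_clinear_simps[OF Z] scaleC_diff_right)
  then show ?thesis
    using T unfolding rel_tuples_def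
    by (auto simp: scaleC_sum_right[symmetric] intro: finite_rank_scale)
qed

text \<open>Kernel vectors \<open>f\<close> of \<open>A(Z)\<close> and \<open>e\<close> of \<open>A(Z)*\<close> produce the relation with entries
  \<open>\<Sum>\<^sub>k\<^sub>l A\<^sub>k\<^sub>l \<langle>-, e\<^sub>k\<rangle> f\<^sub>l\<close>: the equation for \<open>f\<close> kills \<open>\<Sum> Z T\<close>, the equation for \<open>e\<close> kills \<open>\<Sum> T Z\<close>.\<close>

lemma relation_of_kernels:
  fixes Z :: "'n::finite \<Rightarrow> 'h \<Rightarrow> 'h::complex_hilbert"
  assumes Z: "\<And>j. bounded_clinear (Z j)"
    and FR: "rel_tuples Z \<subseteq> {\<lambda>j v. 0}"
    and f: "f \<in> pker p q A (augment Z)" and e: "e \<in> pker q p (dag A) (\<lambda>r. cadj (augment Z r))"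
  shows "(\<Sum>k<p. \<Sum>l<q. (A r k l * cinner v (e k)) *\<^sub>C f l) = 0"
proof -
  \<comment> \<open>The entry \<open>G None\<close> belongs to the constant term and commutes with the identity, so it is no part of the
    relation; it vanishes together with the other entries by the equation for \<open>f\<close>.\<close>
  define G where "G r v = (\<Sum>k<p. \<Sum>l<q. (A r k l * cinner v (e k)) *\<^sub>C f l)" for r v
  have aZ: "bounded_clinear (augment Z r)" for r using Z by (cases r) simp_all
  have finG: "finite_rank (G r)" for r
  proof -
    have "G r = (\<lambda>v. \<Sum>x\<in>{..<p} \<times> {..<q}. cinner v (e (fst x)) *\<^sub>C (A r (fst x) (snd x) *\<^sub>C f (snd x)))"
      by (auto simp: G_def sum.cartesian_product scaleC_scaleC mult.commute split_def)
    then show ?thesis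
      using finite_rank_rank_one_sum[of "{..<p} \<times> {..<q}" "\<lambda>x. e (fst x)"
          "\<lambda>x. A r (fst x) (snd x) *\<^sub>C f (snd x)"] by simp
  qed
  have left: "(\<Sum>r\<in>UNIV. augment Z r (G r v)) = 0" for v
  proof -
    have "(\<Sum>r\<in>UNIV. augment Z r (G r v))
        = (\<Sum>r\<in>UNIV. \<Sum>k<p. \<Sum>l<q. cinner v (e k) *\<^sub>C (A r k l *\<^sub>C augment Z r (f l)))"
      by (simp add: G_def bounded_clinear_simps[OF aZ] scaleC_scaleC mult.commute)
    also have "\<dots> = (\<Sum>k<p. \<Sum>r\<in>UNIV. \<Sum>l<q. cinner v (e k) *\<^sub>C (A r k l *\<^sub>C augment Z r (f l)))"
      by (rule sum.swap)
    also have "\<dots> = (\<Sum>k<p. \<Sum>l<q. \<Sum>r\<in>UNIV. cinner v (e k) *\<^sub>C (A r k l *\<^sub>C augment Z r (f l)))"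
      by (rule sum.cong[OF refl], rule sum.swap)
    also have "\<dots> = (\<Sum>k<p. cinner v (e k) *\<^sub>C (\<Sum>l<q. \<Sum>r\<in>UNIV. A r k l *\<^sub>C augment Z r (f l)))"
      by (simp only: scaleC_sum_right)
    also have "\<dots> = 0" using f by (intro sum.neutral) (simp add: pker_def)
    finally show ?thesis .
  qed
  have right: "(\<Sum>r\<in>UNIV. G r (augment Z r v)) = 0" for v
  proof -
    have "(\<Sum>r\<in>UNIV. G r (augment Z r v))
        = (\<Sum>r\<in>UNIV. \<Sum>l<q. \<Sum>k<p. cinner v (cnj (A r k l) *\<^sub>C cadj (augment Z r) (e k)) *\<^sub>C f l)"
      unfolding G_def
      by (rule sum.cong[OF refl], subst sum.swap)
        (simp add: cadj_works[OF aZ] cinner_scaleC_right)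
    also have "\<dots> = (\<Sum>l<q. \<Sum>r\<in>UNIV. \<Sum>k<p. cinner v (cnj (A r k l) *\<^sub>C cadj (augment Z r) (e k)) *\<^sub>C f l)"
      by (rule sum.swap)
    also have "\<dots> = (\<Sum>l<q. \<Sum>k<p. \<Sum>r\<in>UNIV. cinner v (cnj (A r k l) *\<^sub>C cadj (augment Z r) (e k)) *\<^sub>C f l)"
      by (rule sum.cong[OF refl], rule sum.swap)
    also have "\<dots> = (\<Sum>l<q. cinner v (\<Sum>k<p. \<Sum>r\<in>UNIV. dag A r l k *\<^sub>C cadj (augment Z r) (e k)) *\<^sub>C f l)"
      by (simp only: scaleC_sum_left cinner_sum_right dag_def)
    also have "\<dots> = 0" using e by (intro sum.neutral) (simp add: pker_def)
    finally show ?thesis .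
  qed
  have "(\<Sum>r\<in>UNIV. commutator (G r) (augment Z r) v) = 0" for v
    using left[of v] right[of v] by (simp add: commutator_def sum_subtractf)
  then have "(\<lambda>j. G (Some j)) \<in> rel_tuples Z"
    using finG by (simp add: rel_tuples_def sum_option commutator_def)
  then have GS: "(\<lambda>j. G (Some j)) = (\<lambda>j v. 0)" using FR by blast
  have "G r v = 0" for r v
  proof (cases r)
    case None
    then show ?thesis using left[of v] fun_cong[OF fun_cong[OF GS]]
      by (simp add: sum_option bounded_clinear_simps(3)[OF Z])
  next
    case (Some j) then show ?thesis using fun_cong[OF fun_cong[OF GS], of j v] by simp
  qed
  then show ?thesis by (simp add: G_def)
qed

text \<open>Take an orthonormal basis \<open>g\<close> of a finite-dimensional space that contains the ranges of all \<open>T\<^sub>j\<close> and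
  \<open>T\<^sub>j*\<close>.  The matrices of the \<open>T\<^sub>j\<close> with constant term the matrix of \<open>-\<Sum> Z\<^sub>j T\<^sub>j\<close> form a pencil with \<open>g\<close> in both
  kernels: the relation \<open>\<Sum> Z\<^sub>j T\<^sub>j = \<Sum> T\<^sub>j Z\<^sub>j\<close> ensures that the constant term, too, has range and corange
  in the space.\<close>

lemma relations_trivial_if_indep_kernels:
  fixes Z :: "'n::finite \<Rightarrow> 'h \<Rightarrow> 'h::complex_hilbert"
  assumes Z: "\<And>j. bounded_clinear (Z j)"
    and ii: "\<And>N A f e. f \<in> pker N N A (augment Z) \<Longrightarrow> e \<in> pker N N (dag A) (\<lambda>r. cadj (augment Z r)) \<Longrightarrow>
      indep N f \<Longrightarrow> indep N e \<Longrightarrow> \<forall>r k l. k < N \<longrightarrow> l < N \<longrightarrow> A r k l = 0"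
  shows "rel_tuples Z \<subseteq> {\<lambda>j v. 0}"
proof
  fix T assume T: "T \<in> rel_tuples Z"
  have fr: "finite_rank (T j)" for j using T by (simp add: rel_tuples_def)
  have bT: "bounded_clinear (T j)" for j using finite_rank_bounded[OF fr] .
  have bZs: "bounded_clinear (cadj (Z j))" for j using bounded_clinear_cadj[OF Z] .
  have "\<forall>j. \<exists>F. finite F \<and> (\<forall>v. T j v = (\<Sum>f\<in>F. cinner v (cadj (T j) f) *\<^sub>C f))"
    using finite_rank_representation[OF fr] by blast
  then obtain F where F: "\<And>j. finite (F j)" "\<And>j v. T j v = (\<Sum>f\<in>F j. cinner v (cadj (T j) f) *\<^sub>C f)"
    by metis
  define B where "B = (\<Union>j\<in>UNIV. F j \<union> cadj (T j) ` F j)"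
  have "finite B" unfolding B_def using F(1) by auto
  then obtain G where G: "finite G" "orthonormal G" "B \<subseteq> complex_vector.span G"
    using finite_orthonormal_spanning by blast
  have Ts: "cadj (T j) w = (\<Sum>f\<in>F j. cinner w f *\<^sub>C cadj (T j) f)" for j w
  proof (rule cinner_eqI_right)
    fix z
    have "cinner z (cadj (T j) w) = cinner (T j z) w" by (rule cadj_works[OF bT, symmetric])
    also have "\<dots> = cinner (\<Sum>f\<in>F j. cinner z (cadj (T j) f) *\<^sub>C f) w" by (subst F(2)) (rule refl)
    also have "\<dots> = (\<Sum>f\<in>F j. cinner z (cadj (T j) f) * cnj (cinner w f))"
      unfolding cinner_sum_left cinner_scaleC_left
      by (intro sum.cong refl arg_cong2[where f = "(*)"] cinner_commute)
    also have "\<dots> = cinner z (\<Sum>f\<in>F j. cinner w f *\<^sub>C cadj (T j) f)"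
      by (simp add: cinner_sum_right cinner_scaleC_right mult.commute)
    finally show "cinner z (cadj (T j) w) = cinner z (\<Sum>f\<in>F j. cinner w f *\<^sub>C cadj (T j) f)" .
  qed
  have spT: "T j v \<in> complex_vector.span G" for j v
    by (subst F(2), intro complex_vector.span_sum complex_vector.span_scale)
      (use G(3) in \<open>auto simp: B_def\<close>)
  have spTs: "cadj (T j) v \<in> complex_vector.span G" for j v
    by (subst Ts, intro complex_vector.span_sum complex_vector.span_scale)
      (use G(3) in \<open>auto simp: B_def\<close>)
  obtain g where g: "bij_betw g {0..<card G} G" using ex_bij_betw_nat_finite[OF G(1)] by blast
  define N where "N = card G"
  have expand: "(\<Sum>l<N. cinner x (g l) *\<^sub>C g l) = x" if "x \<in> complex_vector.span G" for x
    using orthonormal_span_expansion[OF G(1,2) that] sum.reindex_bij_betw[OF g, of "\<lambda>f. cinner x f *\<^sub>C f"]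
    by (simp add: N_def lessThan_atLeast0)
  have gi: "cinner (g k) (g l) = (if k = l then 1 else 0)" if "k < N" "l < N" for k l
  proof -
    have "g k \<in> G" "g l \<in> G" using g that by (auto simp: N_def bij_betw_def)
    moreover have "g k = g l \<longleftrightarrow> k = l"
      using g that unfolding bij_betw_def N_def by (auto dest: inj_onD)
    ultimately show ?thesis using G(2) unfolding orthonormal_def by auto
  qed
  have ind: "indep N g"
    unfolding indep_def
  proof (intro allI impI)
    fix c l assume c: "(\<Sum>l<N. c l *\<^sub>C g l) = 0" and l: "l < N"
    have "cinner (\<Sum>k<N. c k *\<^sub>C g k) (g l) = (\<Sum>k<N. if k = l then c k else 0)"
      unfolding cinner_sum_left by (intro sum.cong refl) (use gi l in \<open>auto simp: cinner_scaleC_left\<close>)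
    then show "c l = 0" using c l by simp
  qed
  define R where "R v = (\<Sum>j\<in>UNIV. Z j (T j v))" for v
  have R': "R v = (\<Sum>j\<in>UNIV. T j (Z j v))" for v
    using T by (simp add: rel_tuples_def R_def commutator_def sum_subtractf)
  have spR: "R v \<in> complex_vector.span G" for v
    unfolding R' by (intro complex_vector.span_sum spT)
  define Rs where "Rs w = (\<Sum>j\<in>UNIV. cadj (T j) (cadj (Z j) w))" for w
  have Rs: "cinner (R v) w = cinner v (Rs w)" for v w
    by (simp add: R_def Rs_def cinner_sum_left cinner_sum_right cadj_works[OF Z] cadj_works[OF bT])
  have Rs': "Rs w = (\<Sum>j\<in>UNIV. cadj (Z j) (cadj (T j) w))" for w
    by (rule cinner_eqI_right)
      (simp only: Rs[symmetric] R' cinner_sum_left cinner_sum_right cadj_works[OF Z] cadj_works[OF bT])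
  have spRs: "Rs w \<in> complex_vector.span G" for w
    unfolding Rs_def by (intro complex_vector.span_sum spTs)
  define A where "A r k l = (case r of None \<Rightarrow> - cinner (R (g k)) (g l) | Some j \<Rightarrow> cinner (T j (g k)) (g l))" for r k l
  have "g \<in> pker N N A (augment Z)"
    unfolding pker_def
  proof (intro CollectI allI impI)
    fix k
    have "(\<Sum>l<N. \<Sum>r\<in>UNIV. A r k l *\<^sub>C augment Z r (g l))
        = - (\<Sum>l<N. cinner (R (g k)) (g l) *\<^sub>C g l) + (\<Sum>l<N. \<Sum>j\<in>UNIV. cinner (T j (g k)) (g l) *\<^sub>C Z j (g l))"
      by (simp add: sum_option A_def sum.distrib sum_negf sum_subtractf)
    also have "(\<Sum>l<N. \<Sum>j\<in>UNIV. cinner (T j (g k)) (g l) *\<^sub>C Z j (g l))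
        = (\<Sum>j\<in>UNIV. \<Sum>l<N. cinner (T j (g k)) (g l) *\<^sub>C Z j (g l))" by (rule sum.swap)
    also have "\<dots> = (\<Sum>j\<in>UNIV. Z j (\<Sum>l<N. cinner (T j (g k)) (g l) *\<^sub>C g l))"
      by (simp add: bounded_clinear_simps[OF Z])
    finally show "(\<Sum>l<N. \<Sum>r\<in>UNIV. A r k l *\<^sub>C augment Z r (g l)) = 0"
      by (simp add: expand[OF spT] expand[OF spR] R_def[symmetric])
  qed
  moreover have "g \<in> pker N N (dag A) (\<lambda>r. cadj (augment Z r))"
    unfolding pker_def
  proof (intro CollectI allI impI)
    fix l
    have dA: "dag A None l k = - cinner (Rs (g l)) (g k)" "dag A (Some j) l k = cinner (cadj (T j) (g l)) (g k)" for j k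
      by (simp_all add: dag_def A_def Rs cadj_works[OF bT] flip: cinner_commute)
    have "(\<Sum>k<N. \<Sum>r\<in>UNIV. dag A r l k *\<^sub>C cadj (augment Z r) (g k))
        = - (\<Sum>k<N. cinner (Rs (g l)) (g k) *\<^sub>C g k)
          + (\<Sum>k<N. \<Sum>j\<in>UNIV. cinner (cadj (T j) (g l)) (g k) *\<^sub>C cadj (Z j) (g k))"
      by (simp add: sum_option dA sum.distrib sum_negf sum_subtractf)
    also have "(\<Sum>k<N. \<Sum>j\<in>UNIV. cinner (cadj (T j) (g l)) (g k) *\<^sub>C cadj (Z j) (g k))
        = (\<Sum>j\<in>UNIV. \<Sum>k<N. cinner (cadj (T j) (g l)) (g k) *\<^sub>C cadj (Z j) (g k))" by (rule sum.swap)
    also have "\<dots> = (\<Sum>j\<in>UNIV. cadj (Z j) (\<Sum>k<N. cinner (cadj (T j) (g l)) (g k) *\<^sub>C g k))"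
      by (simp add: bounded_clinear_simps[OF bZs])
    finally show "(\<Sum>k<N. \<Sum>r\<in>UNIV. dag A r l k *\<^sub>C cadj (augment Z r) (g k)) = 0"
      by (simp add: expand[OF spTs] expand[OF spRs] Rs'[symmetric])
  qed
  ultimately have A0: "\<forall>r k l. k < N \<longrightarrow> l < N \<longrightarrow> A r k l = 0" using ind by (intro ii)
  have "T j v = 0" for j v
  proof -
    have "cinner (cadj (T j) (g l)) (g k) = 0" if "k < N" "l < N" for k l
    proof -
      have "cinner (T j (g k)) (g l) = 0" using A0[rule_format, OF that, of "Some j"] by (simp add: A_def)
      then have "cinner (g k) (cadj (T j) (g l)) = 0" by (simp only: cadj_works[OF bT])
      then show ?thesis using cinner_commute[of "cadj (T j) (g l)" "g k"] by simp
    qed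
    then have "cadj (T j) (g l) = 0" if "l < N" for l
      using expand[OF spTs, of j "g l"] that by simp
    then have "cinner (T j v) (g l) = 0" if "l < N" for l using that by (simp add: cadj_works[OF bT])
    then show ?thesis using expand[OF spT, of j v] by simp
  qed
  then show "T \<in> {\<lambda>j v. 0}" by (simp add: fun_eq_iff)
qed

context tracial_operator_algebra
begin

text \<open>Completing a tall matrix by the first \<open>N - t\<close> unit columns to a square one turns finiteness of the
  matrix algebra into a statement about rectangular pencils: the adjoint of the square matrix is
  injective because its kernel consists of those vectors in the kernel of the small adjoint whose first
  \<open>N - t\<close> components vanish.\<close>

lemma trivial_pker_if_adjoint_kernel_small:
  fixes P :: "'r::finite pencil"
  assumes Z: "\<And>r. Z r \<in> A" and t: "t \<le> N"
    and e: "\<And>e k. e \<in> pker t N (dag P) (\<lambda>r. cadj (Z r)) \<Longrightarrow> N - t \<le> k \<Longrightarrow> k < N \<Longrightarrow> e k = 0"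
  shows "trivial_pker N t P Z"
proof -
  define E where "E i j = (\<lambda>x. \<Sum>r\<in>UNIV. P r i j *\<^sub>C Z r x)" for i j
  define C where "C i j = (if j < N - t then (if i = j then (\<lambda>x. x) else (\<lambda>x. 0)) else E i (j - (N - t)))" for i j
  have bZ: "bounded_clinear (Z r)" for r using Z bdd by blast
  have EA: "E i j \<in> A" for i j unfolding E_def by (intro sum scale Z)
  have CA: "C \<in> mats" unfolding mats_def C_def using id zero EA by auto
  have Es: "cadj (E i j) = (\<lambda>x. \<Sum>r\<in>UNIV. cnj (P r i j) *\<^sub>C cadj (Z r) x)" for i j
    unfolding E_def
    by (subst cadj_sum) (auto intro!: bounded_clinear_scale bZ simp: cadj_scale[OF bZ])
  have Cs: "madj C i j = (if i < N - t then (if i = j then (\<lambda>x. x) else (\<lambda>x. 0)) else cadj (E j (i - (N - t))))" for i j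
  proof -
    have "cadj (\<lambda>x. 0 :: 'h) = (\<lambda>x. 0)" by (rule cadj_unique) simp
    then show ?thesis by (auto simp: madj_def C_def)
  qed
  have inj: "\<forall>i<N. u i = 0" if u: "\<forall>i<N. mact N (madj C) u i = 0" for u
  proof -
    have u1: "u i = 0" if "i < N - t" for i
    proof -
      have "mact N (madj C) u i = (\<Sum>j<N. if i = j then u j else 0)"
        unfolding mact_def by (intro sum.cong) (use that in \<open>auto simp: Cs\<close>)
      then show ?thesis using u that by (auto split: if_splits)
    qed
    have "u \<in> pker t N (dag P) (\<lambda>r. cadj (Z r))"
      unfolding pker_def
    proof (intro CollectI allI impI)
      fix l assume l: "l < t"
      have "mact N (madj C) u (N - t + l) = (\<Sum>k<N. \<Sum>r\<in>UNIV. dag P r l k *\<^sub>C cadj (Z r) (u k))"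
        by (simp add: mact_def Cs Es dag_def)
      then show "(\<Sum>k<N. \<Sum>r\<in>UNIV. dag P r l k *\<^sub>C cadj (Z r) (u k)) = 0" using u l t by simp
    qed
    from e[OF this] u1 show ?thesis by (metis not_le)
  qed
  show ?thesis
    unfolding trivial_pker_def
  proof (intro ballI allI impI)
    fix f l assume f: "f \<in> pker N t P Z" and l: "l < t"
    define F where "F j = (if j < N - t then 0 else f (j - (N - t)))" for j
    have FC: "\<forall>i<N. mact N C F i = 0"
    proof (intro allI impI)
      fix i assume i: "i < N"
      have C0: "C i j 0 = 0" for j using bounded_clinear_simps(3)[OF mats_bdd[OF CA]] .
      have "mact N C F i = (\<Sum>j<N - t. C i j (F j)) + (\<Sum>j<N - (N - t). C i (N - t + j) (F (N - t + j)))"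
        unfolding mact_def by (rule sum_split_lessThan) simp
      also have "(\<Sum>j<N - t. C i j (F j)) = 0" by (intro sum.neutral) (auto simp: F_def C0)
      also have "(\<Sum>j<N - (N - t). C i (N - t + j) (F (N - t + j))) = (\<Sum>j<t. E i j (f j))"
      proof -
        have "C i (N - t + j) = E i j" "F (N - t + j) = f j" for j by (simp_all add: C_def F_def)
        then show ?thesis using t by simp
      qed
      finally show "mact N C F i = 0" using f i by (simp add: pker_def E_def)
    qed
    have "F (N - t + l) = 0"
    proof (rule matrix_injective_if_adjoint_injective[of C N F "N - t + l", OF CA _ FC])
      show "N - t + l < N" using l t by simp
      fix u assume "\<forall>i<N. mact N (madj C) u i = 0"
      then show "\<forall>i<N. u i = 0" by (rule inj)
    qed
    then show "f l = 0" by (simp add: F_def)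
  qed
qed

lemma trivial_pker_square_adjoint:
  fixes P :: "'r::finite pencil"
  assumes "\<And>r. Z r \<in> A" "trivial_pker N N (dag P) (\<lambda>r. cadj (Z r))"
  shows "trivial_pker N N P Z"
  using assms(2) by (intro trivial_pker_if_adjoint_kernel_small assms(1)) (auto simp: trivial_pker_def)

text \<open>Restrict the pencil to the \<open>t\<close> columns that its kernel sees and then to the \<open>s\<close> rows that the kernel
  of the adjoint of this restriction sees.  The relation built from these two kernels vanishes, so the
  \<open>s \<times> t\<close> block is zero and \<open>s + t \<le> N\<close>.  Then the kernel of the adjoint is so small that, by finiteness,
  the restricted pencil is injective, whence \<open>t = 0\<close>.\<close>

lemma trivial_pker_if_relations_trivial:
  fixes Z :: "'n::finite \<Rightarrow> 'h \<Rightarrow> 'h"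
  assumes Z: "\<And>j. Z j \<in> A" and FR: "rel_tuples Z \<subseteq> {\<lambda>j v. 0}" and nh: "\<not> hollow N N P"
  shows "trivial_pker N N P (augment Z)"
proof -
  let ?Z = "augment Z" and ?Zs = "\<lambda>r. cadj (augment Z r)"
  have ZA: "?Z r \<in> A" for r using Z id by (cases r) simp_all
  have bZ: "bounded_clinear (Z j)" for j using Z bdd by blast
  have bZ': "\<forall>r. bounded_clinear (?Z r)" using ZA bdd by blast
  then have bZs': "\<forall>r. bounded_clinear (?Zs r)" using bounded_clinear_cadj by blast
  obtain B t where B: "col_eqv N P B" "t \<le> N" "\<forall>f\<in>pker N N B ?Z. \<forall>l<N. t \<le> l \<longrightarrow> f l = 0"
      "\<forall>c. (\<forall>f\<in>pker N N B ?Z. (\<Sum>l<t. c l *\<^sub>C f l) = 0) \<longrightarrow> (\<forall>l<t. c l = 0)"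
    using pker_nondegenerate_form[OF bZ', of N P N] by (elim exE conjE)
  obtain D s where D: "col_eqv N (dag B) D" "s \<le> N" "\<forall>f\<in>pker t N D ?Zs. \<forall>l<N. s \<le> l \<longrightarrow> f l = 0"
      "\<forall>c. (\<forall>f\<in>pker t N D ?Zs. (\<Sum>l<s. c l *\<^sub>C f l) = 0) \<longrightarrow> (\<forall>l<s. c l = 0)"
    using pker_nondegenerate_form[OF bZs', of N "dag B" t] by (elim exE conjE)
  define C where "C = dag D"
  have PC: "eqv N N P C"
    unfolding C_def by (rule eqv_trans[OF col_eqv_eqv[OF B(1)] row_eqv_dag[OF D(1)]])
  have kerC: "pker N t B ?Z = pker N t C ?Z" unfolding C_def by (rule pker_row_eqv_dag[OF D(1)])
  have sub: "pker N N B ?Z \<subseteq> pker N t C ?Z"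
  proof
    fix f assume f: "f \<in> pker N N B ?Z"
    have "f (t + l) = 0" if "l < N - t" for l using B(3) f that by auto
    then have "f \<in> pker N t B ?Z"
      using f bounded_clinear_simps(3)[OF bZ'[rule_format]]
      by (simp add: pker_def sum_split_lessThan[OF B(2)])
    then show "f \<in> pker N t C ?Z" using kerC by simp
  qed
  have nd: "c l = 0" if "\<forall>f\<in>pker N t C ?Z. (\<Sum>l<t. c l *\<^sub>C f l) = 0" "l < t" for c l
    using B(4) sub that by blast
  \<comment> \<open>The scalars can be read off the vanishing relation because neither kernel satisfies a linear
    relation in the coordinates that remain.\<close>
  have block: "C r k l = 0" if k: "k < s" and l: "l < t" for r k l
  proof -
    have "(\<Sum>l<t. C r k l *\<^sub>C f l) = 0" if f: "f \<in> pker N t C ?Z" for f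
    proof -
      have "cinner (\<Sum>l<t. C r k l *\<^sub>C f l) w = 0" for w
      proof -
        define a where "a k = cinner (\<Sum>l<t. C r k l *\<^sub>C f l) w" for k
        have "(\<Sum>k<s. cnj (a k) *\<^sub>C e k) = 0" if e: "e \<in> pker t N D ?Zs" for e
        proof (rule cinner_eqI_right)
          fix v
          have e0: "e (s + i) = 0" if "i < N - s" for i using D(3) e that by auto
          have "e \<in> pker t N (dag C) ?Zs" using e by (simp add: C_def)
          from relation_of_kernels[OF bZ FR f this, of r v]
          have "0 = cinner (\<Sum>k<N. \<Sum>l<t. (C r k l * cinner v (e k)) *\<^sub>C f l) w" by simp
          also have "\<dots> = (\<Sum>k<N. a k * cinner v (e k))"
            by (simp add: a_def cinner_sum_left cinner_scaleC_left sum_distrib_left sum_distrib_right mult_ac)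
          also have "\<dots> = (\<Sum>k<s. a k * cinner v (e k))"
            by (simp add: sum_split_lessThan[OF D(2)] e0)
          also have "\<dots> = cinner v (\<Sum>k<s. cnj (a k) *\<^sub>C e k)"
            by (simp add: cinner_sum_right cinner_scaleC_right)
          finally show "cinner v (\<Sum>k<s. cnj (a k) *\<^sub>C e k) = cinner v 0" by simp
        qed
        then have "cnj (a k) = 0" using D(4)[rule_format, of "\<lambda>k. cnj (a k)"] k by blast
        then show ?thesis by (simp add: a_def)
      qed
      then show ?thesis using cinner_self_eq_0 by blast
    qed
    then show ?thesis using nd[of "\<lambda>l. C r k l"] l by blast
  qed
  have st: "s + t \<le> N"
  proof (rule ccontr)
    assume "\<not> s + t \<le> N"
    then have "hollow N N P"
      unfolding hollow_def using PC D(2) B(2) block by (intro exI[of _ C] exI[of _ s] exI[of _ t]) auto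
    then show False using nh by simp
  qed
  have tr: "trivial_pker N t C ?Z"
  proof (rule trivial_pker_if_adjoint_kernel_small[OF ZA B(2)])
    fix e k assume "e \<in> pker t N (dag C) ?Zs" "N - t \<le> k" "k < N"
    then show "e k = 0" using D(3) st by (simp add: C_def)
  qed
  have "t = 0"
  proof (rule ccontr)
    assume "t \<noteq> 0"
    have "\<forall>f\<in>pker N t C ?Z. (\<Sum>l<t. 1 *\<^sub>C f l) = 0"
      using tr by (auto simp: trivial_pker_def)
    from nd[OF this, of 0] \<open>t \<noteq> 0\<close> show False by simp
  qed
  then have "trivial_pker N N B ?Z" using B(3) by (simp add: trivial_pker_def)
  then show ?thesis by (rule trivial_pker_eqv[OF bZ' col_eqv_eqv[OF B(1)]])
qed

end

section \<open>The equivalence\<close>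

context tracial_L2
begin

lemma tracial_operator_algebra_Lm: "tracial_operator_algebra (Lm ` M) \<xi>"
proof
  show "(\<lambda>x. x) \<in> Lm ` M" using Lm_id by (intro image_eqI[of _ _ id]) simp_all
  show "closure {R \<xi> |R. bounded_clinear R \<and> (\<forall>a\<in>Lm ` M. \<forall>x. R (a x) = a (R x))} = UNIV"
    by (rule right_mult_cyclic)
next
  fix a b c assume "a \<in> Lm ` M"
  then obtain x where x: "x \<in> M" "a = Lm x" by blast
  show "bounded_clinear a" "cadj a \<in> Lm ` M" using x by (auto simp: Lm_cadj)
  show "(\<lambda>x. c *\<^sub>C a x) \<in> Lm ` M"
    using x by (intro image_eqI[of _ _ "\<lambda>y. c *\<^sub>C x y"]) (auto simp: Lm_scale)
  assume "b \<in> Lm ` M"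
  then obtain y where y: "y \<in> M" "b = Lm y" by blast
  show "(\<lambda>x. a x + b x) \<in> Lm ` M"
    using x y by (intro image_eqI[of _ _ "\<lambda>z. x z + y z"]) (auto simp: Lm_add)
  show "(\<lambda>x. a (b x)) \<in> Lm ` M"
    using x y by (intro image_eqI[of _ _ "x \<circ> y"]) (auto simp: Lm_comp)
  show "cinner (a (b \<xi>)) \<xi> = cinner (b (a \<xi>)) \<xi>" using Lm_trace x y by simp
qed

lemma finite_rank_J_sandwich:
  assumes "finite_rank T"
  shows "finite_rank (\<lambda>v. J (T (J v)))"
proof -
  obtain B where B: "bounded_clinear T" "finite B" "range T \<subseteq> complex_vector.span B"
    using assms unfolding finite_rank_def by blast
  have "J x \<in> complex_vector.span (J ` B)" if x: "x \<in> complex_vector.span B" for x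
  proof -
    obtain u where "x = (\<Sum>v\<in>B. u v *\<^sub>C v)" using x complex_vector.span_finite[OF B(2)] by auto
    then have "J x = (\<Sum>v\<in>B. cnj (u v) *\<^sub>C J v)" by (simp add: J_sum J_scale)
    also have "\<dots> \<in> complex_vector.span (J ` B)"
      by (intro complex_vector.span_sum complex_vector.span_scale complex_vector.span_base imageI)
    finally show ?thesis .
  qed
  then have "range (\<lambda>v. J (T (J v))) \<subseteq> complex_vector.span (J ` B)" using B(3) by blast
  then show ?thesis
    unfolding finite_rank_def using J_sandwich_bdd[OF B(1)] B(2) by (intro conjI exI[of _ "J ` B"]) auto
qed

text \<open>\<open>J\<close> is an antilinear involution, so conjugating by it exchanges the relations between the \<open>J X\<^sub>j J\<close> with
  those between the \<open>X\<^sub>j\<close>.\<close>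

lemma rel_tuples_J:
  assumes "T \<in> rel_tuples Z"
  shows "(\<lambda>j v. J (T j (J v))) \<in> rel_tuples (\<lambda>j v. J (Z j (J v)))"
proof -
  have "commutator (\<lambda>v. J (T j (J v))) (\<lambda>v. J (Z j (J v))) v = J (commutator (T j) (Z j) (J v))" for j v
    by (simp add: commutator_def J_diff)
  then show ?thesis
    using assms by (auto simp: rel_tuples_def J_sum[symmetric] intro: finite_rank_J_sandwich)
qed

text \<open>Left multiplications commute with the \<open>J X\<^sub>j J\<close>, so the relations are closed under \<open>T \<mapsto> a T b\<close>.  If the
  dimension vanishes, every relation is orthogonal to the trace projection, hence so are all \<open>a T b\<close>, and
  this says that all matrix coefficients \<open>\<langle>T (\<iota> b), \<iota> a\<rangle>\<close> are zero.\<close>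

lemma Delta_eq_card_iff:
  fixes X :: "'n::finite \<Rightarrow> 'k \<Rightarrow> 'k"
  assumes X: "\<And>j. X j \<in> M"
  shows "Delta M \<iota> X = real (card (UNIV :: 'n set)) \<longleftrightarrow> rel_tuples (\<lambda>j. Lm (X j)) \<subseteq> {\<lambda>j v. 0}"
proof -
  define Y where "Y j = (\<lambda>v. J (Lm (X j) (J v)))" for j
  define V where "V = finite_rank_relations M \<iota> X"
  have V: "V = rel_tuples Y"
    by (simp add: V_def finite_rank_relations_def rel_tuples_def Y_def comp_def)
  have Yb: "bounded_clinear (Y j)" for j unfolding Y_def by (intro J_sandwich_bdd Lm_bdd X)
  have Vhs: "\<forall>T\<in>V. \<forall>j. hilbert_schmidt (T j)"
    unfolding V rel_tuples_def using finite_rank_hilbert_schmidt by blast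
  have V0: "(\<lambda>j v. 0) \<in> V" unfolding V by (rule rel_tuples_zero[OF Yb])
  have Vadd: "\<forall>S\<in>V. \<forall>T\<in>V. (\<lambda>j v. S j v + T j v) \<in> V" unfolding V using rel_tuples_add[of Y] Yb by blast
  have Vscale: "\<forall>c. \<forall>T\<in>V. (\<lambda>j v. c *\<^sub>C T j v) \<in> V" unfolding V using rel_tuples_scale[of Y] Yb by blast
  have dim0: "MvN_dim \<iota> (hs_closure V) = 0 \<longleftrightarrow> V \<subseteq> {\<lambda>j v. 0}"
  proof
    assume dim: "MvN_dim \<iota> (hs_closure V) = 0"
    show "V \<subseteq> {\<lambda>j v. 0}"
    proof
      fix T assume T: "T \<in> V"
      have bT: "bounded_clinear (T j)" for j using Vhs T hilbert_schmidt_bounded by blast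
      have sand: "(\<lambda>j v. Lm a (T j (Lm b v))) \<in> V" if ab: "a \<in> M" "b \<in> M" for a b
      proof -
        have YL: "Y j (Lm c v) = Lm c (Y j v)" if "c \<in> M" for j c v
          using J_Lm_J_commutes[OF X that] by (simp add: Y_def)
        have "commutator (\<lambda>v. Lm a (T j (Lm b v))) (Y j) v = Lm a (commutator (T j) (Y j) (Lm b v))" for j v
          using ab by (simp add: commutator_def YL bounded_clinear_simps[OF Lm_bdd])
        then have "(\<Sum>j\<in>UNIV. commutator (\<lambda>v. Lm a (T j (Lm b v))) (Y j) v)
            = Lm a (\<Sum>j\<in>UNIV. commutator (T j) (Y j) (Lm b v))" for v
          using ab by (simp add: bounded_clinear_simps(6)[OF Lm_bdd])
        also have "Lm a (\<Sum>j\<in>UNIV. commutator (T j) (Y j) (Lm b v)) = 0" for v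
          using T ab unfolding V rel_tuples_def by (simp add: bounded_clinear_simps(3)[OF Lm_bdd])
        finally show ?thesis
          using T ab unfolding V rel_tuples_def by (simp add: finite_rank_sandwich)
      qed
      have "T j (\<iota> b) = 0" if b: "b \<in> M" for j b
      proof -
        have "cinner (T j (\<iota> b)) x = 0" for x
        proof (rule continuous_eq_on_dense[where f = "\<lambda>x. cinner (T j (\<iota> b)) x" and g = "\<lambda>x. 0", OF _ _ _ iota_dense])
          fix x assume "x \<in> \<iota> ` M"
          then obtain a where a: "a \<in> M" "x = \<iota> a" by blast
          have "cinner (Lm (cadj a) (T j (Lm b \<xi>))) \<xi> = 0"
            using MvN_dim_eq_0D[OF Vhs V0 Vadd Vscale dim sand[OF cadj_M[OF a(1)] b], of j] .
          then show "cinner (T j (\<iota> b)) x = 0"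
            using a b by (simp add: Lm_cadj[symmetric] cadj_works_left)
        qed (intro continuous_intros)+
        then show ?thesis using cinner_self_eq_0 by blast
      qed
      then have "T j = (\<lambda>v. 0)" for j by (intro eq_on_iotaI bT) auto
      then show "T \<in> {\<lambda>j v. 0}" by (simp add: fun_eq_iff)
    qed
  next
    assume "V \<subseteq> {\<lambda>j v. 0}"
    then have "V = {\<lambda>j v. 0}" using V0 by blast
    then show "MvN_dim \<iota> (hs_closure V) = 0" by (simp add: hs_closure_zero MvN_dim_zero)
  qed
  have JJ: "(\<lambda>j v. J (Y j (J v))) = (\<lambda>j. Lm (X j))" by (simp add: Y_def)
  have "V \<subseteq> {\<lambda>j v. 0} \<longleftrightarrow> rel_tuples (\<lambda>j. Lm (X j)) \<subseteq> {\<lambda>j v. 0}"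
  proof -
    have unJ: "T = (\<lambda>j v. 0)" if "(\<lambda>j v. J (T j (J v))) = (\<lambda>j v. 0)" for T :: "'n \<Rightarrow> 'h \<Rightarrow> 'h"
    proof (intro ext)
      fix j v
      have "J (T j (J (J v))) = 0" using fun_cong[OF fun_cong[OF that], of j "J v"] .
      then show "T j v = 0" by (metis J_J J_zero)
    qed
    have 1: "(\<lambda>j v. J (T j (J v))) \<in> rel_tuples (\<lambda>j. Lm (X j))" if "T \<in> V" for T
      using rel_tuples_J[of T Y] that unfolding V JJ .
    have 2: "(\<lambda>j v. J (T j (J v))) \<in> V" if "T \<in> rel_tuples (\<lambda>j. Lm (X j))" for T
      using rel_tuples_J[OF that] unfolding V Y_def[abs_def] .
    show ?thesis
    proof
      assume a: "V \<subseteq> {\<lambda>j v. 0}"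
      show "rel_tuples (\<lambda>j. Lm (X j)) \<subseteq> {\<lambda>j v. 0}"
      proof
        fix T assume "T \<in> rel_tuples (\<lambda>j. Lm (X j))"
        then have "(\<lambda>j v. J (T j (J v))) = (\<lambda>j v. 0)" using 2 a by blast
        then show "T \<in> {\<lambda>j v. 0}" using unJ by simp
      qed
    next
      assume a: "rel_tuples (\<lambda>j. Lm (X j)) \<subseteq> {\<lambda>j v. 0}"
      show "V \<subseteq> {\<lambda>j v. 0}"
      proof
        fix T assume "T \<in> V"
        then have "(\<lambda>j v. J (T j (J v))) = (\<lambda>j v. 0)" using 1 a by blast
        then show "T \<in> {\<lambda>j v. 0}" using unJ by simp
      qed
    qed
  qed
  then show ?thesis using dim0 unfolding Delta_def V_def by simp
qed

lemma nc_eval_lin: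
  fixes X :: "'n::finite \<Rightarrow> 'k \<Rightarrow> 'k"
  shows "nc_eval X (lin A k l) = (\<lambda>v. \<Sum>r\<in>UNIV. A r k l *\<^sub>C augment X r v)"
proof
  fix v
  define K where "K = Word ` insert [] (range (\<lambda>i::'n. [i]))"
  have fK: "finite K" unfolding K_def by simp
  have sub: "Poly_Mapping.keys (lin A k l) \<subseteq> K"
  proof
    fix w assume w: "w \<in> Poly_Mapping.keys (lin A k l)"
    obtain u where u: "w = Word u" by (cases w)
    then have "cf (lin A k l) u \<noteq> 0" using w by (simp add: cf_def in_keys_iff)
    then show "w \<in> K" unfolding K_def u by (auto simp: cf_lin split: list.splits)
  qed
  have "nc_eval X (lin A k l) v = (\<Sum>w\<in>K. Poly_Mapping.lookup (lin A k l) w *\<^sub>C foldr (\<lambda>i f. X i \<circ> f) (letters w) id v)"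
    unfolding nc_eval_def using fK sub by (intro sum.mono_neutral_left) (auto simp: in_keys_iff)
  also have "\<dots> = (\<Sum>u\<in>insert [] (range (\<lambda>i. [i])). cf (lin A k l) u *\<^sub>C foldr (\<lambda>i f. X i \<circ> f) u id v)"
    unfolding K_def by (subst sum.reindex) (auto simp: cf_def intro: inj_onI)
  also have "\<dots> = A None k l *\<^sub>C v + (\<Sum>i\<in>UNIV. A (Some i) k l *\<^sub>C X i v)"
    by (subst sum.insert) (auto simp: cf_lin sum.reindex inj_on_def)
  finally show "nc_eval X (lin A k l) v = (\<Sum>r\<in>UNIV. A r k l *\<^sub>C augment X r v)"
    by (simp add: sum_option)
qed

lemma nc_eval_lin_M:
  assumes X: "\<And>j. X j \<in> M"
  shows "nc_eval X (lin A k l) \<in> M"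
    and "Lm (nc_eval X (lin A k l)) = (\<lambda>v. \<Sum>r\<in>UNIV. A r k l *\<^sub>C augment (\<lambda>j. Lm (X j)) r v)"
proof -
  have aM: "augment X r \<in> M" for r using X id_M by (cases r) (simp_all add: id_def)
  have aL: "Lm (augment X r) = augment (\<lambda>j. Lm (X j)) r" for r
    using Lm_id by (cases r) (simp_all add: id_def)
  show "nc_eval X (lin A k l) \<in> M"
    unfolding nc_eval_lin by (intro sum_M scale_M aM)
  show "Lm (nc_eval X (lin A k l)) = (\<lambda>v. \<Sum>r\<in>UNIV. A r k l *\<^sub>C augment (\<lambda>j. Lm (X j)) r v)"
    unfolding nc_eval_lin using Lm_sum[of UNIV "\<lambda>r v. A r k l *\<^sub>C augment X r v"] aM
    by (simp add: Lm_scale aL)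
qed

lemma L2_mat_ker_lin_mat:
  assumes X: "\<And>j. X j \<in> M"
  shows "L2_mat_ker M \<iota> (nc_eval_mat X (lin_mat N A))
      = {f \<in> carrier_vec N. vec_index f \<in> pker N N A (augment (\<lambda>j. Lm (X j)))}"
  unfolding L2_mat_ker_def pker_def nc_eval_mat_def
  by (auto simp: lin_mat_def nc_eval_lin_M(2)[OF X])

lemma L2_mat_ker_adj_lin_mat:
  assumes X: "\<And>j. X j \<in> M"
  shows "L2_mat_ker M \<iota> (op_mat_adj (nc_eval_mat X (lin_mat N A)))
      = {f \<in> carrier_vec N. vec_index f \<in> pker N N (dag A) (\<lambda>r. cadj (augment (\<lambda>j. Lm (X j)) r))}"
proof -
  have aL: "bounded_clinear (augment (\<lambda>j. Lm (X j)) r)" for r using X by (cases r) simp_all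
  have "Lm (cadj (nc_eval X (lin A k l)))
      = (\<lambda>v. \<Sum>r\<in>UNIV. dag A r l k *\<^sub>C cadj (augment (\<lambda>j. Lm (X j)) r) v)" for k l
    unfolding Lm_cadj[OF nc_eval_lin_M(1)[OF X], symmetric] nc_eval_lin_M(2)[OF X]
    by (subst cadj_sum) (auto simp: cadj_scale aL dag_def intro!: bounded_clinear_scale)
  then show ?thesis
    unfolding L2_mat_ker_def pker_def nc_eval_mat_def op_mat_adj_def
    by (auto simp: lin_mat_def)
qed

lemma pker_cong: "(\<And>l. l < q \<Longrightarrow> f l = g l) \<Longrightarrow> f \<in> pker p q A Z \<longleftrightarrow> g \<in> pker p q A Z"
  unfolding pker_def by simp

lemma lin_indep_components_vec: "lin_indep_components (Matrix.vec N f) \<longleftrightarrow> indep N f"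
  unfolding lin_indep_components_def indep_def by simp

text \<open>Write \<open>FR\<close> for the absence of nonzero finite rank relations.  The first condition is equivalent to
  \<open>FR\<close>, and the other two follow each other in the cycle from the second to \<open>FR\<close> to the third and back
  to the second.\<close>

theorem three_conditions:
  fixes X :: "'n::finite \<Rightarrow> 'k \<Rightarrow> 'k"
  assumes X: "\<And>j. X j \<in> M"
  defines "Z \<equiv> augment (\<lambda>j. Lm (X j))"
  shows "Delta M \<iota> X = real (card (UNIV :: 'n set)) \<longleftrightarrow>
      (\<forall>N A. (\<exists>f\<in>pker N N A Z. \<exists>e\<in>pker N N (dag A) (\<lambda>r. cadj (Z r)). indep N f \<and> indep N e) \<longrightarrow>
        (\<forall>r k l. k < N \<longrightarrow> l < N \<longrightarrow> A r k l = 0))" (is "?i \<longleftrightarrow> ?ii")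
    and "(\<forall>N A. (\<exists>f\<in>pker N N A Z. \<exists>e\<in>pker N N (dag A) (\<lambda>r. cadj (Z r)). indep N f \<and> indep N e) \<longrightarrow>
        (\<forall>r k l. k < N \<longrightarrow> l < N \<longrightarrow> A r k l = 0)) \<longleftrightarrow>
      (\<forall>N A. \<not> hollow N N A \<longrightarrow> trivial_pker N N A Z)" (is "_ \<longleftrightarrow> ?iii")
proof -
  interpret alg: tracial_operator_algebra "Lm ` M" \<xi> by (rule tracial_operator_algebra_Lm)
  let ?FR = "rel_tuples (\<lambda>j. Lm (X j)) \<subseteq> {\<lambda>j v. 0}"
  have LX: "Lm (X j) \<in> Lm ` M" for j using X by blast
  have bX: "bounded_clinear (Lm (X j))" for j using X by simp
  have ZM: "Z r \<in> Lm ` M" for r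
    using LX alg.id by (cases r) (simp_all add: Z_def)
  have bZ: "\<forall>r. bounded_clinear (Z r)" using ZM alg.bdd by blast
  then have bZs: "\<forall>r. bounded_clinear (cadj (Z r))" using bounded_clinear_cadj by blast
  have i: "?i \<longleftrightarrow> ?FR" by (rule Delta_eq_card_iff[OF X])
  have ii_FR: ?FR if ii: ?ii
  proof (rule relations_trivial_if_indep_kernels[OF bX])
    fix N :: nat and A :: "'n option pencil" and f e
    assume "f \<in> pker N N A (augment (\<lambda>j. Lm (X j)))"
      "e \<in> pker N N (dag A) (\<lambda>r. cadj (augment (\<lambda>j. Lm (X j)) r))" "indep N f" "indep N e"
    then show "\<forall>r k l. k < N \<longrightarrow> l < N \<longrightarrow> A r k l = 0" using ii unfolding Z_def by blast
  qed
  have FR_iii: ?iii if FR: ?FR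
    using alg.trivial_pker_if_relations_trivial[OF LX FR] unfolding Z_def by blast
  have iii_ii: ?ii if iii: ?iii
  proof -
    \<comment> \<open>The third condition passes to the adjoint tuple by finiteness.\<close>
    have sqs: "\<forall>N A. \<not> hollow N N A \<longrightarrow> trivial_pker N N A (\<lambda>r. cadj (Z r))"
    proof (intro allI impI)
      fix N and A :: "'n option pencil"
      assume "\<not> hollow N N A"
      then have "trivial_pker N N (dag A) Z" using iii hollow_dag by blast
      moreover have "(\<lambda>r. cadj (cadj (Z r))) = Z" using bZ by (simp add: cadj_cadj)
      ultimately have "trivial_pker N N (dag A) (\<lambda>r. cadj (cadj (Z r)))" by simp
      then show "trivial_pker N N A (\<lambda>r. cadj (Z r))"
        by (rule alg.trivial_pker_square_adjoint[where Z = "\<lambda>r. cadj (Z r)", OF alg.adj[OF ZM]])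
    qed
    show ?thesis using pencil_zero_if_indep_kernels[OF bZ bZs iii sqs] by blast
  qed
  show "?i \<longleftrightarrow> ?ii" using i ii_FR FR_iii iii_ii by blast
  show "?ii \<longleftrightarrow> ?iii" using ii_FR FR_iii iii_ii by blast
qed

end

theorem theorem3p1:
  fixes M :: "('k::complex_hilbert \<Rightarrow> 'k) set"
    and \<tau> :: "('k \<Rightarrow> 'k) \<Rightarrow> complex"
    and \<iota> :: "('k \<Rightarrow> 'k) \<Rightarrow> 'h::complex_hilbert"
    and X :: "'n::finite \<Rightarrow> 'k \<Rightarrow> 'k"
  assumes "tracial_Wstar_space M \<tau>"
    and "is_L2 M \<tau> \<iota>"
    and "\<forall>j. X j \<in> M"
  shows "((Delta M \<iota> X = real (card (UNIV :: 'n set))) \<longleftrightarrow>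
          (\<forall>N. \<forall>A :: 'n ncpoly mat. linear_nc_mat N A \<longrightarrow>
             (\<exists>f \<in> L2_mat_ker M \<iota> (nc_eval_mat X A).
              \<exists>e \<in> L2_mat_ker M \<iota> (op_mat_adj (nc_eval_mat X A)).
                lin_indep_components f \<and> lin_indep_components e) \<longrightarrow>
             A = 0\<^sub>m N N)) \<and>
         ((\<forall>N. \<forall>A :: 'n ncpoly mat. linear_nc_mat N A \<longrightarrow>
             (\<exists>f \<in> L2_mat_ker M \<iota> (nc_eval_mat X A).
              \<exists>e \<in> L2_mat_ker M \<iota> (op_mat_adj (nc_eval_mat X A)).
                lin_indep_components f \<and> lin_indep_components e) \<longrightarrow>
             A = 0\<^sub>m N N) \<longleftrightarrow>
          (\<forall>N. \<forall>A :: 'n ncpoly mat. linear_nc_mat N A \<longrightarrow> full_mat N A \<longrightarrow>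
             L2_mat_ker M \<iota> (nc_eval_mat X A) = {0\<^sub>v N}))"
proof -
  interpret tracial_L2 M \<tau> \<iota> using assms(1,2) by unfold_locales
  have X: "\<And>j. X j \<in> M" using assms(3) by blast
  define Z where "Z = augment (\<lambda>j. L2_left M \<iota> (X j))"
  have ker: "L2_mat_ker M \<iota> (nc_eval_mat X (lin_mat N A)) = {f \<in> carrier_vec N. vec_index f \<in> pker N N A Z}"
    "L2_mat_ker M \<iota> (op_mat_adj (nc_eval_mat X (lin_mat N A)))
      = {f \<in> carrier_vec N. vec_index f \<in> pker N N (dag A) (\<lambda>r. cadj (Z r))}" for N A
    unfolding Z_def by (rule L2_mat_ker_lin_mat[OF X], rule L2_mat_ker_adj_lin_mat[OF X])
  have indep_vec: "lin_indep_components f \<longleftrightarrow> indep N (vec_index f)" if "f \<in> carrier_vec N" for f :: "'h Matrix.vec" and N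
    using that by (simp add: lin_indep_components_def indep_def)
  have kernels: "(\<exists>f \<in> L2_mat_ker M \<iota> (nc_eval_mat X (lin_mat N A)).
        \<exists>e \<in> L2_mat_ker M \<iota> (op_mat_adj (nc_eval_mat X (lin_mat N A))).
          lin_indep_components f \<and> lin_indep_components e) \<longleftrightarrow>
      (\<exists>f\<in>pker N N A Z. \<exists>e\<in>pker N N (dag A) (\<lambda>r. cadj (Z r)). indep N f \<and> indep N e)"
    (is "?L \<longleftrightarrow> ?R") for N and A :: "'n option pencil"
  proof
    assume ?L
    then obtain f e where "f \<in> carrier_vec N" "vec_index f \<in> pker N N A Z" "e \<in> carrier_vec N"
        "vec_index e \<in> pker N N (dag A) (\<lambda>r. cadj (Z r))" "lin_indep_components f" "lin_indep_components e"
      unfolding ker by blast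
    then show ?R using indep_vec by blast
  next
    assume ?R
    then obtain f e where fe: "f \<in> pker N N A Z" "e \<in> pker N N (dag A) (\<lambda>r. cadj (Z r))" "indep N f" "indep N e"
      by blast
    have "vec_index (Matrix.vec N f) \<in> pker N N A Z" using fe(1) pker_cong[of N "vec_index (Matrix.vec N f)" f N A Z] by simp
    moreover have "vec_index (Matrix.vec N e) \<in> pker N N (dag A) (\<lambda>r. cadj (Z r))"
      using fe(2) pker_cong[of N "vec_index (Matrix.vec N e)" e N "dag A" "\<lambda>r. cadj (Z r)"] by simp
    ultimately show ?L
      unfolding ker using fe(3,4)
      by (intro bexI[of _ "Matrix.vec N f"] bexI[of _ "Matrix.vec N e"]) (simp_all add: lin_indep_components_vec)
  qed
  have trivial: "L2_mat_ker M \<iota> (nc_eval_mat X (lin_mat N A)) = {0\<^sub>v N} \<longleftrightarrow> trivial_pker N N A Z"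
    for N and A :: "'n option pencil"
  proof
    assume L: "L2_mat_ker M \<iota> (nc_eval_mat X (lin_mat N A)) = {0\<^sub>v N}"
    show "trivial_pker N N A Z"
      unfolding trivial_pker_def
    proof (intro ballI allI impI)
      fix f l assume f: "f \<in> pker N N A Z" and l: "l < N"
      have "vec_index (Matrix.vec N f) \<in> pker N N A Z" using f pker_cong[of N "vec_index (Matrix.vec N f)" f N A Z] by simp
      then have "Matrix.vec N f \<in> L2_mat_ker M \<iota> (nc_eval_mat X (lin_mat N A))" unfolding ker by simp
      then have "Matrix.vec N f = 0\<^sub>v N" unfolding L by simp
      then show "f l = 0" using l by (metis index_vec index_zero_vec(1))
    qed
  next
    assume t: "trivial_pker N N A Z"
    have bZ: "Z r 0 = 0" for r
      using X bounded_clinear_simps(3)[OF Lm_bdd] by (cases r) (simp_all add: Z_def)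
    have "f = 0\<^sub>v N" if "f \<in> carrier_vec N" "vec_index f \<in> pker N N A Z" for f
      using t that by (intro eq_vecI) (auto simp: trivial_pker_def)
    moreover have "vec_index (0\<^sub>v N) \<in> pker N N A Z" by (simp add: pker_def bZ)
    ultimately show "L2_mat_ker M \<iota> (nc_eval_mat X (lin_mat N A)) = {0\<^sub>v N}" unfolding ker by auto
  qed
  have ii: "(\<forall>N. \<forall>A :: 'n ncpoly mat. linear_nc_mat N A \<longrightarrow>
             (\<exists>f \<in> L2_mat_ker M \<iota> (nc_eval_mat X A).
              \<exists>e \<in> L2_mat_ker M \<iota> (op_mat_adj (nc_eval_mat X A)).
                lin_indep_components f \<and> lin_indep_components e) \<longrightarrow>
             A = 0\<^sub>m N N) \<longleftrightarrow>
      (\<forall>N A. (\<exists>f\<in>pker N N A Z. \<exists>e\<in>pker N N (dag A) (\<lambda>r. cadj (Z r)). indep N f \<and> indep N e) \<longrightarrow>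
        (\<forall>r k l. k < N \<longrightarrow> l < N \<longrightarrow> A r k l = 0))"
    unfolding kernels[symmetric] lin_mat_eq_0_iff[symmetric] linear_nc_mat_iff by blast
  have iii: "(\<forall>N. \<forall>A :: 'n ncpoly mat. linear_nc_mat N A \<longrightarrow> full_mat N A \<longrightarrow>
             L2_mat_ker M \<iota> (nc_eval_mat X A) = {0\<^sub>v N}) \<longleftrightarrow>
      (\<forall>N A. \<not> hollow N N A \<longrightarrow> trivial_pker N N A Z)"
  proof -
    \<comment> \<open>The empty matrix is neither full nor hollow; its kernel is trivial.\<close>
    have "trivial_pker 0 0 A Z" for A by (simp add: trivial_pker_def)
    moreover have "(\<forall>N. \<forall>A :: 'n ncpoly mat. linear_nc_mat N A \<longrightarrow> full_mat N A \<longrightarrow>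
             L2_mat_ker M \<iota> (nc_eval_mat X A) = {0\<^sub>v N}) \<longleftrightarrow>
        (\<forall>N A. 0 < N \<and> \<not> hollow N N A \<longrightarrow> trivial_pker N N A Z)"
      unfolding trivial[symmetric] full_lin_mat_iff[symmetric] linear_nc_mat_iff by blast
    ultimately show ?thesis by (metis gr0I)
  qed
  show ?thesis
    unfolding ii iii using three_conditions[of X, OF X] unfolding Z_def by blast
qed

end
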